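(* Assume that $n\geq 1$, $p>2$, $0<\sigma<1$, $q\in\mathbb{R}$ and $s>-\frac{\sigma p}{p-1}$. Then there exist two positive constants $c_0=c_0(n,\sigma,p,q,s)$ and $C_0=C_0(n,\sigma,p,q,s)$, a sequence of functions $\{K_j\}\subset C^\infty(\mathbb{R}^n)$ satisfying, for every $j$, $$-C_0\leq K_j(x)\leq -c_0,\quad c_0\leq|\nabla K_j(x)|\leq C_0,\quad\text{and}\quad |\nabla^2K_j(x)|\leq C_0,\qquad\text{in } B_2,$$ and a sequence of positive functions $\{u_j\}\subset C^\infty(\mathbb{R}^n)$ such that, for every $j$, $$(-\Delta)^\sigma_p u_j(x)=K_j(x)\,u_j^{q(p-1)}(x)\quad\text{for } x\in\mathbb{R}^n,\qquad |x|^s u_j(x)\to 1\quad\text{as } |x|\to\infty,$$ and $$\min_{\overline{B}_1}u_j\to\infty,\quad\text{as } j\to\infty.$$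
   Context: For $n\ge 1$, $p\geq 2$, $0<\sigma<1$, the fractional $p$-Laplacian is $$(-\Delta)^{\sigma}_{p}u(x)=c_{n,\sigma p}\,\mathrm{P.V.}\int_{\mathbb{R}^{n}}\frac{|u(x)-u(y)|^{p-2}(u(x)-u(y))}{|x-y|^{n+\sigma p}}\,dy,$$ where $c_{n,\sigma p}$ is a fixed positive constant and P.V. denotes the Cauchy principal value (the limit as $\varepsilon\to0^+$ of the integral over $\mathbb{R}^n\setminus B_\varepsilon(x)$). It is well defined for $u\in C^{\sigma p+\alpha}_{loc}(\mathbb{R}^n)\cap\mathcal{L}_{\sigma p}(\mathbb{R}^n)$ for some $\alpha>0$, where $$\mathcal{L}_{\sigma p}(\mathbb{R}^{n}):=\left\{u\in L^{p-1}_{loc}(\mathbb{R}^{n})\,:\,\int_{\mathbb{R}^{n}}\frac{|u(x)|^{p-1}}{1+|x|^{n+\sigma p}}\,dx<\infty\right\},$$ and $C^{\sigma p+\alpha}_{loc}:=C^{[\sigma p+\alpha],\,\sigma p+\alpha-[\sigma p+\alpha]}_{loc}$, with $[\sigma p+\alpha]$ the integer part of $\sigma p+\alpha$. Functions are real-valued. $B_r$ is the ball of radius $r$ centered at the origin in $\mathbb{R}^n$ and $\overline{B}_r$ its closure. The constants $c_0,C_0$ depend only on $n,\sigma,p,q,s$ and not on $j$. *)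

theory Defs
  imports "HOL-Analysis.Analysis"
begin

definition partial_deriv :: "'n \<Rightarrow> (real ^ 'n::finite \<Rightarrow> real) \<Rightarrow> real ^ 'n \<Rightarrow> real" where
  "partial_deriv i f x = frechet_derivative f (at x) (axis i 1)"

primrec Ck :: "nat \<Rightarrow> (real ^ 'n::finite \<Rightarrow> real) \<Rightarrow> bool" where
  "Ck 0 f \<longleftrightarrow> continuous_on UNIV f"
| "Ck (Suc k) f \<longleftrightarrow> (\<forall>x. f differentiable (at x)) \<and> (\<forall>i. Ck k (partial_deriv i f))"

definition smooth :: "(real ^ 'n::finite \<Rightarrow> real) \<Rightarrow> bool" where
  "smooth f \<longleftrightarrow> (\<forall>k. Ck k f)"

definition grad :: "(real ^ 'n::finite \<Rightarrow> real) \<Rightarrow> real ^ 'n \<Rightarrow> real ^ 'n" where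
  "grad f x = (\<chi> i. partial_deriv i f x)"

(* The norm on real ^ 'n ^ 'n is the Frobenius norm, so this is how |D^2 f| is measured. *)
definition hess :: "(real ^ 'n::finite \<Rightarrow> real) \<Rightarrow> real ^ 'n \<Rightarrow> real ^ 'n ^ 'n" where
  "hess f x = (\<chi> i j. partial_deriv i (partial_deriv j f) x)"

definition frac_p_kernel ::
  "real \<Rightarrow> real \<Rightarrow> (real ^ 'n::finite \<Rightarrow> real) \<Rightarrow> real ^ 'n \<Rightarrow> real ^ 'n \<Rightarrow> real" where
  "frac_p_kernel \<sigma> p u x y =
     \<bar>u x - u y\<bar> powr (p - 2) * (u x - u y) / norm (x - y) powr (real CARD('n) + \<sigma> * p)"

(* "The fractional p-Laplacian of u at x, with normalising constant c, exists and equals L".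
   A relation rather than a function: the library's integral and limit operators return
   unspecified values when they diverge, so an equation between values alone would not
   assert that the principal value exists. *)
definition has_frac_p_laplacian ::
  "real \<Rightarrow> real \<Rightarrow> real \<Rightarrow> (real ^ 'n::finite \<Rightarrow> real) \<Rightarrow> real ^ 'n \<Rightarrow> real \<Rightarrow> bool" where
  "has_frac_p_laplacian c \<sigma> p u x L \<longleftrightarrow>
     (\<forall>\<epsilon>>0. set_integrable lborel (- ball x \<epsilon>) (frac_p_kernel \<sigma> p u x)) \<and>
     ((\<lambda>\<epsilon>. c * (LINT y:- ball x \<epsilon>|lborel. frac_p_kernel \<sigma> p u x y)) \<longlongrightarrow> L) (at_right 0)"

end

theory Submission
  imports Defs "HOL-Analysis.Analysis" "HOL-Real_Asymp.Real_Asymp"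
begin

text \<open>A positive function that is constant, equal to \<open>v\<close>, on a ball has there the smooth operator
  \<open>c * (\<integral>y. |v - u y| powr (p - 2) * (v - u y) * norm (x - y) powr (- (n + \<sigma> * p)))\<close>.
  Take \<open>u = v + \<epsilon> * A\<close> with a fixed \<open>A \<ge> 0\<close>, radially monotone about a centre \<open>x0\<close> outside the ball,
  corrected very far away so that \<open>u\<close> behaves like \<open>norm x powr (- s)\<close>; the condition on \<open>s\<close> makes
  the contribution of the correction as small as desired. With \<open>\<epsilon> = v powr q\<close> the function
  \<open>K = u powr (- q * (p - 1)) * L\<close>, where \<open>L\<close> is the operator of \<open>u\<close>, is on the ball a \<open>C\<^sup>2\<close>-small
  perturbation of \<open>- c\<close> times the potential of \<open>A powr (p - 1)\<close>, which does not depend on \<open>v\<close>, is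
  positive and has a nonzero radial derivative because \<open>A\<close> is monotone. So \<open>v\<close> can tend to infinity.

  What remains is that \<open>L\<close> is smooth on the whole space although \<open>|t| powr (p - 2) * t\<close> is not. By
  similarity \<open>L\<close> reduces to integrals of the nonlinearity along a fixed pair of directions
  \<open>e + h\<close>, \<open>e - h\<close>, where it factors into a function of \<open>h\<close> alone and a power of a mean of the derivative
  of the profile. The profile is strictly monotone except on plateaus, and its derivative vanishes
  there to infinite order, so that all positive powers of such a mean are smooth.\<close>

text \<open>The operator loses smoothness where \<open>u y = u x\<close>. For a strictly monotone
  radial \<open>u\<close> this set is a sphere that moves with \<open>x\<close>. With
  \<open>a\<close> the logarithm of the distance from \<open>x\<close> to the centre, and
  \<open>b\<close> the logarithm of the ratio of the distances of \<open>y\<close> and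
  \<open>x\<close> to the centre, it becomes \<open>b = 0\<close> for all \<open>x\<close> at once,
  and only \<open>a\<close> is left to be differentiated: the degenerate factor
  \<open>spow p b\<close> never meets a derivative. What is differentiated is the power
  \<open>p - 1\<close> of a mean slope, which may vanish. Positive powers of a nonnegative function
  are smooth across its zeros if all its derivatives are bounded by each of its powers below the
  first. This class is stable under sums, products and averages, so it can be checked on exp (-1/t)
  and a few exponentials. The principal value converges because
  \<open>ln (norm (e + h)) + ln (norm (e - h))\<close> is quadratic in \<open>h\<close>. The bounds
  for the far correction do not involve the radius at which it begins, so this radius can be chosen
  after \<open>v\<close>, \<open>\<epsilon>\<close> and the tolerance.\<close>

section \<open>Bounds for all derivatives by weights, uniform in a parameter\<close>

definition dir_deriv :: "'a::euclidean_space \<Rightarrow> ('a \<Rightarrow> real) \<Rightarrow> 'a \<Rightarrow> real" where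
  "dir_deriv i f x = frechet_derivative f (at x) i"

text \<open>Every weight of \<open>B\<close> must bound \<open>g\<close>, each with its own
  constant, uniformly in the parameter and the point. A singleton expresses one majorant, a family
  of weights a bound with an arbitrarily small loss.\<close>

definition bounded_by ::
  "'a set \<Rightarrow> 'p set \<Rightarrow> ('p \<Rightarrow> 'a \<Rightarrow> real) set \<Rightarrow> ('p \<Rightarrow> 'a \<Rightarrow> real) \<Rightarrow> bool" where
  "bounded_by S P B g \<longleftrightarrow> (\<forall>\<beta>\<in>B. \<exists>C\<ge>0. \<forall>y\<in>P. \<forall>x\<in>S. \<bar>g y x\<bar> \<le> C * \<beta> y x)"

text \<open>The derivatives obey the same weights as the function, so a derivative of a member is a
  member of one order less, and inductions over \<open>n\<close> run with \<open>g\<close>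
  arbitrary. Derivatives are taken in the whole space, not within \<open>S\<close>.\<close>

primrec dbd ::
  "nat \<Rightarrow> 'a::euclidean_space set \<Rightarrow> 'p set \<Rightarrow> ('p \<Rightarrow> 'a \<Rightarrow> real) set \<Rightarrow> ('p \<Rightarrow> 'a \<Rightarrow> real) \<Rightarrow> bool" where
  "dbd 0 S P B g \<longleftrightarrow> bounded_by S P B g"
| "dbd (Suc n) S P B g \<longleftrightarrow> bounded_by S P B g \<and> (\<forall>y\<in>P. \<forall>x\<in>S. g y differentiable (at x)) \<and>
     (\<forall>i\<in>Basis. dbd n S P B (\<lambda>y. dir_deriv i (g y)))"

lemma dir_deriv_eq: "(f has_derivative f') (at x) \<Longrightarrow> dir_deriv i f x = f' i"
  by (metis dir_deriv_def frechet_derivative_at)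

lemma has_derivative_dir_deriv:
  "f differentiable (at x) \<Longrightarrow> (f has_derivative (\<lambda>v. dir_deriv v f x)) (at x)"
  unfolding dir_deriv_def by (metis eta_contract_eq frechet_derivative_works)

lemma dir_deriv_Basis_sum:
  assumes "f differentiable (at x)"
  shows "dir_deriv v f x = (\<Sum>i\<in>Basis. (v \<bullet> i) * dir_deriv i f x)"
proof -
  interpret bounded_linear "\<lambda>v. dir_deriv v f x"
    using has_derivative_dir_deriv[OF assms] by (rule has_derivative_bounded_linear)
  have "dir_deriv (\<Sum>i\<in>Basis. (v \<bullet> i) *\<^sub>R i) f x = (\<Sum>i\<in>Basis. (v \<bullet> i) * dir_deriv i f x)"
    by (simp add: sum scaleR)
  then show ?thesis by (simp add: euclidean_representation)
qed

lemma dir_deriv_cong: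
  assumes "open S" "x \<in> S" "\<And>x. x \<in> S \<Longrightarrow> f x = g x"
  shows "f differentiable (at x) \<longleftrightarrow> g differentiable (at x)"
    and "dir_deriv i f x = dir_deriv i g x"
proof -
  have *: "(f has_derivative D) (at x) \<longleftrightarrow> (g has_derivative D) (at x)" for D
    using assms by (metis has_derivative_transform_within_open)
  then show "f differentiable (at x) \<longleftrightarrow> g differentiable (at x)"
    unfolding differentiable_def by auto
  show "dir_deriv i f x = dir_deriv i g x"
    unfolding dir_deriv_def frechet_derivative_def using * by simp
qed

lemma dbd_cong:
  assumes "open S"
  shows "(\<And>y x. y \<in> P \<Longrightarrow> x \<in> S \<Longrightarrow> g y x = h y x) \<Longrightarrow> dbd n S P B g = dbd n S P B h"
proof (induction n arbitrary: g h)
  case 0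
  then show ?case by (simp add: bounded_by_def)
next
  case (Suc n)
  have "bounded_by S P B g = bounded_by S P B h"
    using Suc.prems by (simp add: bounded_by_def)
  moreover have "g y differentiable at x \<longleftrightarrow> h y differentiable at x" if "y \<in> P" "x \<in> S" for x y
    using dir_deriv_cong(1)[OF assms] Suc.prems that by blast
  moreover have "dbd n S P B (\<lambda>y. dir_deriv i (g y)) = dbd n S P B (\<lambda>y. dir_deriv i (h y))" for i
    by (rule Suc.IH) (use dir_deriv_cong(2)[OF assms] Suc.prems in blast)
  ultimately show ?case by simp
qed

lemma dbd_bounded_by: "dbd n S P B g \<Longrightarrow> bounded_by S P B g"
  by (cases n) auto

lemma dbd_Suc_D: "dbd (Suc n) S P B g \<Longrightarrow> dbd n S P B g"
  by (induction n arbitrary: g) auto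

text \<open>In the inductions below the derivative is known in closed form; this rule exchanges
  \<open>dir_deriv\<close> for that form.\<close>

lemma dbd_SucI:
  assumes "open S" "bounded_by S P B g"
    and "\<And>y x. y \<in> P \<Longrightarrow> x \<in> S \<Longrightarrow> (g y has_derivative G y x) (at x)"
    and "\<And>i. i \<in> Basis \<Longrightarrow> dbd n S P B (\<lambda>y x. G y x i)"
  shows "dbd (Suc n) S P B g"
proof -
  have "dbd n S P B (\<lambda>y. dir_deriv i (g y))" if "i \<in> Basis" for i
    using dbd_cong[OF assms(1), of P "\<lambda>y. dir_deriv i (g y)" "\<lambda>y x. G y x i"] assms(3,4) that dir_deriv_eq
    by blast
  then show ?thesis using assms(2,3) by (auto simp: differentiable_def)
qed

lemma bounded_by_weaken:
  assumes "bounded_by S P B g" "S' \<subseteq> S" "P' \<subseteq> P"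
    and "\<And>\<beta>'. \<beta>' \<in> B' \<Longrightarrow> \<exists>\<beta>\<in>B. \<exists>C\<ge>0. \<forall>y\<in>P'. \<forall>x\<in>S'. \<beta> y x \<le> C * \<beta>' y x"
  shows "bounded_by S' P' B' g"
  unfolding bounded_by_def
proof
  fix \<beta>' assume "\<beta>' \<in> B'"
  then obtain \<beta> C where 1: "\<beta> \<in> B" "C \<ge> 0" "\<And>y x. y \<in> P' \<Longrightarrow> x \<in> S' \<Longrightarrow> \<beta> y x \<le> C * \<beta>' y x"
    using assms(4) by blast
  then obtain C1 where 2: "C1 \<ge> 0" "\<And>y x. y \<in> P \<Longrightarrow> x \<in> S \<Longrightarrow> \<bar>g y x\<bar> \<le> C1 * \<beta> y x"
    using assms(1) unfolding bounded_by_def by blast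
  have "\<bar>g y x\<bar> \<le> (C1 * C) * \<beta>' y x" if "y \<in> P'" "x \<in> S'" for x y
  proof -
    have "\<bar>g y x\<bar> \<le> C1 * \<beta> y x" using 2(2)[of y x] that assms(2,3) by blast
    also have "\<dots> \<le> C1 * (C * \<beta>' y x)" using mult_left_mono[OF 1(3)[OF that] 2(1)] .
    finally show ?thesis by (simp add: mult.assoc)
  qed
  then show "\<exists>C\<ge>0. \<forall>y\<in>P'. \<forall>x\<in>S'. \<bar>g y x\<bar> \<le> C * \<beta>' y x"
    using 1(2) 2(1) by (intro exI[of _ "C1 * C"]) auto
qed

lemma dbd_weaken:
  assumes "S' \<subseteq> S" "P' \<subseteq> P"
    and "\<And>\<beta>'. \<beta>' \<in> B' \<Longrightarrow> \<exists>\<beta>\<in>B. \<exists>C\<ge>0. \<forall>y\<in>P'. \<forall>x\<in>S'. \<beta> y x \<le> C * \<beta>' y x"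
  shows "dbd n S P B g \<Longrightarrow> dbd n S' P' B' g"
proof (induction n arbitrary: g)
  case 0
  then show ?case using bounded_by_weaken[OF _ assms] by simp
next
  case (Suc n)
  have "bounded_by S' P' B' g"
    by (rule bounded_by_weaken[OF _ assms]) (use Suc.prems in auto)
  moreover have "g y differentiable at x" if "y \<in> P'" "x \<in> S'" for x y
    using Suc.prems assms(1,2) that by (simp add: subset_iff)
  ultimately show ?case using Suc by simp
qed

lemma bounded_by_singleI:
  assumes "\<And>y x. y \<in> P \<Longrightarrow> x \<in> S \<Longrightarrow> \<bar>g y x\<bar> \<le> K * \<beta> y x" "K \<ge> 0"
  shows "bounded_by S P {\<beta>} g"
  unfolding bounded_by_def using assms by blast

lemma bounded_by_add:
  assumes "bounded_by S P B g" "bounded_by S P B h"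
  shows "bounded_by S P B (\<lambda>y x. g y x + h y x)"
  unfolding bounded_by_def
proof
  fix \<beta> assume "\<beta> \<in> B"
  then obtain C1 C2 where "C1 \<ge> 0" "\<And>y x. y \<in> P \<Longrightarrow> x \<in> S \<Longrightarrow> \<bar>g y x\<bar> \<le> C1 * \<beta> y x"
      "C2 \<ge> 0" "\<And>y x. y \<in> P \<Longrightarrow> x \<in> S \<Longrightarrow> \<bar>h y x\<bar> \<le> C2 * \<beta> y x"
    using assms unfolding bounded_by_def by meson
  then show "\<exists>C\<ge>0. \<forall>y\<in>P. \<forall>x\<in>S. \<bar>g y x + h y x\<bar> \<le> C * \<beta> y x"
    by (intro exI[of _ "C1 + C2"]) (fastforce simp: distrib_right)
qed

lemma bounded_by_mult:
  assumes "bounded_by S P B1 g" "bounded_by S P B2 h"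
    and "\<And>\<beta>. \<beta> \<in> B \<Longrightarrow> \<exists>\<beta>1\<in>B1. \<exists>\<beta>2\<in>B2. \<exists>C\<ge>0. \<forall>y\<in>P. \<forall>x\<in>S. \<beta>1 y x * \<beta>2 y x \<le> C * \<beta> y x"
  shows "bounded_by S P B (\<lambda>y x. g y x * h y x)"
  unfolding bounded_by_def
proof
  fix \<beta> assume "\<beta> \<in> B"
  from assms(3)[OF this] obtain \<beta>1 \<beta>2 C where "\<beta>1 \<in> B1" "\<beta>2 \<in> B2" and C: "C \<ge> 0"
      "\<And>y x. y \<in> P \<Longrightarrow> x \<in> S \<Longrightarrow> \<beta>1 y x * \<beta>2 y x \<le> C * \<beta> y x"
    by blast
  with assms(1,2) obtain C1 C2 where *: "C1 \<ge> 0" "\<And>y x. y \<in> P \<Longrightarrow> x \<in> S \<Longrightarrow> \<bar>g y x\<bar> \<le> C1 * \<beta>1 y x"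
      "C2 \<ge> 0" "\<And>y x. y \<in> P \<Longrightarrow> x \<in> S \<Longrightarrow> \<bar>h y x\<bar> \<le> C2 * \<beta>2 y x"
    unfolding bounded_by_def by meson
  have "\<bar>g y x * h y x\<bar> \<le> (C1 * C2 * C) * \<beta> y x" if yx: "y \<in> P" "x \<in> S" for y x
  proof -
    have "\<bar>g y x * h y x\<bar> \<le> (C1 * \<beta>1 y x) * (C2 * \<beta>2 y x)"
      unfolding abs_mult using *(2,4)[OF yx] by (intro mult_mono) auto
    also have "\<dots> = (C1 * C2) * (\<beta>1 y x * \<beta>2 y x)" by simp
    also have "\<dots> \<le> (C1 * C2) * (C * \<beta> y x)"
      using C(2)[OF yx] * by (intro mult_left_mono) auto
    finally show ?thesis by (simp add: mult.assoc)
  qed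
  then show "\<exists>C\<ge>0. \<forall>y\<in>P. \<forall>x\<in>S. \<bar>g y x * h y x\<bar> \<le> C * \<beta> y x"
    using C(1) * by (intro exI[of _ "C1 * C2 * C"]) auto
qed

lemma dbd_add:
  assumes "open S"
  shows "dbd n S P B g \<Longrightarrow> dbd n S P B h \<Longrightarrow> dbd n S P B (\<lambda>y x. g y x + h y x)"
proof (induction n arbitrary: g h)
  case 0
  then show ?case by (simp add: bounded_by_add)
next
  case (Suc n)
  show ?case
  proof (rule dbd_SucI[OF assms])
    show "bounded_by S P B (\<lambda>y x. g y x + h y x)"
      using Suc.prems by (simp add: bounded_by_add)
    show "((\<lambda>x. g y x + h y x) has_derivative (\<lambda>i. dir_deriv i (g y) x + dir_deriv i (h y) x)) (at x)"
      if "y \<in> P" "x \<in> S" for x y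
      using Suc.prems that by (intro has_derivative_add has_derivative_dir_deriv) auto
    show "dbd n S P B (\<lambda>y x. dir_deriv i (g y) x + dir_deriv i (h y) x)" if "i \<in> Basis" for i
      using Suc.prems that by (intro Suc.IH) auto
  qed
qed

text \<open>In the Leibniz rule the weights of a factor also serve its derivatives, so one
  compatibility condition between the weight sets covers all orders.\<close>

lemma dbd_mult:
  assumes "open S"
    and "\<And>\<beta>. \<beta> \<in> B \<Longrightarrow> \<exists>\<beta>1\<in>B1. \<exists>\<beta>2\<in>B2. \<exists>C\<ge>0. \<forall>y\<in>P. \<forall>x\<in>S. \<beta>1 y x * \<beta>2 y x \<le> C * \<beta> y x"
  shows "dbd n S P B1 g \<Longrightarrow> dbd n S P B2 h \<Longrightarrow> dbd n S P B (\<lambda>y x. g y x * h y x)"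
proof (induction n arbitrary: g h)
  case 0
  then show ?case using bounded_by_mult[OF _ _ assms(2)] by simp
next
  case (Suc n)
  show ?case
  proof (rule dbd_SucI[OF assms(1)])
    show "bounded_by S P B (\<lambda>y x. g y x * h y x)"
      using Suc.prems bounded_by_mult[OF _ _ assms(2)] by simp
    show "((\<lambda>x. g y x * h y x) has_derivative (\<lambda>i. g y x * dir_deriv i (h y) x + dir_deriv i (g y) x * h y x)) (at x)"
      if "y \<in> P" "x \<in> S" for x y
      using Suc.prems that by (intro has_derivative_mult has_derivative_dir_deriv) auto
    show "dbd n S P B (\<lambda>y x. g y x * dir_deriv i (h y) x + dir_deriv i (g y) x * h y x)" if "i \<in> Basis" for i
      using Suc.prems that dbd_Suc_D[OF Suc.prems(1)] dbd_Suc_D[OF Suc.prems(2)]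
      by (intro dbd_add[OF assms(1)] Suc.IH) auto
  qed
qed

lemma dbd_param_const:
  assumes "open S" "bounded_by S P B (\<lambda>y x. c y)"
    and "\<And>\<beta> y x. \<beta> \<in> B \<Longrightarrow> y \<in> P \<Longrightarrow> x \<in> S \<Longrightarrow> \<beta> y x \<ge> 0"
  shows "dbd n S P B (\<lambda>y x. c y)"
proof -
  have "dbd n S P B (\<lambda>y x. c y)" if "bounded_by S P B (\<lambda>y x. c y)" for c
    using that
  proof (induction n arbitrary: c)
    case 0
    then show ?case by simp
  next
    case (Suc n)
    show ?case
      by (rule dbd_SucI[OF assms(1)])
        (use Suc assms(3) in \<open>auto intro!: has_derivative_const Suc.IH[of "\<lambda>_. 0"] exI[of _ "0::real"] simp: bounded_by_def\<close>)
  qed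
  with assms show ?thesis by simp
qed

lemma dbd_param_mult:
  assumes "open S" "\<And>y. y \<in> P \<Longrightarrow> \<bar>c y\<bar> \<le> K" "dbd n S P B g"
  shows "dbd n S P B (\<lambda>y x. c y * g y x)"
proof (rule dbd_mult[where ?B1.0 = "{\<lambda>y x. 1}" and ?B2.0 = B, OF assms(1) _ _ assms(3)])
  have "\<bar>c y\<bar> \<le> max K 0" if "y \<in> P" for y
    using assms(2)[OF that] by simp
  then have "bounded_by S P {\<lambda>y x. 1} (\<lambda>y x. c y)"
    by (intro bounded_by_singleI[of _ _ _ "max K 0"]) auto
  then show "dbd n S P {\<lambda>y x. 1} (\<lambda>y x. c y)"
    by (rule dbd_param_const[OF assms(1)]) auto
next
  show "\<exists>\<beta>1\<in>{\<lambda>y x. 1}. \<exists>\<beta>2\<in>B. \<exists>C\<ge>0. \<forall>y\<in>P. \<forall>x\<in>S. \<beta>1 y x * \<beta>2 y x \<le> C * \<beta> y x" if "\<beta> \<in> B" for \<beta>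
    using that by (auto intro!: bexI[of _ \<beta>] exI[of _ "1::real"])
qed

text \<open>Each differentiation produces a coefficient \<open>l y i\<close>, bounded over the
  parameters, and replaces the one-dimensional \<open>f\<close> by its derivative.\<close>

lemma dbd_affine:
  fixes l :: "'p \<Rightarrow> 'a::euclidean_space \<Rightarrow> real"
  assumes "open S" and l: "\<And>y. y \<in> P \<Longrightarrow> bounded_linear (l y)"
    and lS: "\<And>y x. y \<in> P \<Longrightarrow> x \<in> S \<Longrightarrow> l y x + c y \<in> T"
    and lK: "\<And>i. i \<in> Basis \<Longrightarrow> \<exists>K. \<forall>y\<in>P. \<bar>l y i\<bar> \<le> K"
  shows "dbd n T {()} B (\<lambda>_. f) \<Longrightarrow> dbd n S P ((\<lambda>\<beta> y x. \<beta> () (l y x + c y)) ` B) (\<lambda>y x. f (l y x + c y))"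
proof (induction n arbitrary: f)
  case (0 f)
  have "bounded_by T {()} B (\<lambda>_. f)" using 0 by simp
  then show ?case using lS by (fastforce simp: bounded_by_def)
next
  case (Suc n)
  show ?case
  proof (rule dbd_SucI[OF assms(1)])
    have "bounded_by T {()} B (\<lambda>_. f)" using Suc.prems by simp
    then show "bounded_by S P ((\<lambda>\<beta> y x. \<beta> () (l y x + c y)) ` B) (\<lambda>y x. f (l y x + c y))"
      using lS by (fastforce simp: bounded_by_def)
    show "((\<lambda>x. f (l y x + c y)) has_derivative (\<lambda>i. l y i * dir_deriv 1 f (l y x + c y))) (at x)" if "y \<in> P" "x \<in> S" for x y
    proof -
      have "f differentiable at (l y x + c y)" using Suc.prems lS[OF that] by auto
      from has_derivative_dir_deriv[OF this] have 1: "(f has_derivative (\<lambda>v. v * dir_deriv 1 f (l y x + c y))) (at (l y x + c y))"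
        by (subst (asm) dir_deriv_Basis_sum[OF \<open>f differentiable at (l y x + c y)\<close>]) simp
      have 2: "((\<lambda>x. l y x + c y) has_derivative l y) (at x)"
        using bounded_linear_imp_has_derivative[OF l[OF that(1)]]
        by (auto intro!: derivative_eq_intros)
      show ?thesis using diff_chain_at[OF 2 1] by (simp add: comp_def)
    qed
    show "dbd n S P ((\<lambda>\<beta> y x. \<beta> () (l y x + c y)) ` B) (\<lambda>y x. l y i * dir_deriv 1 f (l y x + c y))" if "i \<in> Basis" for i
      using lK[OF that] Suc.prems by (auto intro!: dbd_param_mult[OF assms(1)] Suc.IH)
  qed
qed

text \<open>The exponential reproduces itself under differentiation up to factors that are bounded
  with all their derivatives, so it is its own weight without any loss.\<close>

lemma dbd_exp:
  assumes "open S" "\<And>y x. y \<in> P \<Longrightarrow> x \<in> S \<Longrightarrow> (g y has_derivative G y x) (at x)"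
    and G: "\<And>i n. i \<in> Basis \<Longrightarrow> dbd n S P {\<lambda>y x. 1} (\<lambda>y x. G y x i)"
  shows "dbd n S P {\<lambda>y x. exp (g y x)} (\<lambda>y x. exp (g y x))"
proof (induction n)
  case 0
  then show ?case using bounded_by_singleI[of P S _ 1] by simp
next
  case (Suc n)
  show ?case
  proof (rule dbd_SucI[OF assms(1)])
    show "((\<lambda>x. exp (g y x)) has_derivative (\<lambda>i. G y x i * exp (g y x))) (at x)" if "y \<in> P" "x \<in> S" for x y
      using assms(2)[OF that] by (auto intro!: derivative_eq_intros)
    show "dbd n S P {\<lambda>y x. exp (g y x)} (\<lambda>y x. G y x i * exp (g y x))" if "i \<in> Basis" for i
      by (rule dbd_mult[where ?B1.0 = "{\<lambda>y x. 1}" and ?B2.0 = "{\<lambda>y x. exp (g y x)}", OF assms(1) _ G[OF that] Suc]) (auto intro: exI[of _ "1::real"])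
  qed (rule bounded_by_singleI[of _ _ _ 1], auto)
qed

text \<open>The powers of a weight, up to an arbitrarily small loss in the exponent; the loss makes
  the flat functions below comparable with all of their derivatives.\<close>

definition powers :: "('p \<Rightarrow> 'a \<Rightarrow> real) \<Rightarrow> real \<Rightarrow> ('p \<Rightarrow> 'a \<Rightarrow> real) set" where
  "powers w m = (\<lambda>\<epsilon> y x. w y x powr (m - \<epsilon>)) ` {0<..<1}"

text \<open>The loss \<open>\<epsilon>\<close> of the product is shared evenly by the two
  factors.\<close>

lemma dbd_powers_mult:
  assumes "open S" "dbd n S P (powers w m) g" "dbd n S P (powers w m') h"
  shows "dbd n S P (powers w (m + m')) (\<lambda>y x. g y x * h y x)"
proof (rule dbd_mult[where ?B1.0 = "powers w m" and ?B2.0 = "powers w m'", OF assms(1) _ assms(2,3)])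
  fix \<beta> assume "\<beta> \<in> powers w (m + m')"
  then obtain \<epsilon> where \<epsilon>: "0 < \<epsilon>" "\<epsilon> < 1" "\<beta> = (\<lambda>y x. w y x powr (m + m' - \<epsilon>))" by (auto simp: powers_def)
  show "\<exists>\<beta>1\<in>powers w m. \<exists>\<beta>2\<in>powers w m'. \<exists>C\<ge>0. \<forall>y\<in>P. \<forall>x\<in>S. \<beta>1 y x * \<beta>2 y x \<le> C * \<beta> y x"
    using \<epsilon> by (auto simp: powers_def powr_add[symmetric] intro!: bexI[of _ "\<epsilon>/2"] exI[of _ "1::real"])
qed

text \<open>Here each factor keeps its own weight and both use the same loss, since a power of a
  product is the product of the powers.\<close>

lemma dbd_powers_mult_weight:
  assumes "open S" "dbd n S P (powers w 1) g" "dbd n S P (powers w' 1) h"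
    and "\<And>y x. y \<in> P \<Longrightarrow> x \<in> S \<Longrightarrow> w y x \<ge> 0 \<and> w' y x \<ge> 0"
  shows "dbd n S P (powers (\<lambda>y x. w y x * w' y x) 1) (\<lambda>y x. g y x * h y x)"
proof (rule dbd_mult[where ?B1.0 = "powers w 1" and ?B2.0 = "powers w' 1", OF assms(1) _ assms(2,3)])
  fix \<beta> assume "\<beta> \<in> powers (\<lambda>y x. w y x * w' y x) 1"
  then obtain \<epsilon> where \<epsilon>: "0 < \<epsilon>" "\<epsilon> < 1" "\<beta> = (\<lambda>y x. (w y x * w' y x) powr (1 - \<epsilon>))" by (auto simp: powers_def)
  show "\<exists>\<beta>1\<in>powers w 1. \<exists>\<beta>2\<in>powers w' 1. \<exists>C\<ge>0. \<forall>y\<in>P. \<forall>x\<in>S. \<beta>1 y x * \<beta>2 y x \<le> C * \<beta> y x"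
    using \<epsilon> assms(4) by (auto simp: powers_def powr_mult intro!: bexI[of _ "\<epsilon>"] exI[of _ "1::real"])
qed

lemma dbd_powers_le:
  assumes "dbd n S P (powers w 1) g" "\<And>y x. y \<in> P \<Longrightarrow> x \<in> S \<Longrightarrow> 0 \<le> w y x \<and> w y x \<le> w' y x"
  shows "dbd n S P (powers w' 1) g"
proof (rule dbd_weaken[OF order_refl order_refl _ assms(1)])
  fix \<beta> assume "\<beta> \<in> powers w' 1"
  then obtain \<epsilon> where "0 < \<epsilon>" "\<epsilon> < 1" "\<beta> = (\<lambda>y x. w' y x powr (1 - \<epsilon>))" by (auto simp: powers_def)
  then show "\<exists>\<beta>'\<in>powers w 1. \<exists>C\<ge>0. \<forall>y\<in>P. \<forall>x\<in>S. \<beta>' y x \<le> C * \<beta> y x"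
    using assms(2) by (auto simp: powers_def intro!: bexI[of _ "\<epsilon>"] exI[of _ "1::real"] powr_mono2)
qed

text \<open>For a bounded weight \<open>w = w powr \<epsilon> * w powr (1 - \<epsilon>)\<close> is
  at most a constant times the second factor, so a bound without loss gives all bounds with
  loss.\<close>

lemma dbd_powers_self_bounded:
  assumes "dbd n S P {w} g" "\<And>y x. y \<in> P \<Longrightarrow> x \<in> S \<Longrightarrow> 0 \<le> w y x \<and> w y x \<le> K"
  shows "dbd n S P (powers w 1) g"
proof (rule dbd_weaken[OF order_refl order_refl _ assms(1)])
  fix \<beta> assume "\<beta> \<in> powers w 1"
  then obtain \<epsilon> where \<epsilon>: "0 < \<epsilon>" "\<epsilon> < 1" "\<beta> = (\<lambda>y x. w y x powr (1 - \<epsilon>))" by (auto simp: powers_def)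
  have "w y x \<le> K powr \<epsilon> * w y x powr (1 - \<epsilon>)" if "y \<in> P" "x \<in> S" for x y
  proof -
    have "w y x = w y x powr \<epsilon> * w y x powr (1 - \<epsilon>)"
      using assms(2)[OF that] by (simp add: powr_add[symmetric])
    also have "\<dots> \<le> K powr \<epsilon> * w y x powr (1 - \<epsilon>)"
      using assms(2)[OF that] \<epsilon> by (intro mult_right_mono powr_mono2) auto
    finally show ?thesis .
  qed
  then show "\<exists>\<beta>'\<in>{w}. \<exists>C\<ge>0. \<forall>y\<in>P. \<forall>x\<in>S. \<beta>' y x \<le> C * \<beta> y x"
    using \<epsilon> by (auto intro!: exI[of _ "K powr \<epsilon>"])
qed

section \<open>Real powers of functions that vanish to infinite order\<close>

text \<open>Used at zeros of flat functions, where the chain rule for powers does not apply.\<close>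

lemma has_derivative_zero_quadratic:
  fixes F :: "'a::real_normed_vector \<Rightarrow> real"
  assumes "F x = 0" "\<forall>\<^sub>F z in at x. \<bar>F z\<bar> \<le> M * (norm (z - x))\<^sup>2"
  shows "(F has_derivative (\<lambda>_. 0)) (at x)"
  unfolding has_derivative_iff_norm
proof (intro conjI)
  show "((\<lambda>z. norm (F z - F x - 0) / norm (z - x)) \<longlongrightarrow> 0) (at x)"
  proof (rule tendsto_sandwich[OF _ _ tendsto_const])
    show "\<forall>\<^sub>F z in at x. norm (F z - F x - 0) / norm (z - x) \<le> M * norm (z - x)"
      using assms(2) eventually_neq_at_within[of x x UNIV]
    proof eventually_elim
      case (elim z)
      then have "norm (F z - F x - 0) / norm (z - x) \<le> (M * (norm (z - x))\<^sup>2) / norm (z - x)"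
        using assms(1) by (intro divide_right_mono) auto
      also have "\<dots> = M * norm (z - x)"
        using elim by (simp add: power2_eq_square)
      finally show ?case .
    qed
    have "((\<lambda>z. M * norm (z - x)) \<longlongrightarrow> M * norm (x - x)) (at x)"
      by (intro tendsto_intros)
    then show "((\<lambda>z. M * norm (z - x)) \<longlongrightarrow> 0) (at x)" by simp
  qed auto
qed simp

lemma dir_deriv_bound:
  fixes B :: real
  assumes "f differentiable (at x)" "\<And>i. i \<in> Basis \<Longrightarrow> \<bar>dir_deriv i f x\<bar> \<le> B"
  shows "\<bar>dir_deriv v f (x::'a::euclidean_space)\<bar> \<le> DIM('a) * B * norm v"
proof -
  have "\<bar>dir_deriv v f x\<bar> \<le> (\<Sum>i\<in>Basis. \<bar>(v \<bullet> i) * dir_deriv i f x\<bar>)"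
    unfolding dir_deriv_Basis_sum[OF assms(1), of v] by (rule sum_abs)
  also have "\<dots> \<le> (\<Sum>i\<in>(Basis::'a set). norm v * B)"
    unfolding abs_mult using assms(2) by (intro sum_mono mult_mono Basis_le_norm) auto
  finally show ?thesis by (simp add: mult.commute mult.left_commute)
qed

text \<open>The vanishing order at a zero is infinite: \<open>(f + \<delta>) powr \<eta>\<close> is Lipschitz uniformly in \<open>\<delta>\<close>.\<close>

lemma powr_le_dist_zero:
  fixes f :: "'a::euclidean_space \<Rightarrow> real" and \<eta> C :: real
  assumes "\<And>z. z \<in> ball x r \<Longrightarrow> 0 \<le> f z"
    and d: "\<And>z. z \<in> ball x r \<Longrightarrow> f differentiable (at z)"
    and C: "\<And>z i. z \<in> ball x r \<Longrightarrow> i \<in> Basis \<Longrightarrow> \<bar>dir_deriv i f z\<bar> \<le> C * f z powr (1 - \<eta>)"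
    and "f x = 0" "0 < \<eta>" "\<eta> < 1" "z \<in> ball x r" "C \<ge> 0"
  shows "f z powr \<eta> \<le> \<eta> * (DIM('a) * C) * norm (z - x)"
proof (rule field_le_epsilon)
  fix e :: real assume "e > 0"
  \<comment> \<open>With this shift \<open>f x = 0\<close> gives
    \<open>(f x + \<delta>) powr \<eta> = e\<close>, so the shift costs exactly the permitted
    error.\<close>
  define \<delta> where "\<delta> = e powr (1 / \<eta>)"
  have \<delta>: "\<delta> > 0" "\<delta> powr \<eta> = e" using \<open>e > 0\<close> \<open>0 < \<eta>\<close> by (auto simp: \<delta>_def powr_powr)
  let ?h = "\<lambda>z. (f z + \<delta>) powr \<eta>"
  let ?h' = "\<lambda>z v. \<eta> * (f z + \<delta>) powr (\<eta> - 1) * dir_deriv v f z"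
  have "norm (?h z - ?h x) \<le> (\<eta> * (DIM('a) * C)) * norm (z - x)"
  proof (rule differentiable_bound[of "ball x r" _ ?h'])
    fix w assume w: "w \<in> ball x r"
    have pos: "f w + \<delta> > 0" using assms(1)[OF w] \<delta>(1) by simp
    show "(?h has_derivative ?h' w) (at w within ball x r)"
      using pos by (rule_tac has_derivative_at_withinI)
        (auto intro!: derivative_eq_intros has_derivative_dir_deriv[OF d[OF w]] simp: powr_diff field_simps)
    show "onorm (?h' w) \<le> \<eta> * (DIM('a) * C)"
    proof (rule onorm_le)
      fix v
      have "\<bar>dir_deriv v f w\<bar> \<le> DIM('a) * (C * f w powr (1 - \<eta>)) * norm v"
        using C[OF w] by (intro dir_deriv_bound d w) auto
      then have "norm (?h' w v) \<le> \<eta> * (f w + \<delta>) powr (\<eta> - 1) * (DIM('a) * (C * f w powr (1 - \<eta>)) * norm v)"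
        using assms(5) by (auto simp: abs_mult intro!: mult_left_mono)
      \<comment> \<open>Enlarging \<open>f w\<close> to \<open>f w + \<delta>\<close> in the bound
        for the derivative makes the two opposite powers cancel; the Lipschitz constant is then free
        of \<open>\<delta>\<close>.\<close>
      also have "\<dots> \<le> \<eta> * (f w + \<delta>) powr (\<eta> - 1) * (DIM('a) * (C * (f w + \<delta>) powr (1 - \<eta>)) * norm v)"
        using assms(5,6,8) assms(1)[OF w] \<delta>(1)
        by (intro mult_left_mono mult_right_mono powr_mono2) auto
      also have "\<dots> = \<eta> * ((f w + \<delta>) powr (\<eta> - 1) * (f w + \<delta>) powr (1 - \<eta>)) * (DIM('a) * C) * norm v"
        by (simp only: ac_simps)
      also have "\<dots> = \<eta> * (DIM('a) * C) * norm v"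
        using pos by (simp add: powr_add[symmetric])
      finally show "norm (?h' w v) \<le> \<eta> * (DIM('a) * C) * norm v" .
    qed
  qed (use assms(7) in \<open>auto simp: dist_norm intro: le_less_trans[OF norm_ge_zero]\<close>)
  then have "?h z \<le> e + \<eta> * (DIM('a) * C) * norm (z - x)"
    using \<delta> assms(4) by simp
  moreover have "f z powr \<eta> \<le> ?h z"
    using assms(1)[OF assms(7)] \<delta>(1) assms(5) by (intro powr_mono2) auto
  ultimately show "f z powr \<eta> \<le> \<eta> * (DIM('a) * C) * norm (z - x) + e" by simp
qed

lemma powers_boundE:
  assumes "bounded_by S P (powers w m) g" "0 < \<epsilon>" "\<epsilon> < 1"
  obtains C where "C \<ge> 0" "\<And>y x. y \<in> P \<Longrightarrow> x \<in> S \<Longrightarrow> \<bar>g y x\<bar> \<le> C * w y x powr (m - \<epsilon>)"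
proof -
  have "(\<lambda>y x. w y x powr (m - \<epsilon>)) \<in> powers w m" using assms(2,3) by (auto simp: powers_def)
  then have "\<exists>C\<ge>0. \<forall>y\<in>P. \<forall>x\<in>S. \<bar>g y x\<bar> \<le> C * w y x powr (m - \<epsilon>)"
    using assms(1) unfolding bounded_by_def by (elim ballE) auto
  then show ?thesis using that by metis
qed

lemma bounded_by_powr_mult:
  assumes "bounded_by S P (powers f m) g"
  shows "bounded_by S P (powers f (\<gamma> + m)) (\<lambda>y x. f y x powr \<gamma> * g y x)"
  unfolding bounded_by_def
proof
  fix \<beta> assume "\<beta> \<in> powers f (\<gamma> + m)"
  then obtain \<epsilon> where \<epsilon>: "0 < \<epsilon>" "\<epsilon> < 1" "\<beta> = (\<lambda>y x. f y x powr (\<gamma> + m - \<epsilon>))" by (auto simp: powers_def)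
  obtain C where C: "C \<ge> 0" "\<And>y x. y \<in> P \<Longrightarrow> x \<in> S \<Longrightarrow> \<bar>g y x\<bar> \<le> C * f y x powr (m - \<epsilon>)"
    using powers_boundE[OF assms \<epsilon>(1,2)] by blast
  have "\<bar>f y x powr \<gamma> * g y x\<bar> \<le> C * \<beta> y x" if "y \<in> P" "x \<in> S" for x y
  proof -
    have "\<bar>f y x powr \<gamma> * g y x\<bar> \<le> f y x powr \<gamma> * (C * f y x powr (m - \<epsilon>))"
      using C(2)[OF that] by (auto simp: abs_mult intro!: mult_left_mono)
    also have "\<dots> = C * (f y x powr (\<gamma> + (m - \<epsilon>)))" by (simp add: powr_add)
    finally show ?thesis by (simp add: \<epsilon>(3) algebra_simps)
  qed
  then show "\<exists>C\<ge>0. \<forall>y\<in>P. \<forall>x\<in>S. \<bar>f y x powr \<gamma> * g y x\<bar> \<le> C * \<beta> y x" using C(1) by blast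
qed

text \<open>Here \<open>\<gamma>\<close> may be negative; only the total order
  \<open>\<gamma> + m\<close> is positive. Where \<open>f > 0\<close> this is the product rule. At a
  zero of \<open>f\<close> the convention \<open>0 powr a = 0\<close> turns the asserted derivative
  into the zero map, and the function is of second order in the distance because \<open>f\<close>
  vanishes to infinite order.\<close>

lemma has_derivative_powr_mult:
  assumes "open S" "x \<in> S" "y \<in> P" and f0: "\<And>y x. y \<in> P \<Longrightarrow> x \<in> S \<Longrightarrow> 0 \<le> f y x"
    and f: "dbd 1 S P (powers f 1) f" and g: "dbd 1 S P (powers f m) g" and "\<gamma> + m > 0"
  shows "((\<lambda>x. f y x powr \<gamma> * g y x) has_derivative
    (\<lambda>i. f y x powr (\<gamma> - 1) * (\<gamma> * (dir_deriv i (f y) x * g y x)) + f y x powr \<gamma> * dir_deriv i (g y) x))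
    (at (x::'a::euclidean_space))"
proof (cases "f y x > 0")
  case True
  have "f y differentiable (at x)" "g y differentiable (at x)" using f g assms(2,3) by auto
  then show ?thesis using True
    by (auto intro!: derivative_eq_intros has_derivative_dir_deriv simp: powr_diff field_simps)
next
  case False
  then have z: "f y x = 0" using f0 assms(2,3) by fastforce
  obtain r where r: "r > 0" "ball x r \<subseteq> S" using assms(1,2) open_contains_ball by metis
  \<comment> \<open>\<open>\<epsilon>\<close> keeps the exponent
    \<open>\<gamma> + m - \<epsilon>\<close> positive and \<open>\<eta>\<close> is at most half of
    that exponent. So two factors \<open>f powr \<eta>\<close> fit into it, each bounded by the
    distance to the zero.\<close>
  define \<epsilon> where "\<epsilon> = min ((\<gamma> + m) / 2) (1/2)"
  define \<eta> where "\<eta> = min ((\<gamma> + m - \<epsilon>) / 2) (1/2)"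
  have \<epsilon>: "0 < \<epsilon>" "\<epsilon> < 1" "\<epsilon> < \<gamma> + m" using assms(7) by (auto simp: \<epsilon>_def min_def)
  have \<eta>: "0 < \<eta>" "\<eta> < 1" "2 * \<eta> \<le> \<gamma> + m - \<epsilon>" using \<epsilon>(3) by (auto simp: \<eta>_def min_def)
  have Di: "bounded_by S P (powers f 1) (\<lambda>y. dir_deriv i (f y))" if "i \<in> Basis" for i
    using f that by simp
  have "\<exists>C\<ge>0. \<forall>y\<in>P. \<forall>x\<in>S. \<bar>dir_deriv i (f y) x\<bar> \<le> C * f y x powr (1 - \<eta>)" if "i \<in> Basis" for i
    using powers_boundE[OF Di[OF that] \<eta>(1,2)] by metis
  then obtain Ci where Ci: "\<And>i. i \<in> Basis \<Longrightarrow> Ci i \<ge> 0"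
    "\<And>i y x. i \<in> Basis \<Longrightarrow> y \<in> P \<Longrightarrow> x \<in> S \<Longrightarrow> \<bar>dir_deriv i (f y) x\<bar> \<le> Ci i * f y x powr (1 - \<eta>)"
    by metis
  define C where "C = (\<Sum>i\<in>Basis. Ci i)"
  have C: "C \<ge> 0" "\<And>i z. i \<in> Basis \<Longrightarrow> z \<in> ball x r \<Longrightarrow> \<bar>dir_deriv i (f y) z\<bar> \<le> C * f y z powr (1 - \<eta>)"
  proof -
    show "C \<ge> 0" using Ci(1) by (auto simp: C_def sum_nonneg)
    fix i :: 'a and z assume i: "i \<in> Basis" and zz: "z \<in> ball x r"
    have "Ci i \<le> C" unfolding C_def using i Ci(1) by (intro member_le_sum) auto
    then show "\<bar>dir_deriv i (f y) z\<bar> \<le> C * f y z powr (1 - \<eta>)"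
      using Ci(2)[OF i assms(3), of z] zz r(2) mult_right_mono[of "Ci i" C "f y z powr (1 - \<eta>)"] by fastforce
  qed
  define K where "K = \<eta> * (DIM('a) * C)"
  have K: "f y z powr \<eta> \<le> K * norm (z - x)" if "z \<in> ball x r" for z
    unfolding K_def using f f0 r(2) assms(3) C z \<eta> that
    by (intro powr_le_dist_zero[where r = r]) (auto simp: subset_iff)
  obtain B where B: "B \<ge> 0" "\<And>y x. y \<in> P \<Longrightarrow> x \<in> S \<Longrightarrow> \<bar>f y x powr \<gamma> * g y x\<bar> \<le> B * f y x powr (\<gamma> + m - \<epsilon>)"
    using powers_boundE[OF bounded_by_powr_mult[OF dbd_bounded_by[OF g]] \<epsilon>(1,2)] by metis
  have "((\<lambda>x. f y x powr \<gamma> * g y x) has_derivative (\<lambda>_. 0)) (at x)"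
  proof (rule has_derivative_zero_quadratic[where M = "B * K\<^sup>2"])
    have "f y differentiable (at x)" using f assms(2,3) by auto
    then have "isCont (f y) x" by (rule differentiable_imp_continuous_within)
    then have "((f y) \<longlongrightarrow> 0) (at x)" using z by (simp add: isCont_def)
    then have "\<forall>\<^sub>F z in at x. f y z < 1" by (rule order_tendstoD) simp
    moreover have "\<forall>\<^sub>F z in at x. z \<in> ball x r" using r(1) eventually_at_ball[of r x UNIV] by simp
    ultimately show "\<forall>\<^sub>F z in at x. \<bar>f y z powr \<gamma> * g y z\<bar> \<le> B * K\<^sup>2 * (norm (z - x))\<^sup>2"
    proof eventually_elim
      case (elim w)
      then have w: "w \<in> S" using r by auto
      have f0w: "f y w \<ge> 0" using f0[OF assms(3) w] .
      have "\<bar>f y w powr \<gamma> * g y w\<bar> \<le> B * f y w powr (\<gamma> + m - \<epsilon>)"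
        using B(2)[OF assms(3) w] .
      \<comment> \<open>Since \<open>f y w < 1\<close>, the smaller exponent gives the larger
        power.\<close>
      also have "\<dots> \<le> B * f y w powr (\<eta> + \<eta>)"
      proof (cases "f y w = 0")
        case False
        then show ?thesis using f0w elim B(1) \<eta>(3) by (intro mult_left_mono powr_mono') auto
      qed simp
      also have "\<dots> = B * (f y w powr \<eta>)\<^sup>2" by (simp only: powr_add power2_eq_square)
      also have "\<dots> \<le> B * (K * norm (w - x))\<^sup>2"
        using K[OF elim(2)] B(1) by (intro mult_left_mono power_mono) auto
      finally show ?case by (simp add: power_mult_distrib mult.assoc)
    qed
  qed (use z in simp)
  then show ?thesis using z by simp
qed

text \<open>Differentiating \<open>f powr \<gamma> * g\<close> gives two terms of the same kind:
  \<open>\<gamma> - 1\<close> with a factor of order \<open>m + 1\<close>, and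
  \<open>\<gamma>\<close> with a derivative of \<open>g\<close> of order \<open>m\<close>. The total
  order is unchanged. The general \<open>g\<close> is what closes the induction; a bare power would
  leave its class after one derivative.\<close>

lemma dbd_powr_mult:
  assumes "open S" and f0: "\<And>y x. y \<in> P \<Longrightarrow> x \<in> S \<Longrightarrow> 0 \<le> f y x"
    and f: "\<And>n. dbd n S P (powers f 1) f"
  shows "dbd n S P (powers f m) g \<Longrightarrow> \<gamma> + m > 0 \<Longrightarrow>
    dbd n S P (powers f (\<gamma> + m)) (\<lambda>y x. f y x powr \<gamma> * g y x)"
proof (induction n arbitrary: g m \<gamma>)
  case 0
  then show ?case using bounded_by_powr_mult[of S P f m g \<gamma>] by simp
next
  case (Suc n)
  have g1: "dbd 1 S P (powers f m) g" using Suc.prems by (auto simp: dbd_bounded_by)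
  show ?case
  proof (rule dbd_SucI[OF assms(1)])
    show "bounded_by S P (powers f (\<gamma> + m)) (\<lambda>y x. f y x powr \<gamma> * g y x)"
      using Suc.prems bounded_by_powr_mult[of S P f m g \<gamma>] by simp
    show "((\<lambda>x. f y x powr \<gamma> * g y x) has_derivative
        (\<lambda>i. f y x powr (\<gamma> - 1) * (\<gamma> * (dir_deriv i (f y) x * g y x)) + f y x powr \<gamma> * dir_deriv i (g y) x)) (at x)"
      if "y \<in> P" "x \<in> S" for x y
      by (rule has_derivative_powr_mult[OF assms(1) that(2,1) f0 f g1 Suc.prems(2)])
    fix i :: 'a assume i: "i \<in> Basis"
    have "dbd n S P (powers f 1) (\<lambda>y. dir_deriv i (f y))" using f[of "Suc n"] i by simp
    from dbd_powers_mult[OF assms(1) this dbd_Suc_D[OF Suc.prems(1)]]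
    have "dbd n S P (powers f (1 + m)) (\<lambda>y x. dir_deriv i (f y) x * g y x)" .
    then have "dbd n S P (powers f (1 + m)) (\<lambda>y x. \<gamma> * (dir_deriv i (f y) x * g y x))"
      by (rule dbd_param_mult[OF assms(1), of _ _ "\<bar>\<gamma>\<bar>", rotated]) simp
    from Suc.IH[OF this, of "\<gamma> - 1"] Suc.prems(2)
    have 1: "dbd n S P (powers f (\<gamma> + m)) (\<lambda>y x. f y x powr (\<gamma> - 1) * (\<gamma> * (dir_deriv i (f y) x * g y x)))"
      by simp
    have 2: "dbd n S P (powers f (\<gamma> + m)) (\<lambda>y x. f y x powr \<gamma> * dir_deriv i (g y) x)"
      using Suc.prems i by (intro Suc.IH) auto
    show "dbd n S P (powers f (\<gamma> + m)) (\<lambda>y x. f y x powr (\<gamma> - 1) * (\<gamma> * (dir_deriv i (f y) x * g y x)) +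
        f y x powr \<gamma> * dir_deriv i (g y) x)"
      by (rule dbd_add[OF assms(1) 1 2])
  qed
qed

lemma dbd_powr:
  assumes "open S" and f0: "\<And>y x. y \<in> P \<Longrightarrow> x \<in> S \<Longrightarrow> 0 \<le> f y x"
    and f: "\<And>n. dbd n S P (powers f 1) f" and "\<beta> > 0"
  shows "dbd n S P (powers f \<beta>) (\<lambda>y x. f y x powr \<beta>)"
proof -
  have "dbd n S P (powers f \<beta>) (\<lambda>y x. f y x powr (\<beta> - 1) * f y x)"
    using dbd_powr_mult[OF assms(1) f0 f f, where \<gamma> = "\<beta> - 1"] assms(4) by simp
  moreover have "f y x powr (\<beta> - 1) * f y x = f y x powr \<beta>" if "y \<in> P" "x \<in> S" for x y
    using f0[OF that] by (cases "f y x = 0") (auto simp: powr_diff)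
  ultimately show ?thesis
    using dbd_cong[OF assms(1), of P "\<lambda>y x. f y x powr (\<beta> - 1) * f y x" "\<lambda>y x. f y x powr \<beta>"] by blast
qed

section \<open>Differentiation under the integral sign\<close>

text \<open>The derivative is the limit of difference quotients along a sequence that is the same
  for all parameters.\<close>

lemma borel_measurable_dir_deriv:
  fixes g :: "'p \<Rightarrow> 'a::euclidean_space \<Rightarrow> real"
  assumes "open S" "x \<in> S" "\<And>z. z \<in> S \<Longrightarrow> (\<lambda>y. g y z) \<in> borel_measurable M"
    and "\<And>y. y \<in> space M \<Longrightarrow> g y differentiable (at x)"
  shows "(\<lambda>y. dir_deriv v (g y) x) \<in> borel_measurable M"
proof -
  have ev: "\<forall>\<^sub>F h in at (0::real). x + h *\<^sub>R v \<in> S"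
  proof (rule topological_tendstoD)
    have "((\<lambda>h. x + h *\<^sub>R v) \<longlongrightarrow> x + 0 *\<^sub>R v) (at (0::real))" by (intro tendsto_intros)
    then show "((\<lambda>h. x + h *\<^sub>R v) \<longlongrightarrow> x) (at (0::real))" by simp
  qed (use assms in auto)
  then obtain d where d: "d > 0" "\<And>h. h \<noteq> 0 \<Longrightarrow> \<bar>h\<bar> < d \<Longrightarrow> x + h *\<^sub>R v \<in> S"
    unfolding eventually_at by (auto simp: dist_real_def)
  \<comment> \<open>The offset 2 keeps every increment strictly below \<open>d\<close>, so all
    sample points lie in \<open>S\<close>.\<close>
  define X where "X n = d / real (n + 2)" for n
  have X: "X n \<noteq> 0" "\<bar>X n\<bar> < d" for n
    using d(1) by (auto simp: X_def field_simps intro!: add_pos_nonneg)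
  have Xlim: "filterlim X (at 0) sequentially"
  proof (rule filterlim_atI)
    have "(\<lambda>n. d * inverse (real (n + 2))) \<longlonglongrightarrow> d * 0"
      by (intro tendsto_mult tendsto_const LIMSEQ_ignore_initial_segment[OF lim_inverse_n])
    then show "X \<longlonglongrightarrow> 0" by (simp add: X_def[abs_def] divide_inverse)
  qed (use X in auto)
  show ?thesis
  proof (rule borel_measurable_LIMSEQ_real)
    fix y assume "y \<in> space M"
    have "((\<lambda>h. (g y (x + h *\<^sub>R v) - g y x) / h) \<longlongrightarrow> dir_deriv v (g y) x) (at 0)"
    proof -
      have 1: "((\<lambda>h. x + h *\<^sub>R v) has_derivative (\<lambda>h. h *\<^sub>R v)) (at (0::real))"
        by (auto intro!: derivative_eq_intros)
      have 2: "(g y has_derivative (\<lambda>v. dir_deriv v (g y) x)) (at (x + 0 *\<^sub>R v))"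
        using has_derivative_dir_deriv[OF assms(4)[OF \<open>y \<in> space M\<close>]] by simp
      interpret bl: bounded_linear "\<lambda>v. dir_deriv v (g y) x"
        using 2 by (rule has_derivative_bounded_linear)
      have "((\<lambda>h. g y (x + h *\<^sub>R v)) has_derivative (\<lambda>h. h * dir_deriv v (g y) x)) (at 0)"
        using diff_chain_at[OF 1 2] by (simp add: comp_def bl.scaleR)
      then have "((\<lambda>h. g y (x + h *\<^sub>R v)) has_field_derivative dir_deriv v (g y) x) (at 0)"
        by (simp add: has_field_derivative_def mult_commute_abs)
      then show ?thesis by (simp add: DERIV_def)
    qed
    from filterlim_compose[OF this Xlim]
    show "(\<lambda>n. (g y (x + X n *\<^sub>R v) - g y x) / X n) \<longlonglongrightarrow> dir_deriv v (g y) x" .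
  next
    fix n
    have "(\<lambda>y. g y (x + X n *\<^sub>R v)) \<in> borel_measurable M" "(\<lambda>y. g y x) \<in> borel_measurable M"
      using assms(2,3) d(2) X by auto
    then show "(\<lambda>y. (g y (x + X n *\<^sub>R v) - g y x) / X n) \<in> borel_measurable M" by measurable
  qed
qed

text \<open>Dominated convergence acts on the whole remainder of the Frechet derivative divided by
  \<open>norm (z - x)\<close>, along an arbitrary sequence tending to \<open>x\<close>. The
  increment and the linear part each contribute at most \<open>DIM('a) * B y\<close>, which gives
  the majorant.\<close>

lemma has_derivative_integral:
  fixes g :: "'p \<Rightarrow> 'a::euclidean_space \<Rightarrow> real"
  assumes "open S" "x \<in> S"
    and int: "\<And>z. z \<in> S \<Longrightarrow> integrable M (\<lambda>y. g y z)"
    and der: "\<And>y z. y \<in> space M \<Longrightarrow> z \<in> S \<Longrightarrow> g y differentiable (at z)"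
    and bd: "\<And>y z i. y \<in> space M \<Longrightarrow> z \<in> S \<Longrightarrow> i \<in> Basis \<Longrightarrow> \<bar>dir_deriv i (g y) z\<bar> \<le> B y"
    and B: "integrable M B"
  shows "((\<lambda>z. \<integral>y. g y z \<partial>M) has_derivative (\<lambda>v. \<Sum>i\<in>Basis. (v \<bullet> i) * (\<integral>y. dir_deriv i (g y) x \<partial>M))) (at x)"
proof -
  have meas: "(\<lambda>y. dir_deriv v (g y) x) \<in> borel_measurable M" for v
    using assms by (intro borel_measurable_dir_deriv[OF assms(1,2)]) auto
  have intD: "integrable M (\<lambda>y. dir_deriv i (g y) x)" if "i \<in> Basis" for i
    by (rule Bochner_Integration.integrable_bound[OF B meas]) (use bd[OF _ assms(2) that] in \<open>auto intro!: AE_I2 simp: order_trans[OF _ abs_ge_self]\<close>)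
  have sum_eq: "(\<Sum>i\<in>Basis. (v \<bullet> i) * (\<integral>y. dir_deriv i (g y) x \<partial>M)) = (\<integral>y. dir_deriv v (g y) x \<partial>M)"
    and intv: "integrable M (\<lambda>y. dir_deriv v (g y) x)" for v
  proof -
    have "integrable M (\<lambda>y. \<Sum>i\<in>Basis. (v \<bullet> i) * dir_deriv i (g y) x)"
      using intD by (intro Bochner_Integration.integrable_sum integrable_mult_right) auto
    moreover have "integrable M (\<lambda>y. dir_deriv v (g y) x) \<longleftrightarrow> integrable M (\<lambda>y. \<Sum>i\<in>Basis. (v \<bullet> i) * dir_deriv i (g y) x)"
      using der assms(2) by (intro Bochner_Integration.integrable_cong refl dir_deriv_Basis_sum) auto
    ultimately show "integrable M (\<lambda>y. dir_deriv v (g y) x)" by simp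
    have "(\<integral>y. dir_deriv v (g y) x \<partial>M) = (\<integral>y. (\<Sum>i\<in>Basis. (v \<bullet> i) * dir_deriv i (g y) x) \<partial>M)"
      using der assms(2) by (intro Bochner_Integration.integral_cong refl dir_deriv_Basis_sum) auto
    also have "\<dots> = (\<Sum>i\<in>Basis. (\<integral>y. (v \<bullet> i) * dir_deriv i (g y) x \<partial>M))"
      using intD by (intro Bochner_Integration.integral_sum) auto
    finally show "(\<Sum>i\<in>Basis. (v \<bullet> i) * (\<integral>y. dir_deriv i (g y) x \<partial>M)) = (\<integral>y. dir_deriv v (g y) x \<partial>M)" by simp
  qed
  obtain r where r: "r > 0" "ball x r \<subseteq> S" using assms(1,2) open_contains_ball by metis
  have lip: "\<bar>g y z - g y x\<bar> \<le> DIM('a) * B y * norm (z - x)" if "y \<in> space M" "z \<in> ball x r" for y z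
  proof -
    have "norm (g y z - g y x) \<le> (DIM('a) * B y) * norm (z - x)"
    proof (rule differentiable_bound[of "ball x r" _ "\<lambda>w v. dir_deriv v (g y) w"])
      fix w assume w: "w \<in> ball x r"
      then have w: "w \<in> S" using r by auto
      show "(g y has_derivative (\<lambda>v. dir_deriv v (g y) w)) (at w within ball x r)"
        by (rule has_derivative_at_withinI[OF has_derivative_dir_deriv[OF der[OF that(1) w]]])
      show "onorm (\<lambda>v. dir_deriv v (g y) w) \<le> DIM('a) * B y"
        by (rule onorm_le) (use dir_deriv_bound[OF der[OF that(1) w] bd[OF that(1) w]] in auto)
    qed (use that r in auto)
    then show ?thesis by simp
  qed
  show ?thesis
    unfolding has_derivative_iff_norm
  proof (intro conjI)
    show "bounded_linear (\<lambda>v. \<Sum>i\<in>Basis. (v \<bullet> i) * (\<integral>y. dir_deriv i (g y) x \<partial>M))"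
      by (intro bounded_linear_intros)
    show "((\<lambda>z. norm ((\<integral>y. g y z \<partial>M) - (\<integral>y. g y x \<partial>M) - (\<Sum>i\<in>Basis. ((z - x) \<bullet> i) * (\<integral>y. dir_deriv i (g y) x \<partial>M))) / norm (z - x)) \<longlongrightarrow> 0) (at x)"
      unfolding tendsto_at_iff_sequentially
    proof (intro allI impI)
      fix X assume X: "\<forall>i. X i \<in> UNIV - {x}" "X \<longlonglongrightarrow> x"
      then have "\<forall>\<^sub>F n in sequentially. X n \<in> ball x r"
        using r(1) by (intro topological_tendstoD) auto
      then obtain N where N: "\<And>n. n \<ge> N \<Longrightarrow> X n \<in> ball x r" by (auto simp: eventually_sequentially)
      let ?R = "\<lambda>n y. (g y (X n) - g y x - dir_deriv (X n - x) (g y) x) / norm (X n - x)"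
      have "(\<lambda>n. \<integral>y. ?R (n + N) y \<partial>M) \<longlonglongrightarrow> (\<integral>y. 0 \<partial>M)"
      proof (rule integral_dominated_convergence)
        show "integrable M (\<lambda>y. 2 * (DIM('a) * B y))" using B by simp
        show "AE y in M. (\<lambda>n. ?R (n + N) y) \<longlonglongrightarrow> 0"
        proof (rule AE_I2)
          fix y assume y: "y \<in> space M"
          have "((\<lambda>z. norm (g y z - g y x - dir_deriv (z - x) (g y) x) / norm (z - x)) \<longlongrightarrow> 0) (at x)"
            using has_derivative_dir_deriv[OF der[OF y assms(2)]] unfolding has_derivative_iff_norm by simp
          then have "(\<lambda>n. norm (g y (X n) - g y x - dir_deriv (X n - x) (g y) x) / norm (X n - x)) \<longlonglongrightarrow> 0"
            using X unfolding tendsto_at_iff_sequentially comp_def by blast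
          then have "(\<lambda>n. norm (?R n y)) \<longlonglongrightarrow> 0" by (simp add: abs_divide)
          then have "(\<lambda>n. ?R n y) \<longlonglongrightarrow> 0" by (rule tendsto_norm_zero_cancel)
          then show "(\<lambda>n. ?R (n + N) y) \<longlonglongrightarrow> 0" by (rule LIMSEQ_ignore_initial_segment)
        qed
        fix n
        have XS: "X (n + N) \<in> ball x r" using N by simp
        then show "?R (n + N) \<in> borel_measurable M"
          using int meas assms(2) r(2) by (intro borel_measurable_divide borel_measurable_diff) auto
        show "AE y in M. norm (?R (n + N) y) \<le> 2 * (DIM('a) * B y)"
        proof (rule AE_I2)
          fix y assume y: "y \<in> space M"
          have nz: "norm (X (n + N) - x) > 0" using X(1) by auto
          have "\<bar>g y (X (n + N)) - g y x - dir_deriv (X (n + N) - x) (g y) x\<bar> \<le> 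
             (DIM('a) * B y) * norm (X (n + N) - x) + DIM('a) * B y * norm (X (n + N) - x)"
            using lip[OF y XS] dir_deriv_bound[OF der[OF y assms(2)] bd[OF y assms(2)], of "X (n + N) - x"] by linarith
          then show "norm (?R (n + N) y) \<le> 2 * (DIM('a) * B y)"
            using nz by (simp add: abs_divide divide_le_eq algebra_simps)
        qed
      qed auto
      then have lim: "(\<lambda>n. \<integral>y. ?R n y \<partial>M) \<longlonglongrightarrow> 0" by (rule_tac LIMSEQ_offset[where k = N]) simp
      have "\<forall>\<^sub>F n in sequentially. \<bar>\<integral>y. ?R n y \<partial>M\<bar> = norm ((\<integral>y. g y (X n) \<partial>M) - (\<integral>y. g y x \<partial>M) - (\<Sum>i\<in>Basis. ((X n - x) \<bullet> i) * (\<integral>y. dir_deriv i (g y) x \<partial>M))) / norm (X n - x)"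
        unfolding eventually_sequentially
      proof (intro exI[of _ N] allI impI)
        fix n assume "N \<le> n"
        then have "X n \<in> S" using N r by auto
        then show "\<bar>\<integral>y. ?R n y \<partial>M\<bar> = norm ((\<integral>y. g y (X n) \<partial>M) - (\<integral>y. g y x \<partial>M) - (\<Sum>i\<in>Basis. ((X n - x) \<bullet> i) * (\<integral>y. dir_deriv i (g y) x \<partial>M))) / norm (X n - x)"
          unfolding sum_eq using int[of "X n"] int[OF assms(2)] intv[of "X n - x"] by (simp add: abs_divide)
      qed
      from Lim_transform_eventually[OF tendsto_rabs_zero[OF lim] this]
      show "((\<lambda>z. norm ((\<integral>y. g y z \<partial>M) - (\<integral>y. g y x \<partial>M) - (\<Sum>i\<in>Basis. ((z - x) \<bullet> i) * (\<integral>y. dir_deriv i (g y) x \<partial>M))) / norm (z - x)) \<circ> X) \<longlonglongrightarrow> 0"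
        by (simp add: comp_def)
    qed
  qed
qed

lemma dir_deriv_integral:
  fixes g :: "'p \<Rightarrow> 'a::euclidean_space \<Rightarrow> real"
  assumes "open S" "x \<in> S"
    and "\<And>z. z \<in> S \<Longrightarrow> integrable M (\<lambda>y. g y z)"
    and "\<And>y z. y \<in> space M \<Longrightarrow> z \<in> S \<Longrightarrow> g y differentiable (at z)"
    and "\<And>y z i. y \<in> space M \<Longrightarrow> z \<in> S \<Longrightarrow> i \<in> Basis \<Longrightarrow> \<bar>dir_deriv i (g y) z\<bar> \<le> B y"
    and "integrable M B" and "i \<in> Basis"
  shows "dir_deriv i (\<lambda>z. \<integral>y. g y z \<partial>M) x = (\<integral>y. dir_deriv i (g y) x \<partial>M)"
  using dir_deriv_eq[OF has_derivative_integral[OF assms(1-6)], of i] assms(7)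
  by (simp add: inner_Basis if_distrib[of "\<lambda>c. c * _"] sum.delta cong: if_cong)

lemma dbd_integrable:
  assumes "dbd n S (space M) {\<lambda>y x. B y} h" "integrable M B" "x \<in> S" "(\<lambda>y. h y x) \<in> borel_measurable M"
  shows "integrable M (\<lambda>y. h y x)"
proof -
  obtain C where C: "C \<ge> 0" "\<And>y x. y \<in> space M \<Longrightarrow> x \<in> S \<Longrightarrow> \<bar>h y x\<bar> \<le> C * B y"
    using dbd_bounded_by[OF assms(1)] unfolding bounded_by_def by auto
  have "integrable M (\<lambda>y. C * B y)" using assms(2) by simp
  then show ?thesis
    by (rule Bochner_Integration.integrable_bound[OF _ assms(4)]) (use C(2) assms(3) in \<open>auto intro!: AE_I2 simp: order_trans[OF _ abs_ge_self]\<close>)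
qed

lemma dbd_Suc_deriv_bound:
  assumes "dbd (Suc n) S P {\<lambda>y x. B y} h"
  obtains C where "C \<ge> 0" "\<And>y z i. y \<in> P \<Longrightarrow> z \<in> S \<Longrightarrow> i \<in> Basis \<Longrightarrow> \<bar>dir_deriv i (h y) z\<bar> \<le> C * \<bar>B y\<bar>"
proof -
  have "\<exists>C\<ge>0. \<forall>y\<in>P. \<forall>x\<in>S. \<bar>dir_deriv i (h y) x\<bar> \<le> C * B y" if "i \<in> Basis" for i
    using assms that dbd_bounded_by[of n S P "{\<lambda>y x. B y}" "\<lambda>y. dir_deriv i (h y)"] by (auto simp: bounded_by_def)
  then obtain Ci where Ci: "\<And>i. i \<in> Basis \<Longrightarrow> Ci i \<ge> 0"
    "\<And>i y x. i \<in> Basis \<Longrightarrow> y \<in> P \<Longrightarrow> x \<in> S \<Longrightarrow> \<bar>dir_deriv i (h y) x\<bar> \<le> Ci i * B y"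
    by metis
  show ?thesis
  proof (rule that)
    show "0 \<le> (\<Sum>i\<in>Basis. Ci i)" using Ci(1) by (simp add: sum_nonneg)
    fix y z i assume *: "y \<in> P" "z \<in> S" "i \<in> (Basis::'a set)"
    have "\<bar>dir_deriv i (h y) z\<bar> \<le> Ci i * \<bar>B y\<bar>"
      using Ci(2)[OF *(3,1,2)] Ci(1)[OF *(3)] mult_left_mono[of "B y" "\<bar>B y\<bar>" "Ci i"] by linarith
    also have "\<dots> \<le> (\<Sum>i\<in>Basis. Ci i) * \<bar>B y\<bar>"
      using * Ci(1) by (intro mult_right_mono member_le_sum) auto
    finally show "\<bar>dir_deriv i (h y) z\<bar> \<le> (\<Sum>i\<in>Basis. Ci i) * \<bar>B y\<bar>" .
  qed
qed

lemma dbd_has_derivative_integral: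
  assumes "open S" "integrable M B" "dbd (Suc n) S (space M) {\<lambda>y x. B y} h"
    and "\<And>x. x \<in> S \<Longrightarrow> (\<lambda>y. h y x) \<in> borel_measurable M" "x \<in> S"
  shows "((\<lambda>z. \<integral>y. h y z \<partial>M) has_derivative (\<lambda>v. \<Sum>i\<in>Basis. (v \<bullet> i) * (\<integral>y. dir_deriv i (h y) x \<partial>M))) (at x)"
    and "i \<in> Basis \<Longrightarrow> dir_deriv i (\<lambda>z. \<integral>y. h y z \<partial>M) x = (\<integral>y. dir_deriv i (h y) x \<partial>M)"
proof -
  obtain C where C: "C \<ge> 0" "\<And>y z i. y \<in> space M \<Longrightarrow> z \<in> S \<Longrightarrow> i \<in> Basis \<Longrightarrow> \<bar>dir_deriv i (h y) z\<bar> \<le> C * \<bar>B y\<bar>"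
    using dbd_Suc_deriv_bound[OF assms(3)] by blast
  have 1: "integrable M (\<lambda>y. h y z)" if "z \<in> S" for z
    using dbd_integrable[OF assms(3,2) that assms(4)[OF that]] .
  have 2: "h y differentiable (at z)" if "y \<in> space M" "z \<in> S" for y z using assms(3) that by simp
  have 3: "integrable M (\<lambda>y. C * \<bar>B y\<bar>)" using assms(2) by simp
  show "((\<lambda>z. \<integral>y. h y z \<partial>M) has_derivative (\<lambda>v. \<Sum>i\<in>Basis. (v \<bullet> i) * (\<integral>y. dir_deriv i (h y) x \<partial>M))) (at x)"
    by (rule has_derivative_integral[OF assms(1,5) 1 2 C(2) 3])
  show "i \<in> Basis \<Longrightarrow> dir_deriv i (\<lambda>z. \<integral>y. h y z \<partial>M) x = (\<integral>y. dir_deriv i (h y) x \<partial>M)"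
    by (rule dir_deriv_integral[OF assms(1,5) 1 2 C(2) 3])
qed

text \<open>\<open>B\<close> is the integrable majorant that permits differentiation under the
  integral sign. The finer bounds \<open>Bs\<close> pass to the integral through \<open>tr\<close>,
  which is stated for all integrands \<open>k\<close> because it is applied to every derivative of
  \<open>h\<close>.\<close>

lemma dbd_integral:
  fixes h :: "'p \<Rightarrow> 'a::euclidean_space \<Rightarrow> real"
  assumes "open S" "integrable M B"
    and tr: "\<And>k. (\<And>x. x \<in> S \<Longrightarrow> (\<lambda>y. k y x) \<in> borel_measurable M) \<Longrightarrow> bounded_by S (space M) {\<lambda>y x. B y} k \<Longrightarrow>
        bounded_by S (space M) Bs k \<Longrightarrow> bounded_by S {()} Bs' (\<lambda>_ x. \<integral>y. k y x \<partial>M)"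
  shows "dbd n S (space M) {\<lambda>y x. B y} h \<Longrightarrow> dbd n S (space M) Bs h \<Longrightarrow>
    (\<And>x. x \<in> S \<Longrightarrow> (\<lambda>y. h y x) \<in> borel_measurable M) \<Longrightarrow> dbd n S {()} Bs' (\<lambda>_ x. \<integral>y. h y x \<partial>M)"
proof (induction n arbitrary: h)
  case 0
  then show ?case using tr by simp
next
  case (Suc n)
  show ?case
  proof (rule dbd_SucI[OF assms(1)])
    show "bounded_by S {()} Bs' (\<lambda>_ x. \<integral>y. h y x \<partial>M)"
      using Suc.prems by (intro tr) auto
    show "((\<lambda>x. \<integral>y. h y x \<partial>M) has_derivative (\<lambda>v. \<Sum>i\<in>Basis. (v \<bullet> i) * (\<integral>y. dir_deriv i (h y) x \<partial>M))) (at x)"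
      if "x \<in> S" for x
      by (rule dbd_has_derivative_integral(1)[OF assms(1,2) Suc.prems(1,3) that])
    fix i :: 'a assume i: "i \<in> Basis"
    have m: "(\<lambda>y. dir_deriv i (h y) x) \<in> borel_measurable M" if "x \<in> S" for x
      using Suc.prems that by (intro borel_measurable_dir_deriv[OF assms(1) that]) auto
    have "dbd n S {()} Bs' (\<lambda>_ x. \<integral>y. dir_deriv i (h y) x \<partial>M)"
      using Suc.prems i m by (intro Suc.IH) auto
    moreover have "(\<Sum>j\<in>Basis. (i \<bullet> j) * (\<integral>y. dir_deriv j (h y) x \<partial>M)) = (\<integral>y. dir_deriv i (h y) x \<partial>M)" for x
      using i by (simp add: inner_Basis if_distrib[of "\<lambda>c. c * _"] sum.delta cong: if_cong)
    ultimately show "dbd n S {()} Bs' (\<lambda>_ x. \<Sum>j\<in>Basis. (i \<bullet> j) * (\<integral>y. dir_deriv j (h y) x \<partial>M))"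
      by simp
  qed
qed

text \<open>Jensen's inequality: a derivative of the mean is bounded by a mean of
  \<open>g powr (1 - \<epsilon>)\<close>, and by concavity this is at most a constant times the mean
  to the power \<open>1 - \<epsilon>\<close>. So comparability with the derivatives survives
  averaging.\<close>

lemma dbd_average:
  fixes g :: "'p \<Rightarrow> 'a::euclidean_space \<Rightarrow> real"
  assumes "open S" and M: "finite_measure M" "measure M (space M) = 1"
    and gK: "\<And>\<theta> x. \<theta> \<in> space M \<Longrightarrow> x \<in> S \<Longrightarrow> 0 \<le> g \<theta> x \<and> g \<theta> x \<le> K"
    and meas: "\<And>x. x \<in> S \<Longrightarrow> (\<lambda>\<theta>. g \<theta> x) \<in> borel_measurable M"
    and g: "\<And>n. dbd n S (space M) (powers g 1) g"
  shows "dbd n S {()} (powers (\<lambda>_ x. \<integral>\<theta>. g \<theta> x \<partial>M) 1) (\<lambda>_ x. \<integral>\<theta>. g \<theta> x \<partial>M)"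
proof (rule dbd_integral[OF assms(1), where B = "\<lambda>_. 1" and Bs = "powers g 1"])
  show one: "integrable M (\<lambda>_. 1::real)" using M(1) by (simp add: finite_measure.integrable_const)
  show "dbd n S (space M) {\<lambda>y x. 1} g"
  proof (rule dbd_weaken[OF order_refl order_refl _ g])
    fix \<beta> :: "'p \<Rightarrow> 'a \<Rightarrow> real" assume "\<beta> \<in> {\<lambda>y x. 1}"
    then have \<beta>: "\<beta> = (\<lambda>y x. 1)" by simp
    have 1: "(\<lambda>y x. g y x powr (1 - 1/2)) \<in> powers g 1"
      unfolding powers_def by (rule image_eqI[of _ _ "1/2"]) auto
    have "g y x powr (1 - 1/2) \<le> K powr (1 - 1/2) * \<beta> y x" if "y \<in> space M" "x \<in> S" for y x
      using gK[OF that] unfolding \<beta> by (simp add: powr_mono2)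
    then show "\<exists>\<beta>'\<in>powers g 1. \<exists>C\<ge>0. \<forall>y\<in>space M. \<forall>x\<in>S. \<beta>' y x \<le> C * \<beta> y x"
      by (intro bexI[OF _ 1] exI[of _ "K powr (1 - 1/2)"]) simp
  qed
  show "bounded_by S {()} (powers (\<lambda>_ x. \<integral>\<theta>. g \<theta> x \<partial>M) 1) (\<lambda>_ x. \<integral>y. k y x \<partial>M)"
    if k: "\<And>x. x \<in> S \<Longrightarrow> (\<lambda>y. k y x) \<in> borel_measurable M" "bounded_by S (space M) {\<lambda>y x. 1} k"
       "bounded_by S (space M) (powers g 1) k" for k
    unfolding bounded_by_def
  proof
    fix \<beta> :: "unit \<Rightarrow> 'a \<Rightarrow> real" assume "\<beta> \<in> powers (\<lambda>_ x. \<integral>\<theta>. g \<theta> x \<partial>M) 1"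
    then obtain \<epsilon> where \<epsilon>: "0 < \<epsilon>" "\<epsilon> < 1" "\<beta> = (\<lambda>_ x. (\<integral>\<theta>. g \<theta> x \<partial>M) powr (1 - \<epsilon>))"
      by (auto simp: powers_def)
    obtain C where C: "C \<ge> 0" "\<And>y x. y \<in> space M \<Longrightarrow> x \<in> S \<Longrightarrow> \<bar>k y x\<bar> \<le> C * g y x powr (1 - \<epsilon>)"
      using powers_boundE[OF k(3) \<epsilon>(1,2)] by blast
    have "\<bar>\<integral>y. k y x \<partial>M\<bar> \<le> (2 * C) * \<beta> () x" if x: "x \<in> S" for x
    proof -
      let ?q = "\<integral>\<theta>. g \<theta> x \<partial>M"
      have ig: "integrable M (\<lambda>\<theta>. g \<theta> x)"
        using gK[OF _ x] by (intro finite_measure.integrable_const_bound[OF M(1), of _ K] meas x AE_I2) auto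
      have q0: "?q \<ge> 0" using gK[OF _ x] by (intro integral_nonneg_AE AE_I2) auto
      show ?thesis
      proof (cases "?q = 0")
        \<comment> \<open>If the mean is 0 then \<open>g\<close> vanishes almost everywhere, and
          \<open>k\<close> with it because \<open>0 powr (1 - \<epsilon>) = 0\<close>.\<close>
        case True
        have "AE \<theta> in M. g \<theta> x = 0"
          using integral_nonneg_eq_0_iff_AE[OF ig] gK[OF _ x] True by (auto intro!: AE_I2)
        moreover have "AE \<theta> in M. \<theta> \<in> space M" by (rule AE_I2)
        ultimately have "AE \<theta> in M. k \<theta> x = 0"
          by eventually_elim (use C(2)[OF _ x] in force)
        then have "(\<integral>y. k y x \<partial>M) = 0" by (rule integral_eq_zero_AE)
        then show ?thesis using \<epsilon>(3) C(1) by simp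
      next
        case False
        then have q: "?q > 0" using q0 by simp
        text \<open>Concavity of \<open>t powr (1 - \<epsilon>)\<close>, in the weak form of a bound by two lines.\<close>
        have le: "t powr (1 - \<epsilon>) \<le> ?q powr (- \<epsilon>) * t + ?q powr (1 - \<epsilon>)" if "t \<ge> 0" for t
        proof (cases "t \<ge> ?q")
          case True
          then have "t powr (1 - \<epsilon>) = t powr (- \<epsilon>) * t" using q by (simp add: powr_diff powr_minus field_simps)
          also have "\<dots> \<le> ?q powr (- \<epsilon>) * t"
            using True q \<epsilon> by (intro mult_right_mono powr_mono2') auto
          finally show ?thesis by (simp add: add_increasing2)
        next
          case False
          then have "t powr (1 - \<epsilon>) \<le> ?q powr (1 - \<epsilon>)" using that \<epsilon> by (intro powr_mono2) auto
          then show ?thesis using that by (simp add: add_increasing)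
        qed
        have "\<bar>\<integral>y. k y x \<partial>M\<bar> \<le> (\<integral>y. C * (?q powr (- \<epsilon>) * g y x + ?q powr (1 - \<epsilon>)) \<partial>M)"
        proof -
          have kb: "\<bar>k y x\<bar> \<le> C * (?q powr (- \<epsilon>) * g y x + ?q powr (1 - \<epsilon>))" if "y \<in> space M" for y
            using C(2)[OF that x] mult_left_mono[OF le C(1), of "g y x"] gK[OF that x] by linarith
          have ib: "integrable M (\<lambda>y. C * (?q powr (- \<epsilon>) * g y x + ?q powr (1 - \<epsilon>)))"
            using ig M(1) by (intro integrable_mult_right Bochner_Integration.integrable_add) (auto simp: finite_measure.integrable_const)
          have ik: "integrable M (\<lambda>y. k y x)"
            by (rule Bochner_Integration.integrable_bound[OF ib k(1)[OF x]], rule AE_I2)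
              (use kb in \<open>force intro: order_trans[OF _ abs_ge_self]\<close>)
          have "\<bar>\<integral>y. k y x \<partial>M\<bar> \<le> (\<integral>y. \<bar>k y x\<bar> \<partial>M)" by (rule integral_abs_bound)
          also have "\<dots> \<le> (\<integral>y. C * (?q powr (- \<epsilon>) * g y x + ?q powr (1 - \<epsilon>)) \<partial>M)"
            by (intro integral_mono ib kb integrable_abs ik)
          finally show ?thesis .
        qed
        also have "\<dots> = C * (?q powr (- \<epsilon>) * ?q + ?q powr (1 - \<epsilon>))"
          using ig M one by (simp add: finite_measure.integrable_const)
        also have "?q powr (- \<epsilon>) * ?q = ?q powr (1 - \<epsilon>)"
          using q by (simp add: powr_diff powr_minus field_simps)
        finally show ?thesis using \<epsilon>(3) by simp
      qed
    qed
    then show "\<exists>C\<ge>0. \<forall>y\<in>{()}. \<forall>x\<in>S. \<bar>\<integral>y. k y x \<partial>M\<bar> \<le> C * \<beta> y x"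
      using C(1) by (intro exI[of _ "2 * C"]) auto
  qed
qed (use meas g in auto)

section \<open>Smooth functions on open sets\<close>

text \<open>With the empty set of weights the bounds are vacuous and only differentiability is left.\<close>

definition smooth_on :: "'a::euclidean_space set \<Rightarrow> ('a \<Rightarrow> real) \<Rightarrow> bool" where
  "smooth_on S f \<longleftrightarrow> (\<forall>n. dbd n S {()} {} (\<lambda>_. f))"

lemma bounded_by_empty [simp]: "bounded_by S P {} g"
  by (simp add: bounded_by_def)

lemma smooth_on_iff:
  "smooth_on S f \<longleftrightarrow> (\<forall>x\<in>S. f differentiable (at x)) \<and> (\<forall>i\<in>Basis. smooth_on S (dir_deriv i f))"
  (is "_ \<longleftrightarrow> ?R")
proof
  assume *: "smooth_on S f"
  then have "dbd (Suc n) S {()} {} (\<lambda>_. f)" for n unfolding smooth_on_def by blast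
  then show ?R by (auto simp: smooth_on_def)
next
  assume *: ?R
  show "smooth_on S f"
    unfolding smooth_on_def
  proof
    fix n show "dbd n S {()} {} (\<lambda>_. f)"
      using * by (cases n) (auto simp: smooth_on_def)
  qed
qed

lemma dbd_imp_smooth_on: "(\<And>n. dbd n S {()} B (\<lambda>_. f)) \<Longrightarrow> smooth_on S f"
  unfolding smooth_on_def using dbd_weaken[OF order_refl order_refl, of "{}" B] by blast

lemma smooth_on_cong:
  "open S \<Longrightarrow> (\<And>x. x \<in> S \<Longrightarrow> f x = g x) \<Longrightarrow> smooth_on S f \<longleftrightarrow> smooth_on S g"
  unfolding smooth_on_def using dbd_cong[of S "{()}" "\<lambda>_. f" "\<lambda>_. g"] by auto

text \<open>Derivatives refer to full neighbourhoods, so smoothness is decided point by point. This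
  is how local formulas are glued later.\<close>

lemma smooth_on_local:
  assumes "\<And>x. x \<in> S \<Longrightarrow> \<exists>T. x \<in> T \<and> smooth_on T f"
  shows "smooth_on S f"
proof -
  have "dbd n S {()} {} (\<lambda>_. f)" if "\<And>x. x \<in> S \<Longrightarrow> \<exists>T. x \<in> T \<and> smooth_on T f" for n
    using that
  proof (induction n arbitrary: f)
    case 0
    then show ?case by simp
  next
    case (Suc n)
    have "f differentiable (at x)" if "x \<in> S" for x
      using Suc.prems[OF that] smooth_on_iff[of _ f] by blast
    moreover have "dbd n S {()} {} (\<lambda>_. dir_deriv i f)" if "i \<in> Basis" for i
    proof (rule Suc.IH)
      fix x assume "x \<in> S"
      then show "\<exists>T. x \<in> T \<and> smooth_on T (dir_deriv i f)"
        using Suc.prems[of x] smooth_on_iff[of _ f] that by blast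
    qed
    ultimately show ?case by simp
  qed
  with assms show ?thesis by (simp add: smooth_on_def)
qed

lemma smooth_on_imp_continuous_on: "smooth_on S f \<Longrightarrow> continuous_on S f"
  by (metis continuous_at_imp_continuous_on differentiable_imp_continuous_within smooth_on_iff)

lemma smooth_on_imp_smooth:
  fixes f :: "real ^ 'n::finite \<Rightarrow> real"
  assumes "smooth_on UNIV f"
  shows "smooth f"
proof -
  have "Ck k f" if "smooth_on UNIV f" for k
    using that
  proof (induction k arbitrary: f)
    case 0
    then show ?case by (simp add: smooth_on_imp_continuous_on)
  next
    case (Suc k)
    have "partial_deriv i f = dir_deriv (axis i 1) f" for i
      by (auto simp: partial_deriv_def dir_deriv_def)
    then show ?case
      using Suc.prems smooth_on_iff[of UNIV f] by (auto intro!: Suc.IH)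
  qed
  with assms show ?thesis by (simp add: smooth_def)
qed

lemma smooth_on_add: "open S \<Longrightarrow> smooth_on S f \<Longrightarrow> smooth_on S g \<Longrightarrow> smooth_on S (\<lambda>x. f x + g x)"
  unfolding smooth_on_def using dbd_add[of S _ "{()}" "{}" "\<lambda>_. f" "\<lambda>_. g"] by blast

lemma smooth_on_mult: "open S \<Longrightarrow> smooth_on S f \<Longrightarrow> smooth_on S g \<Longrightarrow> smooth_on S (\<lambda>x. f x * g x)"
  unfolding smooth_on_def using dbd_mult[of S "{}" "{}" "{}" "{()}" _ "\<lambda>_. f" "\<lambda>_. g"] by blast

lemma smooth_on_const: "open S \<Longrightarrow> smooth_on S (\<lambda>_. c)"
  unfolding smooth_on_def using dbd_param_const[of S "{()}" "{}" "\<lambda>_. c"] by auto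

lemma smooth_on_sum:
  assumes "open S" "finite I" "\<And>i. i \<in> I \<Longrightarrow> smooth_on S (f i)"
  shows "smooth_on S (\<lambda>x. \<Sum>i\<in>I. f i x)"
  using assms(2,3) by (induction I) (auto intro!: smooth_on_const smooth_on_add assms(1))

lemma smooth_onI:
  assumes "open S" "\<And>x. x \<in> S \<Longrightarrow> (f has_derivative f' x) (at x)"
    and "\<And>i. i \<in> Basis \<Longrightarrow> smooth_on S (\<lambda>x. f' x i)"
  shows "smooth_on S f"
proof -
  have "smooth_on S (dir_deriv i f)" if "i \<in> Basis" for i
    using smooth_on_cong[OF assms(1), of "dir_deriv i f" "\<lambda>x. f' x i"] assms(3)[OF that]
      dir_deriv_eq[OF assms(2)] by blast
  then show ?thesis using assms(2) by (subst smooth_on_iff) (auto simp: differentiable_def)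
qed

lemma smooth_on_inner_left: "open S \<Longrightarrow> smooth_on S (\<lambda>x. x \<bullet> i)"
  by (rule smooth_onI[where f' = "\<lambda>_ v. v \<bullet> i"]) (auto intro!: derivative_eq_intros smooth_on_const)

lemma smooth_on_real_deriv:
  assumes "open S" "\<And>x. x \<in> S \<Longrightarrow> (f has_real_derivative f' x) (at x)" "smooth_on S f'"
  shows "smooth_on S f"
  by (rule smooth_onI[OF assms(1), where f' = "\<lambda>x v. f' x * v"])
    (use assms(2,3) in \<open>auto simp: has_field_derivative_def\<close>)

lemma smooth_on_compose:
  fixes f :: "'a::euclidean_space \<Rightarrow> real"
  assumes "open S" "smooth_on T \<phi>" "smooth_on S f" "\<And>x. x \<in> S \<Longrightarrow> f x \<in> T"
  shows "smooth_on S (\<lambda>x. \<phi> (f x))"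
proof -
  have "dbd n S {()} {} (\<lambda>_ x. \<phi> (f x))" if "smooth_on T \<phi>" for n
    using that
  proof (induction n arbitrary: \<phi>)
    case 0
    then show ?case by simp
  next
    case (Suc n)
    show ?case
    proof (rule dbd_SucI[OF assms(1)])
      fix x assume x: "x \<in> S"
      have d: "\<phi> differentiable (at (f x))" using Suc.prems assms(4)[OF x] smooth_on_iff by blast
      have 1: "(\<phi> has_derivative (\<lambda>v. v * dir_deriv 1 \<phi> (f x))) (at (f x))"
        using has_derivative_dir_deriv[OF d] by (subst (asm) dir_deriv_Basis_sum[OF d]) simp
      have 2: "(f has_derivative (\<lambda>v. dir_deriv v f x)) (at x)"
        using assms(3) x smooth_on_iff by (intro has_derivative_dir_deriv) blast
      show "((\<lambda>x. \<phi> (f x)) has_derivative (\<lambda>v. dir_deriv v f x * dir_deriv 1 \<phi> (f x))) (at x)"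
        using diff_chain_at[OF 2 1] by (simp add: comp_def)
    next
      fix i :: 'a assume i: "i \<in> Basis"
      have "dbd n S {()} {} (\<lambda>_ x. dir_deriv 1 \<phi> (f x))"
        using Suc.prems smooth_on_iff[of T \<phi>] by (intro Suc.IH) simp
      moreover have "dbd n S {()} {} (\<lambda>_. dir_deriv i f)"
        using assms(3) i smooth_on_iff[of S f] by (simp add: smooth_on_def)
      ultimately show "dbd n S {()} {} (\<lambda>_ x. dir_deriv i f x * dir_deriv 1 \<phi> (f x))"
        using dbd_mult[of S "{}" "{}" "{}" "{()}" n "\<lambda>_. dir_deriv i f" "\<lambda>_ x. dir_deriv 1 \<phi> (f x)"] assms(1) by auto
    qed simp
  qed
  with assms(2) show ?thesis by (simp add: smooth_on_def)
qed

lemma smooth_on_powr_real: "smooth_on {0<..} (\<lambda>x::real. x powr a)"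
proof -
  have "dbd n {0<..} {()} {} (\<lambda>_ x::real. x powr a)" for n
  proof (induction n arbitrary: a)
    case 0
    then show ?case by simp
  next
    case (Suc n)
    show ?case
    proof (rule dbd_SucI)
      show "((\<lambda>x. x powr a) has_derivative (\<lambda>v. (a * v) * x powr (a - 1))) (at x)" if "x \<in> {0<..}" for x :: real
        using has_real_derivative_powr[of x a] that
        by (auto simp: has_field_derivative_def elim!: has_derivative_eq_rhs)
      show "dbd n {0<..} {()} {} (\<lambda>y x::real. (a * i) * x powr (a - 1))" for i
        by (rule dbd_param_mult[OF _ order_refl Suc]) auto
    qed auto
  qed
  then show ?thesis by (simp add: smooth_on_def)
qed

lemma smooth_on_ln: "smooth_on {0<..} (ln :: real \<Rightarrow> real)"
  by (rule smooth_on_real_deriv[OF _ _ smooth_on_powr_real[of "-1"]])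
    (auto intro!: derivative_eq_intros simp: powr_minus divide_inverse)

lemma smooth_on_exp: "smooth_on UNIV (exp :: real \<Rightarrow> real)"
proof -
  have "dbd n UNIV {()} {\<lambda>y x. exp x} (\<lambda>y x::real. exp x)" for n
    by (rule dbd_exp[where G = "\<lambda>_ _ v. v"]) (auto intro!: dbd_param_const bounded_by_singleI[of _ _ _ 1] derivative_eq_intros)
  then show ?thesis by (rule dbd_imp_smooth_on)
qed

lemma smooth_on_norm:
  assumes "open S" "\<And>x. x \<in> S \<Longrightarrow> x \<noteq> a"
  shows "smooth_on S (\<lambda>x::'a::euclidean_space. norm (x - a))"
proof -
  have "smooth_on S (\<lambda>x. (\<Sum>i\<in>Basis. (x \<bullet> i + - (a \<bullet> i)) * (x \<bullet> i + - (a \<bullet> i))) powr (1/2))"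
  proof (rule smooth_on_compose[OF assms(1) smooth_on_powr_real])
    show "smooth_on S (\<lambda>x. \<Sum>i\<in>Basis. (x \<bullet> i + - (a \<bullet> i)) * (x \<bullet> i + - (a \<bullet> i)))"
      by (intro smooth_on_sum smooth_on_mult smooth_on_add smooth_on_inner_left smooth_on_const assms(1)) auto
    show "(\<Sum>i\<in>Basis. (x \<bullet> i + - (a \<bullet> i)) * (x \<bullet> i + - (a \<bullet> i))) \<in> {0<..}" if "x \<in> S" for x
      using assms(2)[OF that] by (simp add: inner_diff_left[symmetric] euclidean_inner[symmetric])
  qed
  moreover have "norm (x - a) = (\<Sum>i\<in>Basis. (x \<bullet> i + - (a \<bullet> i)) * (x \<bullet> i + - (a \<bullet> i))) powr (1/2)" for x
    by (simp add: inner_diff_left[symmetric] euclidean_inner[symmetric] powr_half_sqrt norm_eq_sqrt_inner)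
  ultimately show ?thesis by simp
qed

section \<open>Flat functions\<close>

text \<open>These are the terms that arise when exp (-1/t), extended by 0, is differentiated; the
  linear span of the family is closed under differentiation.\<close>

definition flat :: "nat \<Rightarrow> real \<Rightarrow> real" where
  "flat k t = (if t > 0 then exp (- 1 / t) / t ^ k else 0)"

lemma flat_nonneg: "flat k t \<ge> 0"
  by (simp add: flat_def)

lemma power_le_fact_exp: "0 \<le> (x::real) \<Longrightarrow> x ^ k \<le> fact k * exp x"
proof -
  assume "0 \<le> x"
  have "(\<Sum>n\<in>{k}. x ^ n /\<^sub>R fact n) \<le> exp x"
    unfolding exp_def using \<open>0 \<le> x\<close> by (intro sum_le_suminf summable_exp_generic) auto
  then show ?thesis by (simp add: field_simps)
qed

text \<open>The pole is absorbed by a small part of the exponential: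
  \<open>(\<epsilon> / t) ^ k\<close> is at most
  \<open>fact k * exp (\<epsilon> / t)\<close>.\<close>

lemma flat_le:
  assumes "\<epsilon> > 0"
  shows "flat k t \<le> (fact k / \<epsilon> ^ k) * flat 0 t powr (1 - \<epsilon>)"
proof (cases "t > 0")
  case True
  have "(\<epsilon> / t) ^ k \<le> fact k * exp (\<epsilon> / t)" using assms True by (intro power_le_fact_exp) auto
  then have "exp (- 1 / t) * ((\<epsilon> / t) ^ k / \<epsilon> ^ k) \<le> exp (- 1 / t) * (fact k * exp (\<epsilon> / t) / \<epsilon> ^ k)"
    using assms by (intro mult_left_mono divide_right_mono) auto
  also have "\<dots> = (fact k / \<epsilon> ^ k) * exp ((- 1 / t) + \<epsilon> / t)" unfolding exp_add by simp
  also have "(- 1 / t) + \<epsilon> / t = (- 1 / t) * (1 - \<epsilon>)" using True by (simp add: field_simps)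
  also have "exp ((- 1 / t) * (1 - \<epsilon>)) = flat 0 t powr (1 - \<epsilon>)"
    using True by (simp add: flat_def powr_def mult.commute)
  also have "exp (- 1 / t) * ((\<epsilon> / t) ^ k / \<epsilon> ^ k) = flat k t"
    using True assms by (simp add: flat_def power_divide)
  finally show ?thesis .
qed (simp add: flat_def)

lemma flat_deriv: "(flat k has_real_derivative (flat (k + 2) t + (- real k) * flat (k + 1) t)) (at t)"
proof -
  consider "t > 0" | "t < 0" | "t = 0" by linarith
  then show ?thesis
  proof cases
    case 1
    have "real k * t ^ (k - Suc 0) = real k * t ^ k / t" using 1 by (cases k) auto
    then have p: "((\<lambda>t. t ^ k) has_real_derivative (real k * t ^ k / t)) (at t)"
      using DERIV_pow[of k t UNIV] by simp
    have "((\<lambda>t. exp (- 1 / t)) has_real_derivative exp (- 1 / t) / t\<^sup>2) (at t)"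
      using 1 by (auto intro!: derivative_eq_intros simp: power2_eq_square)
    from DERIV_divide[OF this p]
    have "((\<lambda>t. exp (- 1 / t) / t ^ k) has_real_derivative (flat (k + 2) t + (- real k) * flat (k + 1) t)) (at t)"
      by (rule DERIV_cong) (use 1 in \<open>auto simp: flat_def field_simps power2_eq_square\<close>)
    then show ?thesis
      by (rule has_field_derivative_transform_within_open[of _ _ _ "{0<..}"]) (use 1 in \<open>auto simp: flat_def\<close>)
  next
    case 2
    have "((\<lambda>t. 0) has_real_derivative 0) (at t)" by simp
    then show ?thesis using 2
      by (subst (1 2) flat_def) (auto intro: has_field_derivative_transform_within_open[of "\<lambda>_. 0" _ _ "{..<0}"] simp: flat_def)
  next
    case 3
    have "(flat k has_derivative (\<lambda>_. 0)) (at 0)"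
    proof (rule has_derivative_zero_quadratic[where M = "fact (k + 2)"])
      have "\<bar>flat k z\<bar> \<le> fact (k + 2) * (norm (z - 0))\<^sup>2" for z
      proof (cases "z > 0")
        case True
        \<comment> \<open>The exponential pays for two more powers of \<open>1 / z\<close> than
          \<open>flat k\<close> contains, which leaves the factor \<open>z\<^sup>2\<close>.\<close>
        have "(1 / z) ^ (k + 2) * exp (- 1 / z) \<le> fact (k + 2) * exp (1 / z) * exp (- 1 / z)"
          using True by (intro mult_right_mono power_le_fact_exp) auto
        also have "\<dots> = fact (k + 2)" by (simp add: mult.assoc exp_add[symmetric])
        finally have "(1 / z) ^ (k + 2) * exp (- 1 / z) * z\<^sup>2 \<le> fact (k + 2) * z\<^sup>2"
          by (intro mult_right_mono) auto
        moreover have "(1 / z) ^ (k + 2) * exp (- 1 / z) * z\<^sup>2 = flat k z"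
          using True by (simp add: flat_def field_simps power2_eq_square)
        ultimately show ?thesis using flat_nonneg[of k z] by simp
      qed (simp add: flat_def)
      then show "\<forall>\<^sub>F z in at 0. \<bar>flat k z\<bar> \<le> fact (k + 2) * (norm (z - 0))\<^sup>2" by simp
    qed (simp add: flat_def)
    then show ?thesis using 3 by (simp add: flat_def has_field_derivative_def lambda_zero)
  qed
qed

text \<open>The weight is \<open>flat 0\<close> for every \<open>k\<close>: the poles produced by
  differentiation only use up part of the loss.\<close>

lemma dbd_flat: "dbd n UNIV {()} (powers (\<lambda>_. flat 0) 1) (\<lambda>_. flat k)"
proof (induction n arbitrary: k)
  case 0
  have "\<exists>C\<ge>0. \<forall>x. \<bar>flat k x\<bar> \<le> C * flat 0 x powr (1 - \<epsilon>)" if "0 < \<epsilon>" for \<epsilon>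
    using flat_le[OF that, of k] flat_nonneg that by (intro exI[of _ "fact k / \<epsilon> ^ k"]) auto
  then show ?case by (auto simp: bounded_by_def powers_def)
next
  case (Suc n)
  show ?case
  proof (rule dbd_SucI)
    show "bounded_by UNIV {()} (powers (\<lambda>_. flat 0) 1) (\<lambda>_. flat k)" using Suc by (rule dbd_bounded_by)
    show "(flat k has_derivative (\<lambda>v. v * (flat (k + 2) t + (- real k) * flat (k + 1) t))) (at t)" for t
      using flat_deriv[of k t] by (simp add: has_field_derivative_def mult_commute_abs)
    show "dbd n UNIV {()} (powers (\<lambda>_. flat 0) 1) (\<lambda>_ t. i * (flat (k + 2) t + (- real k) * flat (k + 1) t))"
      for i :: real
      by (intro dbd_param_mult[OF _ order_refl] dbd_add Suc) auto
  qed simp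
qed

lemma dbd_affine_powers:
  fixes l :: "'p \<Rightarrow> 'a::euclidean_space \<Rightarrow> real"
  assumes "open S" "\<And>y. y \<in> P \<Longrightarrow> bounded_linear (l y)"
    and "\<And>y x. y \<in> P \<Longrightarrow> x \<in> S \<Longrightarrow> l y x + c y \<in> T"
    and "\<And>i. i \<in> Basis \<Longrightarrow> \<exists>K. \<forall>y\<in>P. \<bar>l y i\<bar> \<le> K"
    and "dbd n T {()} (powers (\<lambda>_. w) m) (\<lambda>_. f)"
  shows "dbd n S P (powers (\<lambda>y x. w (l y x + c y)) m) (\<lambda>y x. f (l y x + c y))"
proof -
  have "(\<lambda>\<beta> y x. \<beta> () (l y x + c y)) ` powers (\<lambda>_. w) m = powers (\<lambda>y x. w (l y x + c y)) m"
    unfolding powers_def image_image ..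
  with dbd_affine[OF assms] show ?thesis by simp
qed

definition bump :: "real \<Rightarrow> real" where
  "bump t = flat 0 t * flat 0 (1 - t)"

lemma dbd_bump: "dbd n UNIV {()} (powers (\<lambda>_. bump) 1) (\<lambda>_. bump)"
proof -
  have "dbd n UNIV {()} (powers (\<lambda>_ t. flat 0 (- t + 1)) 1) (\<lambda>_ t. flat 0 (- t + 1))"
    by (rule dbd_affine_powers[where l = "\<lambda>_ t. - t" and c = "\<lambda>_. 1", OF _ _ _ _ dbd_flat])
      (auto intro: bounded_linear_minus bounded_linear_ident)
  from dbd_powers_mult_weight[OF _ dbd_flat[of n 0] this] show ?thesis
    by (simp add: bump_def[abs_def] flat_nonneg)
qed

lemma bump_nonneg: "bump t \<ge> 0"
  by (simp add: bump_def flat_nonneg)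

lemma bump_pos: "0 < t \<Longrightarrow> t < 1 \<Longrightarrow> bump t > 0"
  by (simp add: bump_def flat_def)

lemma bump_zero: "t \<le> 0 \<or> t \<ge> 1 \<Longrightarrow> bump t = 0"
  by (auto simp: bump_def flat_def)

lemma bump_le: "bump t \<le> 1"
  unfolding bump_def by (rule mult_le_one) (auto simp: flat_def)

lemma continuous_on_bump: "continuous_on S bump"
proof -
  have "smooth_on UNIV bump" by (rule dbd_imp_smooth_on[OF dbd_bump])
  then show ?thesis using smooth_on_imp_continuous_on continuous_on_subset by blast
qed

section \<open>Integrability of powers of the norm\<close>

text \<open>A substitute for polar coordinates: at each point a single term of the series of
  multiples of indicators of balls dominates \<open>f\<close>, and the series has a finite
  integral.\<close>

lemma nn_integral_dyadic_le:
  fixes f :: "'a::euclidean_space \<Rightarrow> real" and c r :: "nat \<Rightarrow> real"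
  assumes "f \<in> borel_measurable lborel" "\<And>k. c k \<ge> 0" "\<And>k. r k \<ge> 0"
    and le: "\<And>x. f x \<noteq> 0 \<Longrightarrow> \<exists>k. norm x < r k \<and> \<bar>f x\<bar> \<le> c k"
    and "summable (\<lambda>k. c k * r k ^ DIM('a))"
  shows "integrable lborel f"
proof (rule integrableI_bounded)
  define v where "v = measure lborel (ball (0::'a) 1)"
  have em: "emeasure lborel (ball (0::'a) (r k)) = ennreal (r k ^ DIM('a) * v)" for k
    using content_ball_conv_unit_ball[of "r k" "0::'a"] assms(3)[of k] emeasure_lborel_ball_finite[of "0::'a" "r k"]
    by (simp add: emeasure_eq_ennreal_measure v_def)
  have m: "(\<lambda>x. ennreal (c k) * indicator (ball (0::'a) (r k)) x) \<in> borel_measurable lborel" for k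
    by (intro borel_measurable_times_ennreal borel_measurable_const borel_measurable_indicator) auto
  have "(\<integral>\<^sup>+ x. ennreal (norm (f x)) \<partial>lborel) \<le> (\<integral>\<^sup>+ x. (\<Sum>k. ennreal (c k) * indicator (ball (0::'a) (r k)) x) \<partial>lborel)"
  proof (rule nn_integral_mono)
    fix x
    show "ennreal (norm (f x)) \<le> (\<Sum>k. ennreal (c k) * indicator (ball 0 (r k)) x)"
    proof (cases "f x = 0")
      case False
      then obtain k where k: "norm x < r k" "\<bar>f x\<bar> \<le> c k" using le by blast
      have "ennreal (norm (f x)) \<le> (\<Sum>k\<in>{k}. ennreal (c k) * indicator (ball 0 (r k)) x)"
        using k by (simp add: ennreal_leI)
      also have "\<dots> \<le> (\<Sum>k. ennreal (c k) * indicator (ball 0 (r k)) x)"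
        by (intro sum_le_suminf) auto
      finally show ?thesis .
    qed simp
  qed
  also have "\<dots> = (\<Sum>k. ennreal (c k * r k ^ DIM('a) * v))"
    using assms(2,3) m by (subst nn_integral_suminf) (auto simp: nn_integral_cmult_indicator em ennreal_mult[symmetric] v_def mult.assoc)
  also have "\<dots> = ennreal (\<Sum>k. c k * r k ^ DIM('a) * v)"
    using assms by (intro suminf_ennreal2 summable_mult2) (auto simp: v_def)
  also have "\<dots> < \<infinity>" by simp
  finally show "(\<integral>\<^sup>+ x. ennreal (norm (f x)) \<partial>lborel) < \<infinity>" .
qed (use assms in auto)

lemma summable_two_powr: "\<gamma> < 0 \<Longrightarrow> summable (\<lambda>k. 2 powr (\<gamma> * real k))"
proof -
  assume "\<gamma> < 0"
  have "2 powr (\<gamma> * real k) = (2 powr \<gamma>) ^ k" for k by (simp add: powr_powr[symmetric] powr_realpow)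
  moreover have "norm (2 powr \<gamma>) < 1" using \<open>\<gamma> < 0\<close> powr_less_mono[of \<gamma> 0 2] by simp
  ultimately show ?thesis using summable_geometric[of "2 powr \<gamma>"] by simp
qed

text \<open>On the dyadic shell with outer radius \<open>r * 2 powr (- real k)\<close> the power is
  comparable with its value at that radius; the factor \<open>max 1 (2 powr (- \<alpha>))\<close>
  covers both signs of \<open>\<alpha>\<close>. The series is geometric, and the hypothesis on
  \<open>\<alpha>\<close> is its convergence.\<close>

lemma integrable_norm_powr_ball:
  fixes \<alpha> r :: real
  assumes "\<alpha> > - real DIM('a::euclidean_space)" "r > 0"
  shows "integrable lborel (\<lambda>h::'a. indicator (ball 0 r) h * norm h powr \<alpha>)"
proof (rule nn_integral_dyadic_le[where r = "\<lambda>k. r * 2 powr (- real k)"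
      and c = "\<lambda>k. max 1 (2 powr (- \<alpha>)) * (r * 2 powr (- real k)) powr \<alpha>"])
  fix x :: 'a assume "indicator (ball 0 r) x * norm x powr \<alpha> \<noteq> 0"
  then have x: "norm x < r" "norm x > 0" by (auto simp: indicator_def split: if_splits)
  define s where "s = - log 2 (norm x / r)"
  have s: "s > 0" using x assms(2) by (simp add: s_def)
  have xs: "norm x = r * 2 powr (- s)" using x assms(2) by (simp add: s_def)
  \<comment> \<open>The ceiling minus one gives \<open>k < s\<close> strictly, as the covering balls
    are open.\<close>
  define k where "k = nat (\<lceil>s\<rceil> - 1)"
  have "real k = real_of_int \<lceil>s\<rceil> - 1" using s by (simp add: k_def)
  then have k: "real k < s" "s \<le> real k + 1" by linarith+
  have "norm x powr \<alpha> \<le> max 1 (2 powr (- \<alpha>)) * (r * 2 powr (- real k)) powr \<alpha>"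
  proof -
    have "norm x powr \<alpha> = 2 powr (- \<alpha> * (s - real k)) * (r * 2 powr (- real k)) powr \<alpha>"
      using assms(2) by (simp add: xs powr_mult powr_powr powr_add[symmetric] algebra_simps)
    moreover have "2 powr (- \<alpha> * (s - real k)) \<le> max 1 (2 powr (- \<alpha>))"
    proof (cases "\<alpha> \<ge> 0")
      case True
      then have "2 powr (- \<alpha> * (s - real k)) \<le> 2 powr 0" using k by (intro powr_mono) auto
      then show ?thesis by simp
    next
      case False
      have "- \<alpha> * (s - real k) \<le> - \<alpha> * 1" using False k by (intro mult_left_mono) auto
      then have "2 powr (- \<alpha> * (s - real k)) \<le> 2 powr (- \<alpha>)" by (intro powr_mono) auto
      then show ?thesis by (rule max.coboundedI2)
    qed
    ultimately show ?thesis by (simp add: mult_right_mono)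
  qed
  moreover have "norm x < r * 2 powr (- real k)"
    using k assms(2) by (simp add: xs)
  ultimately show "\<exists>k. norm x < r * 2 powr (- real k) \<and>
      \<bar>indicator (ball 0 r) x * norm x powr \<alpha>\<bar> \<le> max 1 (2 powr (- \<alpha>)) * (r * 2 powr (- real k)) powr \<alpha>"
    using x by (intro exI[of _ k]) auto
next
  have eq: "max 1 (2 powr (- \<alpha>)) * (r * 2 powr (- real k)) powr \<alpha> * (r * 2 powr (- real k)) ^ DIM('a)
      = (max 1 (2 powr (- \<alpha>)) * r powr (\<alpha> + DIM('a))) * 2 powr (- (\<alpha> + DIM('a)) * real k)" for k
  proof -
    have "(r * 2 powr (- real k)) powr \<alpha> * (r * 2 powr (- real k)) ^ DIM('a) = (r * 2 powr (- real k)) powr (\<alpha> + DIM('a))"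
      using assms(2) by (simp add: powr_add powr_realpow)
    also have "\<dots> = r powr (\<alpha> + DIM('a)) * 2 powr (- (\<alpha> + DIM('a)) * real k)"
      using assms(2) by (simp add: powr_mult powr_powr algebra_simps)
    finally show ?thesis by (simp add: mult.assoc)
  qed
  show "summable (\<lambda>k. max 1 (2 powr (- \<alpha>)) * (r * 2 powr (- real k)) powr \<alpha> * (r * 2 powr (- real k)) ^ DIM('a))"
    unfolding eq using assms by (intro summable_mult summable_two_powr) auto
  have [measurable]: "ball (0::'a) r \<in> sets lborel" by simp
  show "(\<lambda>h::'a. indicator (ball 0 r) h * norm h powr \<alpha>) \<in> borel_measurable lborel" by measurable
qed (use assms in \<open>auto simp: le_max_iff_disj\<close>)

text \<open>Since \<open>\<alpha>\<close> is negative, the inner radius of a dyadic shell bounds the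
  power, while the outer radius gives the covering ball.\<close>

lemma integrable_norm_powr_compl:
  fixes \<alpha> r :: real
  assumes "\<alpha> < - real DIM('a::euclidean_space)" "r > 0"
  shows "integrable lborel (\<lambda>h::'a. indicator (- ball 0 r) h * norm h powr \<alpha>)"
proof (rule nn_integral_dyadic_le[where r = "\<lambda>k. r * 2 powr (real k + 1)"
      and c = "\<lambda>k. (r * 2 powr (real k)) powr \<alpha>"])
  have \<alpha>: "\<alpha> < 0" using assms(1) by (rule less_le_trans) simp
  fix x :: 'a assume "indicator (- ball 0 r) x * norm x powr \<alpha> \<noteq> 0"
  then have x: "norm x \<ge> r" "norm x > 0" using assms(2) by (auto simp: indicator_def split: if_splits)
  define s where "s = log 2 (norm x / r)"
  have s: "s \<ge> 0" using x assms(2) by (simp add: s_def)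
  have xs: "norm x = r * 2 powr s" using x assms(2) by (simp add: s_def)
  define k where "k = nat \<lfloor>s\<rfloor>"
  have "real k = real_of_int \<lfloor>s\<rfloor>" using s by (simp add: k_def)
  then have k: "real k \<le> s" "s < real k + 1" by linarith+
  have "norm x powr \<alpha> \<le> (r * 2 powr (real k)) powr \<alpha>"
    using k assms(2) \<alpha> unfolding xs by (intro powr_mono2') auto
  moreover have "norm x < r * 2 powr (real k + 1)"
    using k assms(2) by (simp add: xs del: powr_add)
  ultimately show "\<exists>k. norm x < r * 2 powr (real k + 1) \<and>
      \<bar>indicator (- ball 0 r) x * norm x powr \<alpha>\<bar> \<le> (r * 2 powr (real k)) powr \<alpha>"
    using x by (intro exI[of _ k]) auto
next
  have eq: "(r * 2 powr (real k)) powr \<alpha> * (r * 2 powr (real k + 1)) ^ DIM('a)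
      = (r powr (\<alpha> + DIM('a)) * 2 ^ DIM('a)) * 2 powr ((\<alpha> + DIM('a)) * real k)" for k
  proof -
    have "(r * 2 powr (real k + 1)) ^ DIM('a) = 2 ^ DIM('a) * (r * 2 powr (real k)) ^ DIM('a)"
      by (simp add: powr_add power_mult_distrib mult_ac)
    moreover have "(r * 2 powr (real k)) powr \<alpha> * (r * 2 powr (real k)) ^ DIM('a) = (r * 2 powr (real k)) powr (\<alpha> + DIM('a))"
      using assms(2) by (simp add: powr_add powr_realpow)
    moreover have "\<dots> = r powr (\<alpha> + DIM('a)) * 2 powr ((\<alpha> + DIM('a)) * real k)"
      using assms(2) by (simp add: powr_mult powr_powr mult.commute)
    ultimately show ?thesis by (simp add: mult_ac)
  qed
  show "summable (\<lambda>k. (r * 2 powr (real k)) powr \<alpha> * (r * 2 powr (real k + 1)) ^ DIM('a))"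
    unfolding eq using assms by (intro summable_mult summable_two_powr) auto
  have [measurable]: "ball (0::'a) r \<in> sets lborel" by simp
  show "(\<lambda>h::'a. indicator (- ball 0 r) h * norm h powr \<alpha>) \<in> borel_measurable lborel" by measurable
qed (use assms in auto)

section \<open>The odd power nonlinearity\<close>

definition spow :: "real \<Rightarrow> real \<Rightarrow> real" where
  "spow p t = \<bar>t\<bar> powr (p - 2) * t"

lemma spow_mult: "spow p (x * y) = spow p x * spow p y"
  by (simp add: spow_def abs_mult powr_mult)

lemma spow_nonneg: "x \<ge> 0 \<Longrightarrow> spow p x = x powr (p - 1)"
  by (cases "x = 0") (auto simp: spow_def powr_diff power2_eq_square divide_simps powr_numeral)

lemma spow_minus: "spow p (- x) = - spow p x"
  by (simp add: spow_def)

lemma abs_spow: "\<bar>spow p x\<bar> = \<bar>x\<bar> powr (p - 1)"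
  using spow_nonneg[of "\<bar>x\<bar>" p] by (simp add: spow_def abs_mult)

text \<open>The mean value theorem applies when the signs agree. When they differ,
  \<open>\<bar>x - y\<bar>\<close> is the sum of the absolute values and the triangle inequality
  suffices because \<open>p - 1 \<ge> 1\<close>.\<close>

lemma spow_lipschitz:
  assumes "p > 2" "\<bar>x\<bar> \<le> R" "\<bar>y\<bar> \<le> R"
  shows "\<bar>spow p x - spow p y\<bar> \<le> (p - 1) * R powr (p - 2) * \<bar>x - y\<bar>"
proof -
  have pos: "\<bar>x powr (p - 1) - y powr (p - 1)\<bar> \<le> (p - 1) * R powr (p - 2) * \<bar>x - y\<bar>"
    if "0 \<le> y" "y < x" "x \<le> R" for x y
  proof -
    have cont: "continuous_on {y..x} (\<lambda>t. t powr (p - 1))"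
      using that assms(1) by (intro continuous_on_powr') (auto intro!: continuous_intros)
    have "((\<lambda>t. t powr (p - 1)) has_derivative (\<lambda>v. v * ((p - 1) * t powr (p - 2)))) (at t)" if "y < t" "t < x" for t
      using has_real_derivative_powr[of t "p - 1"] that \<open>0 \<le> y\<close>
      by (simp add: has_field_derivative_def mult_commute_abs)
    from mvt[OF \<open>y < x\<close> cont this] obtain \<xi> where \<xi>: "y < \<xi>" "\<xi> < x"
      "x powr (p - 1) - y powr (p - 1) = (x - y) * ((p - 1) * \<xi> powr (p - 2))" by auto
    have "\<xi> powr (p - 2) \<le> R powr (p - 2)" using \<xi> that assms(1) by (intro powr_mono2) auto
    then have "(x - y) * ((p - 1) * \<xi> powr (p - 2)) \<le> (x - y) * ((p - 1) * R powr (p - 2))"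
      using that assms(1) by (intro mult_left_mono) auto
    moreover have "(x - y) * ((p - 1) * \<xi> powr (p - 2)) \<ge> 0" using that assms(1) by simp
    ultimately show ?thesis using \<xi>(3) that by (simp add: mult.commute mult.left_commute)
  qed
  have pos': "\<bar>spow p x - spow p y\<bar> \<le> (p - 1) * R powr (p - 2) * \<bar>x - y\<bar>"
    if "0 \<le> y" "0 \<le> x" "x \<le> R" "y \<le> R" for x y
    using pos[of x y] pos[of y x] that by (cases x y rule: linorder_cases) (auto simp: spow_nonneg abs_minus_commute)
  have mix: "\<bar>spow p x - spow p y\<bar> \<le> (p - 1) * R powr (p - 2) * \<bar>x - y\<bar>"
    if "y \<le> 0" "0 \<le> x" "x \<le> R" "- y \<le> R" for x y
  proof -
    have "\<bar>spow p x - spow p y\<bar> \<le> \<bar>x\<bar> powr (p - 2) * \<bar>x\<bar> + \<bar>y\<bar> powr (p - 2) * \<bar>y\<bar>"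
      unfolding spow_def by (rule order_trans[OF abs_triangle_ineq4]) (simp add: abs_mult)
    also have "\<dots> \<le> R powr (p - 2) * \<bar>x\<bar> + R powr (p - 2) * \<bar>y\<bar>"
      using that assms(1) by (intro add_mono mult_right_mono powr_mono2) auto
    also have "\<dots> = 1 * (R powr (p - 2) * \<bar>x - y\<bar>)" using that by (simp add: algebra_simps)
    also have "\<dots> \<le> (p - 1) * (R powr (p - 2) * \<bar>x - y\<bar>)"
      using assms(1) by (intro mult_right_mono) auto
    finally show ?thesis by (simp add: mult.assoc)
  qed
  consider "0 \<le> x" "0 \<le> y" | "x \<le> 0" "y \<le> 0" | "0 \<le> x" "y \<le> 0" | "x \<le> 0" "0 \<le> y" by linarith
  then show ?thesis
  proof cases
    case 1 then show ?thesis using pos'[of y x] assms by auto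
  next
    case 2 then show ?thesis using pos'[of "- x" "- y"] assms by (auto simp: spow_minus abs_minus_commute)
  next
    case 3 then show ?thesis using mix[of y x] assms by auto
  next
    case 4 then show ?thesis using mix[of x y] assms by (auto simp: abs_minus_commute)
  qed
qed

lemma continuous_on_spow:
  assumes "p > 2" "continuous_on S f"
  shows "continuous_on S (\<lambda>x. spow p (f x))"
  unfolding spow_def using assms
  by (intro continuous_on_mult continuous_on_powr' continuous_on_rabs continuous_on_const) auto

section \<open>Monotone profiles with flat plateaus\<close>

text \<open>\<open>F\<close> is a radial profile in the variable \<open>t = ln\<close> of the
  distance, so \<open>m\<close> is an exponent of polynomial growth. Vanishing of \<open>w\<close>
  for \<open>t \<le> -1\<close> makes the radial function constant near its centre, where the
  logarithm is singular. The last assumption is the comparability of \<open>w\<close> with all its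
  derivatives.\<close>

locale profile =
  fixes w F :: "real \<Rightarrow> real" and m :: real
  assumes m: "m \<ge> 0"
    and F_deriv: "\<And>t. (F has_real_derivative exp (m * t) * w t) (at t)"
    and w_nonneg: "\<And>t. w t \<ge> 0"
    and w_zero: "\<And>t. t \<le> -1 \<Longrightarrow> w t = 0"
    and w_bdd: "\<And>A. \<exists>K. \<forall>t>-A. w t \<le> K"
    and w_dbd: "\<And>A n. dbd n {-A<..} {()} (powers (\<lambda>_. w) 1) (\<lambda>_. w)"
begin

definition unit_int :: "real measure" where
  "unit_int = restrict_space lborel {0..1}"

text \<open>For \<open>b \<noteq> 0\<close> this is the quotient of \<open>F (a + b) - F a\<close>
  by \<open>b * exp (m * b)\<close>. Splitting off \<open>exp (m * b)\<close> leaves an exponential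
  that stays bounded as \<open>b\<close> tends to infinity, and splitting off \<open>b\<close>
  leaves a nonnegative quantity.\<close>

definition mean_slope :: "real \<times> real \<Rightarrow> real" where
  "mean_slope x = (\<integral>\<theta>. exp (m * (fst x - (1 - \<theta>) * snd x)) * w (fst x + \<theta> * snd x) \<partial>unit_int)"

lemma smooth_w: "smooth_on UNIV w"
proof (rule smooth_on_local)
  fix x :: real
  have "smooth_on {- (1 - x)<..} w" by (rule dbd_imp_smooth_on[OF w_dbd])
  then show "\<exists>T. x \<in> T \<and> smooth_on T w" by (intro exI[of _ "{- (1 - x)<..}"]) auto
qed

lemma continuous_w: "continuous_on S w"
  using smooth_on_imp_continuous_on[OF smooth_w] continuous_on_subset by blast

lemma smooth_F: "smooth_on UNIV F"
  by (rule smooth_on_real_deriv[OF _ F_deriv])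
    (auto intro!: smooth_on_mult smooth_w smooth_on_compose[OF _ smooth_on_exp] smooth_on_const
      smooth_on_inner_left[where 'a = real and i = 1, simplified])

lemma space_unit_int: "space unit_int = {0..1}"
  by (simp add: unit_int_def space_restrict_space)

lemma finite_unit_int: "finite_measure unit_int" "measure unit_int (space unit_int) = 1"
proof -
  have "emeasure unit_int (space unit_int) = 1"
    by (simp add: space_unit_int) (simp add: unit_int_def emeasure_restrict_space)
  then show "finite_measure unit_int" "measure unit_int (space unit_int) = 1"
    by (auto intro!: finite_measureI simp: measure_def)
qed

text \<open>The integrand is an exponential, which is its own weight, times \<open>w\<close> along
  an affine family; so it is comparable with its derivatives uniformly in \<open>\<theta>\<close>,
  and averaging keeps this. The lower bound \<open>- B\<close> for the second coordinate controls
  both factors.\<close>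

lemma dbd_mean_slope:
  assumes "B \<ge> 0" "S = {lo<..<hi} \<times> {-B<..}"
  shows "dbd n S {()} (powers (\<lambda>_. mean_slope) 1) (\<lambda>_. mean_slope)"
    and "\<exists>K. \<forall>x\<in>S. 0 \<le> mean_slope x \<and> mean_slope x \<le> K"
proof -
  let ?e = "\<lambda>\<theta> x. exp (m * (fst x - (1 - \<theta>) * snd x))"
  let ?l = "\<lambda>\<theta> x::real \<times> real. fst x + \<theta> * snd x"
  have S: "open S" using assms(2) by (auto intro: open_Times)
  have e_bound: "?e \<theta> x \<le> exp (m * (hi + B))" if "\<theta> \<in> {0..1}" "x \<in> S" for \<theta> x
  proof -
    have "(1 - \<theta>) * (- snd x) \<le> (1 - \<theta>) * B" using that assms by (intro mult_left_mono) auto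
    also have "\<dots> \<le> 1 * B" using that assms by (intro mult_right_mono) auto
    finally have "fst x - (1 - \<theta>) * snd x \<le> hi + B" using that assms by auto
    then show ?thesis using m by (simp add: mult_left_mono)
  qed
  have l_bound: "?l \<theta> x > - (B - lo)" if "\<theta> \<in> {0..1}" "x \<in> S" for \<theta> x
  proof -
    have "\<theta> * (- snd x) \<le> \<theta> * B" using that assms by (intro mult_left_mono) auto
    also have "\<dots> \<le> 1 * B" using that assms by (intro mult_right_mono) auto
    finally show ?thesis using that assms by auto
  qed
  obtain K where K: "\<And>t. t > - (B - lo) \<Longrightarrow> w t \<le> K" using w_bdd by blast
  have prod_bound: "0 \<le> ?e \<theta> x * w (?l \<theta> x) \<and> ?e \<theta> x * w (?l \<theta> x) \<le> exp (m * (hi + B)) * K"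
    if "\<theta> \<in> space unit_int" "x \<in> S" for \<theta> x
    using that e_bound[of \<theta> x] K[OF l_bound, of \<theta> x] w_nonneg[of "?l \<theta> x"]
    by (auto simp: space_unit_int intro!: mult_mono mult_nonneg_nonneg)
  have basis: "\<bar>fst i\<bar> \<le> 1 \<and> \<bar>snd i\<bar> \<le> 1" if "i \<in> Basis" for i :: "real \<times> real"
    using that by (auto simp: Basis_prod_def)
  have dl: "dbd n S {0..1} {\<lambda>\<theta> x. 1} (\<lambda>\<theta> x. m * (fst i - (1 - \<theta>) * snd i))" if "i \<in> Basis" for n and i :: "real \<times> real"
  proof (rule dbd_param_const[OF S])
    show "bounded_by S {0..1} {\<lambda>\<theta> x. 1} (\<lambda>\<theta> x. m * (fst i - (1 - \<theta>) * snd i))"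
    proof (rule bounded_by_singleI[of _ _ _ "m * 2"])
      fix \<theta> x assume "\<theta> \<in> {0..1::real}"
      then have "\<bar>(1 - \<theta>) * snd i\<bar> \<le> 1 * 1" unfolding abs_mult using basis[OF that] by (intro mult_mono) auto
      then have "\<bar>fst i - (1 - \<theta>) * snd i\<bar> \<le> 2" using basis[OF that] by linarith
      then show "\<bar>m * (fst i - (1 - \<theta>) * snd i)\<bar> \<le> m * 2 * 1" using m by (simp add: abs_mult mult_left_mono)
    qed (use m in simp)
  qed auto
  have de: "dbd n S {0..1} (powers ?e 1) ?e" for n
  proof (rule dbd_powers_self_bounded)
    show "dbd n S {0..1} {?e} ?e"
      by (rule dbd_exp[where G = "\<lambda>\<theta> _ i. m * (fst i - (1 - \<theta>) * snd i)", OF S _ dl])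
        (auto intro!: derivative_eq_intros)
    show "0 \<le> ?e \<theta> x \<and> ?e \<theta> x \<le> exp (m * (hi + B))" if "\<theta> \<in> {0..1}" "x \<in> S" for \<theta> x
      using e_bound[OF that] by simp
  qed
  have dw: "dbd n S {0..1} (powers (\<lambda>\<theta> x. w (?l \<theta> x + 0)) 1) (\<lambda>\<theta> x. w (?l \<theta> x + 0))" for n
  proof (rule dbd_affine_powers[OF S, where T = "{- (B - lo)<..}"])
    show "bounded_linear (?l \<theta>)" for \<theta> by (intro bounded_linear_add bounded_linear_fst bounded_linear_compose[OF bounded_linear_mult_right bounded_linear_snd])
    show "\<exists>K. \<forall>\<theta>\<in>{0..1}. \<bar>?l \<theta> i\<bar> \<le> K" if "i \<in> Basis" for i :: "real \<times> real"
    proof (intro exI[of _ "2::real"] ballI)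
      fix \<theta> :: real assume "\<theta> \<in> {0..1::real}"
      then have "\<bar>\<theta> * snd i\<bar> \<le> 1 * 1" unfolding abs_mult using basis[OF that] by (intro mult_mono) auto
      then show "\<bar>?l \<theta> i\<bar> \<le> 2" using basis[OF that] by linarith
    qed
  qed (use l_bound w_dbd[of n "B - lo"] in auto)
  have d: "dbd n S (space unit_int) (powers (\<lambda>\<theta> x. ?e \<theta> x * w (?l \<theta> x)) 1) (\<lambda>\<theta> x. ?e \<theta> x * w (?l \<theta> x))" for n
    using dbd_powers_mult_weight[OF S de dw] w_nonneg by (simp add: space_unit_int)
  have meas: "(\<lambda>\<theta>. ?e \<theta> x * w (?l \<theta> x)) \<in> borel_measurable unit_int" for x
  proof -
    have "continuous_on UNIV (\<lambda>\<theta>. ?e \<theta> x * w (?l \<theta> x))"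
      by (auto intro!: continuous_intros continuous_on_compose2[OF continuous_w[of UNIV]])
    from borel_measurable_continuous_onI[OF this] show ?thesis
      unfolding unit_int_def by (intro measurable_restrict_space1) simp
  qed
  show "dbd n S {()} (powers (\<lambda>_. mean_slope) 1) (\<lambda>_. mean_slope)"
    using dbd_average[OF S finite_unit_int prod_bound meas d]
    by (simp add: mean_slope_def[abs_def])
  show "\<exists>K. \<forall>x\<in>S. 0 \<le> mean_slope x \<and> mean_slope x \<le> K"
  proof (intro exI ballI conjI)
    fix x assume x: "x \<in> S"
    interpret finite_measure unit_int by (rule finite_unit_int)
    show "0 \<le> mean_slope x" unfolding mean_slope_def
      using prod_bound[OF _ x] by (intro integral_nonneg_AE AE_I2) auto
    have "integrable unit_int (\<lambda>\<theta>. ?e \<theta> x * w (?l \<theta> x))"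
      using prod_bound[OF _ x] by (intro integrable_const_bound[of _ "exp (m * (hi + B)) * K"] meas AE_I2) auto
    then have "mean_slope x \<le> (\<integral>\<theta>. exp (m * (hi + B)) * K \<partial>unit_int)" unfolding mean_slope_def
      using prod_bound[OF _ x] by (intro integral_mono) auto
    then show "mean_slope x \<le> exp (m * (hi + B)) * K" using finite_unit_int(2) by simp
  qed
qed

text \<open>The fundamental theorem of calculus on the segment from \<open>a\<close> to
  \<open>a + b\<close>, rescaled to the unit interval.\<close>

lemma F_diff: "F (a + b) - F a = b * exp (m * b) * mean_slope (a, b)"
proof -
  let ?g = "\<lambda>\<theta>. b * (exp (m * (a + \<theta> * b)) * w (a + \<theta> * b))"
  have "(\<integral>\<theta>. ?g \<theta> * indicator {0..1} \<theta> \<partial>lborel) = F (a + 1 * b) - F (a + 0 * b)"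
  proof (rule integral_FTC_Icc_real[where F = "\<lambda>\<theta>. F (a + \<theta> * b)"])
    fix \<theta>
    have "((\<lambda>\<theta>. a + \<theta> * b) has_real_derivative b) (at \<theta>)" by (auto intro!: derivative_eq_intros)
    from DERIV_chain2[OF F_deriv this]
    show "((\<lambda>\<theta>. F (a + \<theta> * b)) has_real_derivative ?g \<theta>) (at \<theta>)" by (simp add: mult_ac)
  next
    fix \<theta>
    have "continuous_on UNIV ?g"
      by (auto intro!: continuous_intros continuous_on_compose2[OF continuous_w[of UNIV]])
    then show "isCont ?g \<theta>" by (simp add: continuous_on_eq_continuous_at)
  qed simp
  moreover have "(\<integral>\<theta>. ?g \<theta> * indicator {0..1} \<theta> \<partial>lborel) = (\<integral>\<theta>. ?g \<theta> \<partial>unit_int)"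
    unfolding unit_int_def by (subst integral_restrict_space) (auto simp: mult.commute)
  moreover have "(\<integral>\<theta>. ?g \<theta> \<partial>unit_int) = (\<integral>\<theta>. (b * exp (m * b)) * (exp (m * (a - (1 - \<theta>) * b)) * w (a + \<theta> * b)) \<partial>unit_int)"
    by (intro Bochner_Integration.integral_cong) (auto simp: exp_add[symmetric] algebra_simps)
  ultimately show ?thesis by (simp add: mean_slope_def)
qed

lemma mean_slope_nonneg: "mean_slope x \<ge> 0"
  unfolding mean_slope_def using w_nonneg by (intro integral_nonneg_AE AE_I2) auto

text \<open>The degenerate factor depends on \<open>b\<close> alone, while \<open>a\<close> enters
  only through a positive power of a nonnegative mean. Monotonicity of \<open>F\<close> is what
  makes the mean nonnegative and the power unsigned.\<close>

lemma spow_F_diff: "spow p (F (a + b) - F a) = spow p b * exp (m * (p - 1) * b) * mean_slope (a, b) powr (p - 1)"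
  unfolding F_diff spow_mult using mean_slope_nonneg
  by (simp add: spow_nonneg exp_powr_real mult_ac)

end

section \<open>The logarithm of the norm near a unit vector, and symmetric pairs of points\<close>

lemma abs_ln_le:
  assumes "0 < c" "c \<le> 1" "c \<le> (x::real)"
  shows "\<bar>ln x\<bar> \<le> \<bar>x - 1\<bar> / c"
proof -
  have x: "x > 0" using assms by linarith
  have 1: "ln x \<le> x - 1" using ln_le_minus_one[OF x] .
  have 2: "- ln x \<le> 1 / x - 1" using ln_le_minus_one[of "1 / x"] x by (simp add: ln_div)
  have c: "\<bar>x - 1\<bar> \<le> \<bar>x - 1\<bar> / c" using assms(1,2) by (simp add: le_divide_eq mult_left_le)
  have "1 / x - 1 \<le> \<bar>x - 1\<bar> / c"
  proof -
    have "1 / x - 1 = (1 - x) / x" using x by (simp add: field_simps)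
    also have "\<dots> \<le> \<bar>x - 1\<bar> / x" using x by (intro divide_right_mono) auto
    also have "\<dots> \<le> \<bar>x - 1\<bar> / c" using assms x by (intro divide_left_mono) auto
    finally show ?thesis .
  qed
  with 1 2 c show ?thesis by linarith
qed

text \<open>The truncation costs nothing, as the profiles are constant on the left half-line, and makes
  the function bounded near the origin.\<close>

definition lognorm :: "real \<Rightarrow> 'a::real_normed_vector \<Rightarrow> real" where
  "lognorm B z = ln (max (norm z) (exp (- B)))"

lemma lognorm_ge: "lognorm B z \<ge> - B"
proof -
  have "ln (exp (- B)) \<le> lognorm B z" unfolding lognorm_def
    by (subst ln_le_cancel_iff) (auto simp: less_max_iff_disj)
  then show ?thesis by simp
qed

text \<open>The truncation is inactive near \<open>e\<close>: \<open>norm (e + h) \<ge> 3/4\<close>,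
  whereas \<open>exp (- B) \<le> exp (- 1) \<le> 1/2\<close>.\<close>

lemma lognorm_near:
  assumes "norm (e::'a::real_inner) = 1" "norm h \<le> 1/4" "B \<ge> 1"
  shows "lognorm B (e + h) = ln (norm (e + h))" "\<bar>lognorm B (e + h)\<bar> \<le> 2 * norm h"
proof -
  have n: "norm (e + h) \<ge> 3/4" "\<bar>norm (e + h) - 1\<bar> \<le> norm h"
    using norm_triangle_ineq2[of e "- h"] norm_triangle_ineq[of e h] norm_triangle_ineq2[of "e + h" h] assms by auto
  have "exp 1 \<ge> (2::real)" using exp_ge_add_one_self[of 1] by simp
  then have "exp (- 1) \<le> (1/2::real)" by (simp add: exp_minus field_simps)
  moreover have "exp (- B) \<le> exp (- 1)" using assms by simp
  ultimately have "exp (- B) \<le> norm (e + h)" using n(1) by linarith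
  then show eq: "lognorm B (e + h) = ln (norm (e + h))" by (simp add: lognorm_def max_def)
  have "\<bar>ln (norm (e + h))\<bar> \<le> \<bar>norm (e + h) - 1\<bar> / (1/2)"
    using n by (intro abs_ln_le) auto
  then show "\<bar>lognorm B (e + h)\<bar> \<le> 2 * norm h" using n(2) eq by simp
qed

text \<open>The linear terms cancel. With \<open>t = e \<bullet> h\<close> and
  \<open>s = (norm h)\<^sup>2\<close> the squared product of the two norms is
  \<open>(1 + s)\<^sup>2 - 4 * t\<^sup>2\<close>, which differs from 1 by a quantity quadratic in
  \<open>h\<close>.\<close>

lemma lognorm_antisym:
  assumes "norm (e::'a::real_inner) = 1" "norm h \<le> 1/4" "B \<ge> 1"
  shows "\<bar>lognorm B (e + h) + lognorm B (e - h)\<bar> \<le> 3 * (norm h)\<^sup>2"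
proof -
  define t where "t = e \<bullet> h"
  define s where "s = (norm h)\<^sup>2"
  have ts: "t\<^sup>2 \<le> s"
    using Cauchy_Schwarz_ineq[of e h] assms(1) by (simp add: t_def s_def power2_norm_eq_inner[symmetric])
  have "s \<le> (1/4)\<^sup>2" unfolding s_def using assms(2) by (intro power_mono) auto
  then have s: "0 \<le> s" "s \<le> 1/16" by (auto simp: s_def power2_eq_square)
  have "(norm (e + h))\<^sup>2 = 1 + 2 * t + s" "(norm (e - h))\<^sup>2 = 1 - 2 * t + s"
    using assms(1) unfolding power2_norm_eq_inner s_def t_def
    by (simp_all add: inner_add_left inner_add_right inner_diff_left inner_diff_right inner_commute norm_eq_1 norm_eq_sqrt_inner)
  then have P: "(norm (e + h) * norm (e - h))\<^sup>2 - 1 = 2 * s + s\<^sup>2 - 4 * t\<^sup>2"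
    by (simp add: power_mult_distrib) (simp add: power2_eq_square algebra_simps)
  have "s\<^sup>2 \<le> s * 1" unfolding power2_eq_square using s by (intro mult_left_mono) auto
  then have 1: "\<bar>(norm (e + h) * norm (e - h))\<^sup>2 - 1\<bar> \<le> 3 * s" "(norm (e + h) * norm (e - h))\<^sup>2 \<ge> 1/2"
    using P ts s zero_le_power2[of t] zero_le_power2[of s] by linarith+
  have pos: "norm (e + h) > 0" "norm (e - h) > 0"
    using norm_triangle_ineq2[of e "- h"] norm_triangle_ineq2[of e h] assms by auto
  have "lognorm B (e + h) + lognorm B (e - h) = ln ((norm (e + h) * norm (e - h))\<^sup>2) / 2"
    using lognorm_near(1)[OF assms] lognorm_near(1)[OF assms(1) _ assms(3), of "- h"] assms(2) pos
    by (simp add: ln_mult ln_realpow)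
  also have "\<bar>\<dots>\<bar> \<le> (\<bar>(norm (e + h) * norm (e - h))\<^sup>2 - 1\<bar> / (1/2)) / 2"
    unfolding abs_divide using 1(2) by (intro divide_mono abs_ln_le) auto
  also have "\<dots> \<le> 3 * s" using 1(1) by simp
  finally show ?thesis by (simp add: s_def)
qed

text \<open>The majorant for paired integrands. At the origin the order is \<open>p\<close>, one
  more than the degree of the nonlinearity, thanks to the cancellation in the pair. The radius 1/4
  is that of the estimates near the unit vector.\<close>

definition growth :: "real \<Rightarrow> real \<Rightarrow> 'a::real_normed_vector \<Rightarrow> real" where
  "growth p \<gamma> h = (if norm h < 1/4 then norm h powr p else norm h powr \<gamma>)"

lemma abs_exp_diff_le:
  assumes "\<bar>x\<bar> \<le> R" "\<bar>y\<bar> \<le> R"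
  shows "\<bar>exp x - exp y\<bar> \<le> exp R * \<bar>x - (y::real)\<bar>"
proof -
  have "norm (exp x - exp y) \<le> exp R * norm (x - y)"
  proof (rule field_differentiable_bound[of "{-R..R}"])
    show "(exp has_field_derivative exp z) (at z within {-R..R})" for z :: real
      by (auto intro!: derivative_eq_intros)
  qed (use assms in auto)
  then show ?thesis by simp
qed

text \<open>The sum telescopes through three differences: of the odd powers, of the exponentials,
  and of \<open>y\<close> and \<open>y'\<close>. Each gains one power of \<open>r\<close> over the
  size \<open>r powr (p - 1)\<close> of a single term; for the first this is the hypothesis on
  \<open>b + b'\<close>.\<close>

lemma spow_exp_sum_near:
  assumes "p > 2" "\<kappa> \<ge> 0" "r \<le> 1/4" "\<bar>b\<bar> \<le> 2 * r" "\<bar>b'\<bar> \<le> 2 * r" "\<bar>b + b'\<bar> \<le> 3 * r\<^sup>2"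
    and "\<bar>y\<bar> \<le> C" "\<bar>y - y'\<bar> \<le> C * \<bar>b - b'\<bar>"
  shows "\<bar>spow p b * exp (\<kappa> * b) * y + spow p b' * exp (\<kappa> * b') * y'\<bar>
    \<le> C * (2 powr p * exp \<kappa> * (3 * p + 4 * \<kappa> + 1)) * r powr p"
proof -
  have r: "r \<ge> 0" using assms(4) by linarith
  have C: "C \<ge> 0" using assms(7) by linarith
  let ?t = "(2 * r) powr (p - 1)"
  have rp: "(2 * r) powr (p - 2) * r\<^sup>2 \<le> 2 powr p * r powr p" "?t * r \<le> 2 powr p * r powr p"
  proof -
    have "(2 * r) powr (p - 2) * r\<^sup>2 = 2 powr (p - 2) * r powr p"
      using r assms(1) by (cases "r = 0") (auto simp: powr_mult powr_diff powr_numeral)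
    also have "\<dots> \<le> 2 powr p * r powr p" by (intro mult_right_mono powr_mono) auto
    finally show "(2 * r) powr (p - 2) * r\<^sup>2 \<le> 2 powr p * r powr p" .
    have "?t * r = 2 powr (p - 1) * r powr p"
      using r assms(1) by (cases "r = 0") (auto simp: powr_mult powr_diff)
    also have "\<dots> \<le> 2 powr p * r powr p" by (intro mult_right_mono powr_mono) auto
    finally show "?t * r \<le> 2 powr p * r powr p" .
  qed
  let ?Q = "2 powr p * r powr p"
  have kb: "\<bar>\<kappa> * b\<bar> \<le> \<kappa>" "\<bar>\<kappa> * b'\<bar> \<le> \<kappa>"
    using assms(2-5) mult_left_mono[of "\<bar>b\<bar>" 1 \<kappa>] mult_left_mono[of "\<bar>b'\<bar>" 1 \<kappa>] by (auto simp: abs_mult)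
  then have ek: "exp (\<kappa> * b) \<le> exp \<kappa>" "exp (\<kappa> * b') \<le> exp \<kappa>" by auto
  have sb': "\<bar>spow p b'\<bar> \<le> ?t" unfolding abs_spow using assms(1,5) by (intro powr_mono2) auto
  have 1: "\<bar>spow p b + spow p b'\<bar> \<le> (p - 1) * 3 * ?Q"
  proof -
    have "\<bar>spow p b - spow p (- b')\<bar> \<le> (p - 1) * (2 * r) powr (p - 2) * \<bar>b - - b'\<bar>"
      using assms by (intro spow_lipschitz) auto
    also have "\<dots> \<le> (p - 1) * (2 * r) powr (p - 2) * (3 * r\<^sup>2)"
      using assms by (intro mult_left_mono) auto
    also have "\<dots> = (p - 1) * 3 * ((2 * r) powr (p - 2) * r\<^sup>2)" by simp
    also have "\<dots> \<le> (p - 1) * 3 * ?Q" using rp(1) assms(1) by (intro mult_left_mono) auto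
    finally show ?thesis by (simp add: spow_minus)
  qed
  have bb: "\<bar>b' - b\<bar> \<le> 4 * r" using assms(4,5) by linarith
  have 2: "\<bar>exp (\<kappa> * b') - exp (\<kappa> * b)\<bar> \<le> exp \<kappa> * (\<kappa> * (4 * r))"
  proof -
    have "\<bar>exp (\<kappa> * b') - exp (\<kappa> * b)\<bar> \<le> exp \<kappa> * \<bar>\<kappa> * b' - \<kappa> * b\<bar>" by (rule abs_exp_diff_le[OF kb(2,1)])
    also have "\<bar>\<kappa> * b' - \<kappa> * b\<bar> = \<kappa> * \<bar>b' - b\<bar>"
      using assms(2) by (metis abs_mult abs_of_nonneg right_diff_distrib)
    also have "exp \<kappa> * (\<kappa> * \<bar>b' - b\<bar>) \<le> exp \<kappa> * (\<kappa> * (4 * r))"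
      using bb assms(2) by (intro mult_left_mono) auto
    finally show ?thesis .
  qed
  have "spow p b * exp (\<kappa> * b) * y + spow p b' * exp (\<kappa> * b') * y' =
     (spow p b + spow p b') * exp (\<kappa> * b) * y + spow p b' * (exp (\<kappa> * b') - exp (\<kappa> * b)) * y
     + spow p b' * exp (\<kappa> * b') * (y' - y)"
    by (simp add: algebra_simps)
  also have "\<bar>\<dots>\<bar> \<le> \<bar>spow p b + spow p b'\<bar> * exp (\<kappa> * b) * \<bar>y\<bar> + \<bar>spow p b'\<bar> * \<bar>exp (\<kappa> * b') - exp (\<kappa> * b)\<bar> * \<bar>y\<bar>
     + \<bar>spow p b'\<bar> * exp (\<kappa> * b') * \<bar>y' - y\<bar>"
    by (rule order_trans[OF abs_triangle_ineq add_mono[OF order_trans[OF abs_triangle_ineq]]]) (auto simp: abs_mult)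
  also have "\<dots> \<le> ((p - 1) * 3 * ?Q) * exp \<kappa> * C + ?t * (exp \<kappa> * (\<kappa> * (4 * r))) * C + ?t * exp \<kappa> * (C * (4 * r))"
  proof (intro add_mono mult_mono 1 2 sb' ek assms(7))
    show "\<bar>y' - y\<bar> \<le> C * (4 * r)"
      using assms(8) mult_left_mono[OF bb C] by (simp add: abs_minus_commute)
  qed (use assms(1,2) r C in auto)
  also have "\<dots> = C * exp \<kappa> * ((p - 1) * 3 * ?Q + (4 * \<kappa> + 4) * (?t * r))" by (simp add: algebra_simps)
  also have "\<dots> \<le> C * exp \<kappa> * ((p - 1) * 3 * ?Q + (4 * \<kappa> + 4) * ?Q)"
    using rp(2) assms(2) C by (intro mult_left_mono add_left_mono) auto
  also have "\<dots> = C * (2 powr p * exp \<kappa> * (3 * p + 4 * \<kappa> + 1)) * r powr p" by (simp add: algebra_simps)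
  finally show ?thesis .
qed

text \<open>A logarithm is bounded by any positive power. The exponent
  \<open>\<eta> = \<delta> / (p - 1)\<close> makes the power \<open>p - 1\<close> of the logarithm
  cost \<open>\<delta>\<close> in total.\<close>

lemma spow_exp_far:
  assumes "p > 2" "\<kappa> \<ge> 0" "\<delta> > 0" "B \<ge> 0" "\<epsilon> > 0"
  obtains K where "K \<ge> 0" "\<And>(z::'a::real_normed_vector) (h::'a). norm h \<ge> \<epsilon> \<Longrightarrow> norm z \<le> 1 + norm h \<Longrightarrow>
    \<bar>spow p (lognorm B z) * exp (\<kappa> * lognorm B z)\<bar> \<le> K * norm h powr (\<kappa> + \<delta>)"
proof -
  define \<eta> where "\<eta> = \<delta> / (p - 1)"
  have \<eta>: "\<eta> > 0" "\<eta> * (p - 1) = \<delta>" using assms by (auto simp: \<eta>_def)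
  let ?K = "(B + 1 / \<eta>) powr (p - 1) * (1 + 1 / \<epsilon>) powr (\<kappa> + \<delta>)"
  have "\<bar>spow p (lognorm B z) * exp (\<kappa> * lognorm B z)\<bar> \<le> ?K * norm h powr (\<kappa> + \<delta>)"
    if h: "norm h \<ge> \<epsilon>" and z: "norm z \<le> 1 + norm h" for z :: 'a and h :: 'a
  proof -
  define t where "t = 1 + norm h"
  have t: "t \<ge> 1" by (simp add: t_def)
  let ?b = "lognorm B z"
  have "exp (- B) \<le> 1" using assms by simp
  then have "exp (- B) \<le> t" using t by linarith
  then have "max (norm z) (exp (- B)) \<le> t" by (intro max.boundedI) (use z in \<open>simp_all add: t_def\<close>)
  then have b: "?b \<le> ln t" unfolding lognorm_def by (subst ln_le_cancel_iff) (auto simp: less_max_iff_disj intro: less_le_trans[OF exp_gt_zero])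
  have "ln t \<le> t powr \<eta> / \<eta>" using ln_powr_bound[OF t \<eta>(1)] .
  moreover have "B \<le> B * t powr \<eta>" using assms t \<eta> ge_one_powr_ge_zero[of t \<eta>] by (simp add: mult_le_cancel_left1)
  moreover have "ln t \<ge> 0" using t by simp
  ultimately have "\<bar>?b\<bar> \<le> (B + 1 / \<eta>) * t powr \<eta>"
    using b lognorm_ge[of B z] assms by (simp add: distrib_right)
  then have "\<bar>?b\<bar> powr (p - 1) \<le> ((B + 1 / \<eta>) * t powr \<eta>) powr (p - 1)"
    using assms by (intro powr_mono2) auto
  also have "\<dots> = (B + 1 / \<eta>) powr (p - 1) * t powr \<delta>"
    using assms \<eta> by (simp add: powr_mult powr_powr)
  finally have 1: "\<bar>spow p ?b\<bar> \<le> (B + 1 / \<eta>) powr (p - 1) * t powr \<delta>" by (simp add: abs_spow)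
  have "\<kappa> * ?b \<le> \<kappa> * ln t" using b assms by (intro mult_left_mono)
  then have 2: "exp (\<kappa> * ?b) \<le> t powr \<kappa>" using t by (simp add: powr_def)
  have "norm h / \<epsilon> \<ge> 1" using h assms by simp
  then have "t \<le> (1 + 1 / \<epsilon>) * norm h" by (simp add: t_def distrib_right)
  then have 3: "t powr (\<kappa> + \<delta>) \<le> ((1 + 1 / \<epsilon>) * norm h) powr (\<kappa> + \<delta>)" using assms t by (intro powr_mono2) auto
  have "\<bar>spow p ?b * exp (\<kappa> * ?b)\<bar> \<le> ((B + 1 / \<eta>) powr (p - 1) * t powr \<delta>) * t powr \<kappa>"
    unfolding abs_mult using 1 2 by (intro mult_mono) auto
  also have "\<dots> = (B + 1 / \<eta>) powr (p - 1) * t powr (\<kappa> + \<delta>)" by (simp add: powr_add)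
  also have "\<dots> \<le> (B + 1 / \<eta>) powr (p - 1) * ((1 + 1 / \<epsilon>) * norm h) powr (\<kappa> + \<delta>)"
    using 3 by (intro mult_left_mono) auto
  also have "\<dots> = ?K * norm h powr (\<kappa> + \<delta>)" using assms by (simp add: powr_mult)
  finally show ?thesis .
  qed
  then show ?thesis using that[of ?K] by force
qed

text \<open>The second difference of the nonlinearity along the pair \<open>e + h\<close>, \<open>e - h\<close>, with the
  degenerate factor \<open>spow p b\<close> split off.\<close>

definition pairsum ::
  "real \<Rightarrow> real \<Rightarrow> real \<Rightarrow> 'a::real_normed_vector \<Rightarrow> (real \<times> real \<Rightarrow> real) \<Rightarrow> 'a \<Rightarrow> real \<Rightarrow> real" where
  "pairsum p \<kappa> B e Y h a =
     spow p (lognorm B (e + h)) * exp (\<kappa> * lognorm B (e + h)) * Y (a, lognorm B (e + h)) +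
     spow p (lognorm B (e - h)) * exp (\<kappa> * lognorm B (e - h)) * Y (a, lognorm B (e - h))"

text \<open>\<open>K\<close> does not depend on \<open>Y\<close>: only a common bound
  \<open>C\<close> for \<open>Y\<close> and for its Lipschitz constant in \<open>b\<close> enters.
  So the estimate also applies to the derivatives of \<open>Y\<close> in \<open>a\<close>.\<close>

lemma pairsum_bound:
  assumes "p > 2" "\<kappa> \<ge> 0" "\<delta> > 0" "B \<ge> 1" "norm (e::'a::euclidean_space) = 1"
  obtains K where "K \<ge> 0" "\<And>C Y h a. (\<And>b. b \<ge> - B \<Longrightarrow> \<bar>Y (a, b)\<bar> \<le> C) \<Longrightarrow>
     (\<And>b b'. b \<ge> - B \<Longrightarrow> b' \<ge> - B \<Longrightarrow> \<bar>Y (a, b) - Y (a, b')\<bar> \<le> C * \<bar>b - b'\<bar>) \<Longrightarrow>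
     \<bar>pairsum p \<kappa> B e Y h a\<bar> \<le> C * K * growth p (\<kappa> + \<delta>) h"
proof -
  obtain K1 where K1: "K1 \<ge> 0" "\<And>(z::'a) (h::'a). norm h \<ge> 1/4 \<Longrightarrow> norm z \<le> 1 + norm h \<Longrightarrow>
    \<bar>spow p (lognorm B z) * exp (\<kappa> * lognorm B z)\<bar> \<le> K1 * norm h powr (\<kappa> + \<delta>)"
    using spow_exp_far[of p \<kappa> \<delta> B "1/4"] assms by auto
  define K2 where "K2 = 2 powr p * exp \<kappa> * (3 * p + 4 * \<kappa> + 1)"
  have K2: "K2 \<ge> 0" using assms by (simp add: K2_def)
  show ?thesis
  proof (rule that)
    show "2 * K1 + K2 \<ge> 0" using K1(1) K2 by simp
    fix C Y h a assume Y: "\<And>b. b \<ge> - B \<Longrightarrow> \<bar>Y (a::real, b)\<bar> \<le> C"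
      "\<And>b b'. b \<ge> - B \<Longrightarrow> b' \<ge> - B \<Longrightarrow> \<bar>Y (a, b) - Y (a, b')\<bar> \<le> C * \<bar>b - b'\<bar>"
    have C: "C \<ge> 0" using Y(1)[of 0] assms(4) by linarith
    let ?b = "lognorm B (e + h)" and ?b' = "lognorm B (e - h)"
    show "\<bar>pairsum p \<kappa> B e Y h a\<bar> \<le> C * (2 * K1 + K2) * growth p (\<kappa> + \<delta>) h"
    proof (cases "norm h < 1/4")
      case True
      have "\<bar>pairsum p \<kappa> B e Y h a\<bar> \<le> C * K2 * norm h powr p"
        unfolding pairsum_def K2_def
      proof (rule spow_exp_sum_near)
        show "\<bar>?b\<bar> \<le> 2 * norm h" using lognorm_near(2)[of e h B] assms True by simp
        show "\<bar>?b'\<bar> \<le> 2 * norm h" using lognorm_near(2)[of e "- h" B] assms True by simp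
        show "\<bar>?b + ?b'\<bar> \<le> 3 * (norm h)\<^sup>2" using lognorm_antisym[of e h B] assms True by simp
      qed (use assms True Y(1)[OF lognorm_ge] Y(2)[OF lognorm_ge lognorm_ge] in auto)
      also have "\<dots> \<le> C * (2 * K1 + K2) * norm h powr p"
        using C K1(1) by (intro mult_right_mono mult_left_mono) auto
      finally show ?thesis using True by (simp add: growth_def)
    next
      case False
      have 1: "\<bar>spow p (lognorm B z) * exp (\<kappa> * lognorm B z) * Y (a, lognorm B z)\<bar> \<le> K1 * norm h powr (\<kappa> + \<delta>) * C"
        if "norm z \<le> 1 + norm h" for z :: 'a
        unfolding abs_mult[of _ "Y (a, lognorm B z)"] using K1(1) K1(2)[of h z] False that Y(1)[OF lognorm_ge, of z]
        by (intro mult_mono) auto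
      have "norm (e + h) \<le> 1 + norm h" "norm (e - h) \<le> 1 + norm h"
        using norm_triangle_ineq[of e h] norm_triangle_ineq4[of e h] assms(5) by auto
      then have "\<bar>pairsum p \<kappa> B e Y h a\<bar> \<le> K1 * norm h powr (\<kappa> + \<delta>) * C + K1 * norm h powr (\<kappa> + \<delta>) * C"
        unfolding pairsum_def by (intro order_trans[OF abs_triangle_ineq add_mono] 1)
      also have "\<dots> = C * (2 * K1) * norm h powr (\<kappa> + \<delta>)" by simp
      also have "\<dots> \<le> C * (2 * K1 + K2) * norm h powr (\<kappa> + \<delta>)"
        using C K2 by (intro mult_right_mono mult_left_mono) auto
      finally show ?thesis using False by (simp add: growth_def)
    qed
  qed
qed

lemma pair_derivs:
  fixes Y :: "real \<times> real \<Rightarrow> real"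
  assumes "Y differentiable (at (a, b))"
  shows "((\<lambda>a. Y (a, b)) has_derivative (\<lambda>v. v * dir_deriv (1, 0) Y (a, b))) (at a)"
    and "((\<lambda>b. Y (a, b)) has_derivative (\<lambda>v. v * dir_deriv (0, 1) Y (a, b))) (at b)"
proof -
  note Y = has_derivative_dir_deriv[OF assms]
  interpret bounded_linear "\<lambda>v. dir_deriv v Y (a, b)" using Y by (rule has_derivative_bounded_linear)
  have 1: "((\<lambda>a. (a, b)) has_derivative (\<lambda>v. (v, 0))) (at a)" by (auto intro!: derivative_eq_intros)
  have eq: "(\<lambda>v. dir_deriv (v, 0) Y (a, b)) = (\<lambda>v. v * dir_deriv (1, 0) Y (a, b))"
  proof
    fix v show "dir_deriv (v, 0) Y (a, b) = v * dir_deriv (1, 0) Y (a, b)" using scaleR[of v "(1, 0)"] by simp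
  qed
  show "((\<lambda>a. Y (a, b)) has_derivative (\<lambda>v. v * dir_deriv (1, 0) Y (a, b))) (at a)"
    using diff_chain_at[OF 1 Y] unfolding comp_def eq .
  have 2: "((\<lambda>b. (a, b)) has_derivative (\<lambda>v. (0, v))) (at b)" by (auto intro!: derivative_eq_intros)
  have eq: "(\<lambda>v. dir_deriv (0, v) Y (a, b)) = (\<lambda>v. v * dir_deriv (0, 1) Y (a, b))"
  proof
    fix v show "dir_deriv (0, v) Y (a, b) = v * dir_deriv (0, 1) Y (a, b)" using scaleR[of v "(0, 1)"] by simp
  qed
  show "((\<lambda>b. Y (a, b)) has_derivative (\<lambda>v. v * dir_deriv (0, 1) Y (a, b))) (at b)"
    using diff_chain_at[OF 2 Y] unfolding comp_def eq .
qed

text \<open>The logarithms of the two norms do not depend on \<open>a\<close>, so derivatives in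
  \<open>a\<close> fall on \<open>Y\<close> alone. One order is lost because the bound uses the
  Lipschitz constant of \<open>Y\<close> in \<open>b\<close>. The margin in \<open>B + 1\<close>
  puts the closed range \<open>b \<ge> - B\<close> inside the open set \<open>S\<close>.\<close>

lemma dbd_pairsum:
  assumes "p > 2" "\<kappa> \<ge> 0" "\<delta> > 0" "B \<ge> 1" "norm (e::'a::euclidean_space) = 1"
    and S: "S = {lo<..<hi} \<times> {- (B + 1)<..}" and c: "\<And>h. c h \<ge> 0"
  shows "dbd (Suc n) S {()} {\<lambda>_ _. 1} (\<lambda>_. Y) \<Longrightarrow>
    dbd n {lo<..<hi} UNIV {\<lambda>h _. c h * growth p (\<kappa> + \<delta>) h} (\<lambda>h a. c h * pairsum p \<kappa> B e Y h a)"
proof (induction n arbitrary: Y)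
  have bound: "bounded_by {lo<..<hi} UNIV {\<lambda>h _. c h * growth p (\<kappa> + \<delta>) h} (\<lambda>h a. c h * pairsum p \<kappa> B e Y h a)"
    if Y: "dbd (Suc 0) S {()} {\<lambda>_ _. 1} (\<lambda>_. Y)" for Y
  proof -
    obtain C1 where C1: "C1 \<ge> 0" "\<And>x. x \<in> S \<Longrightarrow> \<bar>Y x\<bar> \<le> C1"
      using dbd_bounded_by[OF Y] by (auto simp: bounded_by_def)
    have "(0, 1) \<in> (Basis :: (real \<times> real) set)" by (auto simp: Basis_prod_def)
    then obtain C2 where C2: "C2 \<ge> 0" "\<And>x. x \<in> S \<Longrightarrow> \<bar>dir_deriv (0, 1) Y x\<bar> \<le> C2"
      using Y by (auto simp: bounded_by_def)
    obtain K where K: "K \<ge> 0" "\<And>C Y h a. (\<And>b. b \<ge> - B \<Longrightarrow> \<bar>Y (a, b)\<bar> \<le> C) \<Longrightarrow>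
     (\<And>b b'. b \<ge> - B \<Longrightarrow> b' \<ge> - B \<Longrightarrow> \<bar>Y (a, b) - Y (a, b')\<bar> \<le> C * \<bar>b - b'\<bar>) \<Longrightarrow>
     \<bar>pairsum p \<kappa> B e Y h a\<bar> \<le> C * K * growth p (\<kappa> + \<delta>) h"
      using pairsum_bound[OF assms(1-5)] by blast
    have "\<bar>c h * pairsum p \<kappa> B e Y h a\<bar> \<le> ((C1 + C2) * K) * (c h * growth p (\<kappa> + \<delta>) h)" if a: "a \<in> {lo<..<hi}" for a h
    proof -
      have "\<bar>pairsum p \<kappa> B e Y h a\<bar> \<le> (C1 + C2) * K * growth p (\<kappa> + \<delta>) h"
      proof (rule K(2))
        show "\<bar>Y (a, b)\<bar> \<le> C1 + C2" if "b \<ge> - B" for b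
          using C1(2)[of "(a, b)"] C2(1) a that S by auto
        fix b b' assume b: "b \<ge> - B" "b' \<ge> - B"
        have "norm (Y (a, b) - Y (a, b')) \<le> C2 * norm (b - b')"
        proof (rule differentiable_bound[of "{- (B + 1)<..}" _ "\<lambda>b v. v * dir_deriv (0, 1) Y (a, b)"])
          fix b assume "b \<in> {- (B + 1)<..}"
          then have ab: "(a, b) \<in> S" using a S by simp
          then have "Y differentiable (at (a, b))" using Y by simp
          from pair_derivs(2)[OF this]
          show "((\<lambda>b. Y (a, b)) has_derivative (\<lambda>v. v * dir_deriv (0, 1) Y (a, b))) (at b within {- (B + 1)<..})"
            by (rule has_derivative_at_withinI)
          show "onorm (\<lambda>v. v * dir_deriv (0, 1) Y (a, b)) \<le> C2"
          proof (rule onorm_le)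
            show "norm (v * dir_deriv (0, 1) Y (a, b)) \<le> C2 * norm v" for v
              using mult_left_mono[OF C2(2)[OF ab], of "\<bar>v\<bar>"] by (simp add: abs_mult mult.commute)
          qed
        qed (use b in auto)
        also have "\<dots> \<le> (C1 + C2) * norm (b - b')" using C1(1) by (intro mult_right_mono) auto
        finally show "\<bar>Y (a, b) - Y (a, b')\<bar> \<le> (C1 + C2) * \<bar>b - b'\<bar>" by simp
      qed
      then have "c h * \<bar>pairsum p \<kappa> B e Y h a\<bar> \<le> c h * ((C1 + C2) * K * growth p (\<kappa> + \<delta>) h)"
        using c by (intro mult_left_mono) auto
      then show ?thesis using c[of h] by (simp add: abs_mult mult_ac)
    qed
    then show ?thesis using C1(1) C2(1) K(1) by (intro bounded_by_singleI[of _ _ _ "(C1 + C2) * K"]) auto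
  qed
  {
    case 0
    then show ?case using bound by simp
  next
    case (Suc n)
    show ?case
    proof (rule dbd_SucI)
      have "dbd (Suc 0) S {()} {\<lambda>_ _. 1} (\<lambda>_. Y)" using Suc.prems by (auto simp: dbd_bounded_by)
      then show "bounded_by {lo<..<hi} UNIV {\<lambda>h _. c h * growth p (\<kappa> + \<delta>) h} (\<lambda>h a. c h * pairsum p \<kappa> B e Y h a)"
        by (rule bound)
      show "((\<lambda>a. c h * pairsum p \<kappa> B e Y h a) has_derivative
          (\<lambda>v. v * (c h * pairsum p \<kappa> B e (dir_deriv (1, 0) Y) h a))) (at a)" if "a \<in> {lo<..<hi}" for h a
      proof -
        have d: "((\<lambda>a. Y (a, lognorm B z)) has_derivative (\<lambda>v. v * dir_deriv (1, 0) Y (a, lognorm B z))) (at a)" for z :: 'a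
        proof (rule pair_derivs(1))
          have "(a, lognorm B z) \<in> S" using that S lognorm_ge[of B z] by simp
          then show "Y differentiable at (a, lognorm B z)" using Suc.prems by simp
        qed
        show ?thesis unfolding pairsum_def
          by (auto intro!: derivative_eq_intros d simp: algebra_simps)
      qed
      show "dbd n {lo<..<hi} UNIV {\<lambda>h _. c h * growth p (\<kappa> + \<delta>) h} (\<lambda>h a. i * (c h * pairsum p \<kappa> B e (dir_deriv (1, 0) Y) h a))"
        for i :: real
      proof (rule dbd_param_mult[OF _ order_refl Suc.IH])
        have "(1, 0) \<in> (Basis :: (real \<times> real) set)" by (auto simp: Basis_prod_def)
        then show "dbd (Suc n) S {()} {\<lambda>_ _. 1} (\<lambda>_. dir_deriv (1, 0) Y)" using Suc.prems by simp
      qed simp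
    qed simp
  }
qed

text \<open>For \<open>N\<close> equal to the dimension plus \<open>\<sigma> * p\<close>, the first
  condition amounts to \<open>\<sigma> * p < p\<close> and the second to growth slower than the
  power \<open>\<sigma> * p\<close>.\<close>

lemma integrable_growth:
  assumes "p - N > - real DIM('a::euclidean_space)" "\<gamma> - N < - real DIM('a)"
  shows "integrable lborel (\<lambda>h::'a. norm h powr (- N) * growth p \<gamma> h)"
proof -
  have "(\<lambda>h::'a. norm h powr (- N) * growth p \<gamma> h) =
    (\<lambda>h. indicator (ball 0 (1/4)) h * norm h powr (p - N) + indicator (- ball 0 (1/4)) h * norm h powr (\<gamma> - N))"
    by (auto simp: fun_eq_iff growth_def indicator_def powr_add[symmetric])
  then show ?thesis
    using integrable_norm_powr_ball[OF assms(1), of "1/4"] integrable_norm_powr_compl[OF assms(2), of "1/4"] by simp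
qed

lemma continuous_lognorm: "continuous_on UNIV (\<lambda>h. lognorm B (f h))" if "continuous_on UNIV f"
  unfolding lognorm_def using that by (intro continuous_intros) (auto simp: max_def)

section \<open>Smooth dependence of the symmetrised integral on the logarithmic radius\<close>

context profile
begin

text \<open>Once the power has been taken, boundedness of all derivatives is what the integral over
  \<open>h\<close> asks for; the finer weights have served their purpose.\<close>

lemma dbd_mean_slope_powr:
  assumes "p > 2" "B \<ge> 1" "S = {lo<..<hi} \<times> {- (B + 1)<..}"
  shows "dbd n S {()} {\<lambda>_ _. 1} (\<lambda>_ x. mean_slope x powr (p - 1))"
proof -
  have S: "open S" using assms(3) by (auto intro: open_Times)
  have B: "B + 1 \<ge> 0" using assms by simp
  obtain K where K: "\<And>x. x \<in> S \<Longrightarrow> 0 \<le> mean_slope x \<and> mean_slope x \<le> K"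
    using dbd_mean_slope(2)[OF B assms(3)] by blast
  have "dbd n S {()} (powers (\<lambda>_. mean_slope) (p - 1)) (\<lambda>_ x. mean_slope x powr (p - 1))"
    using K assms(1) by (intro dbd_powr S dbd_mean_slope(1)[OF B assms(3)]) auto
  then show ?thesis
  proof (rule dbd_weaken[OF order_refl order_refl, rotated])
    fix \<beta> :: "unit \<Rightarrow> real \<times> real \<Rightarrow> real" assume \<beta>: "\<beta> \<in> {\<lambda>_ _. 1}"
    have 1: "(\<lambda>_ x. mean_slope x powr (p - 1 - 1/2)) \<in> powers (\<lambda>_::unit. mean_slope) (p - 1)"
      unfolding powers_def by (rule image_eqI[of _ _ "1/2"]) auto
    have "mean_slope x powr (p - 1 - 1/2) \<le> K powr (p - 1 - 1/2) * \<beta> () x" if "x \<in> S" for x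
      using K[OF that] \<beta> assms(1) by (auto intro!: powr_mono2)
    then show "\<exists>\<beta>'\<in>powers (\<lambda>_. mean_slope) (p - 1). \<exists>C\<ge>0. \<forall>y\<in>{()}. \<forall>x\<in>S. \<beta>' y x \<le> C * \<beta> y x"
      by (intro bexI[OF _ 1] exI[of _ "K powr (p - 1 - 1/2)"]) auto
  qed
qed

text \<open>One half of the symmetrised integrand, in polar logarithmic coordinates around the centre.\<close>

definition jump :: "real \<Rightarrow> real \<Rightarrow> real \<Rightarrow> 'a::euclidean_space \<Rightarrow> real" where
  "jump p B a z = spow p (F (a + lognorm B z) - F a)"

lemma continuous_jump: "p > 2 \<Longrightarrow> continuous_on UNIV f \<Longrightarrow> continuous_on UNIV (\<lambda>h. jump p B a (f h))"
  unfolding jump_def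
  by (intro continuous_on_spow continuous_intros continuous_lognorm
      continuous_on_compose2[OF smooth_on_imp_continuous_on[OF smooth_F]]) auto

lemma jump_pairsum:
  "jump p B a (e + h) + jump p B a (e - h) = pairsum p (m * (p - 1)) B e (\<lambda>x. mean_slope x powr (p - 1)) h a"
  by (simp add: jump_def pairsum_def spow_F_diff)

lemma jump_pair_smooth:
  fixes e :: "'a::euclidean_space" and p N B :: real
  assumes "p > 2" "m * (p - 1) < N - DIM('a)" "N - DIM('a) < p" "B \<ge> 1" "norm e = 1"
  shows "integrable lborel (\<lambda>h. norm h powr (- N) * (jump p B a (e + h) + jump p B a (e - h)))"
    and "smooth_on UNIV (\<lambda>a. \<integral>h. norm h powr (- N) * (jump p B a (e + h) + jump p B a (e - h)) \<partial>lborel)"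
proof -
  \<comment> \<open>Half of the gap between the growth \<open>m * (p - 1)\<close> and the threshold
    of integrability at infinity; it makes room for the logarithms.\<close>
  define \<delta> where "\<delta> = (N - DIM('a) - m * (p - 1)) / 2"
  have \<delta>: "\<delta> > 0" "m * (p - 1) + \<delta> - N < - real DIM('a)" using assms by (auto simp: \<delta>_def field_simps)
  have \<kappa>: "m * (p - 1) \<ge> 0" using m assms by simp
  let ?R = "\<lambda>h::'a. norm h powr (- N) * growth p (m * (p - 1) + \<delta>) h"
  have R: "integrable lborel ?R" using assms \<delta> by (intro integrable_growth) auto
  have d: "dbd n {lo<..<hi} UNIV {\<lambda>h _. ?R h} (\<lambda>h a. norm h powr (- N) * (jump p B a (e + h) + jump p B a (e - h)))" for n lo hi
    unfolding jump_pairsum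
    by (rule dbd_pairsum[OF assms(1) \<kappa> \<delta>(1) assms(4,5) refl _ dbd_mean_slope_powr[OF assms(1,4) refl]]) simp
  have meas: "(\<lambda>h. norm h powr (- N) * (jump p B a (e + h) + jump p B a (e - h))) \<in> borel_measurable lborel" for a
  proof -
    have "continuous_on UNIV (\<lambda>h. jump p B a (e + h) + jump p B a (e - h))"
      by (intro continuous_on_add continuous_jump assms continuous_intros)
    from borel_measurable_continuous_onI[OF this] show ?thesis by simp
  qed
  show "integrable lborel (\<lambda>h. norm h powr (- N) * (jump p B a (e + h) + jump p B a (e - h)))"
  proof (rule dbd_integrable[where n = 0 and S = "{a-1<..<a+1}" and B = ?R and x = a
        and h = "\<lambda>h a. norm h powr (- N) * (jump p B a (e + h) + jump p B a (e - h))"])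
    show "dbd 0 {a-1<..<a+1} (space lborel) {\<lambda>h _. ?R h} (\<lambda>h a. norm h powr (- N) * (jump p B a (e + h) + jump p B a (e - h)))"
      using d[of 0 "a - 1" "a + 1"] by simp
  qed (use R meas in auto)
  show "smooth_on UNIV (\<lambda>a. \<integral>h. norm h powr (- N) * (jump p B a (e + h) + jump p B a (e - h)) \<partial>lborel)"
  proof (rule smooth_on_local)
    fix a :: real
    have "dbd n {a-1<..<a+1} {()} {} (\<lambda>_ a. \<integral>h. norm h powr (- N) * (jump p B a (e + h) + jump p B a (e - h)) \<partial>lborel)" for n
    proof (rule dbd_integral[where B = ?R and Bs = "{}"])
      show 1: "dbd n {a-1<..<a+1} (space lborel) {\<lambda>h _. ?R h} (\<lambda>h a. norm h powr (- N) * (jump p B a (e + h) + jump p B a (e - h)))"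
        using d[of n "a - 1" "a + 1"] by simp
      show "dbd n {a-1<..<a+1} (space lborel) {} (\<lambda>h a. norm h powr (- N) * (jump p B a (e + h) + jump p B a (e - h)))"
        by (rule dbd_weaken[OF order_refl order_refl _ 1]) simp
    qed (use R meas in auto)
    then show "\<exists>T. a \<in> T \<and> smooth_on T (\<lambda>a. \<integral>h. norm h powr (- N) * (jump p B a (e + h) + jump p B a (e - h)) \<partial>lborel)"
      by (intro exI[of _ "{a-1<..<a+1}"]) (auto simp: smooth_on_def)
  qed
qed

text \<open>The definition of the operator demands integrability of each truncated kernel, before
  \<open>h\<close> is paired with \<open>- h\<close>; outside a ball only the growth at infinity
  matters.\<close>

lemma jump_integrable:
  fixes e :: "'a::euclidean_space" and p N B :: real
  assumes "p > 2" "m * (p - 1) < N - DIM('a)" "B \<ge> 1" "norm e = 1" "\<epsilon> > 0"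
  shows "integrable lborel (\<lambda>h. indicator (- ball 0 \<epsilon>) h * (norm h powr (- N) * jump p B a (e + h)))"
proof -
  define \<delta> where "\<delta> = (N - DIM('a) - m * (p - 1)) / 2"
  have \<delta>: "\<delta> > 0" "m * (p - 1) + \<delta> - N < - real DIM('a)" using assms by (auto simp: \<delta>_def field_simps)
  have \<kappa>: "m * (p - 1) \<ge> 0" using m assms by simp
  obtain K where K: "K \<ge> 0" "\<And>(z::'a) (h::'a). norm h \<ge> \<epsilon> \<Longrightarrow> norm z \<le> 1 + norm h \<Longrightarrow>
    \<bar>spow p (lognorm B z) * exp (m * (p - 1) * lognorm B z)\<bar> \<le> K * norm h powr (m * (p - 1) + \<delta>)"
    using spow_exp_far[OF assms(1) \<kappa> \<delta>(1) _ assms(5), of B] assms(3) by auto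
  obtain C where C: "C \<ge> 0" "\<And>b. b \<ge> - B \<Longrightarrow> \<bar>mean_slope (a, b) powr (p - 1)\<bar> \<le> C"
    using dbd_bounded_by[OF dbd_mean_slope_powr[OF assms(1,3) refl, of 0 "a - 1" "a + 1"]] by (auto simp: bounded_by_def)
  have bound: "\<bar>jump p B a (e + h)\<bar> \<le> K * norm h powr (m * (p - 1) + \<delta>) * C" if "norm h \<ge> \<epsilon>" for h
    unfolding jump_def spow_F_diff abs_mult[of _ "mean_slope (a, _) powr _"]
    using K(1) K(2)[of h "e + h"] that C(2)[OF lognorm_ge, of "e + h"] norm_triangle_ineq[of e h] assms(4)
    by (intro mult_mono) auto
  have "integrable lborel (\<lambda>h. (K * C) * (indicator (- ball 0 \<epsilon>) h * norm (h::'a) powr (m * (p - 1) + \<delta> - N)))"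
    using \<delta>(2) assms(5) by (intro integrable_mult_right integrable_norm_powr_compl)
  then show ?thesis
  proof (rule Bochner_Integration.integrable_bound)
    have "continuous_on UNIV (\<lambda>h. jump p B a (e + h))"
      by (intro continuous_jump assms continuous_intros)
    moreover have [measurable]: "ball (0::'a) \<epsilon> \<in> sets lborel" by simp
    ultimately show "(\<lambda>h. indicator (- ball 0 \<epsilon>) h * (norm h powr (- N) * jump p B a (e + h))) \<in> borel_measurable lborel"
      by (intro borel_measurable_times) (auto dest: borel_measurable_continuous_onI)
    show "AE h in lborel. norm (indicator (- ball 0 \<epsilon>) h * (norm h powr (- N) * jump p B a (e + h))) \<le>
        norm ((K * C) * (indicator (- ball 0 \<epsilon>) h * norm h powr (m * (p - 1) + \<delta> - N)))"
    proof (rule AE_I2)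
      fix h :: 'a
      show "norm (indicator (- ball 0 \<epsilon>) h * (norm h powr (- N) * jump p B a (e + h))) \<le>
        norm ((K * C) * (indicator (- ball 0 \<epsilon>) h * norm h powr (m * (p - 1) + \<delta> - N)))"
      proof (cases "norm h \<ge> \<epsilon>")
        case True
        have "norm h powr (- N) * \<bar>jump p B a (e + h)\<bar> \<le> norm h powr (- N) * (K * norm h powr (m * (p - 1) + \<delta>) * C)"
          by (intro mult_left_mono bound[OF True]) simp
        also have "\<dots> = (K * C) * norm h powr (m * (p - 1) + \<delta> - N)"
          by (simp add: powr_diff powr_minus powr_add divide_simps)
        finally show ?thesis using True K(1) C(1) by (simp add: abs_mult)
      qed simp
    qed
  qed
qed

end

section \<open>Invariance of Lebesgue measure under similarities\<close>

lemma emeasure_ball_eq: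
  fixes x y :: "'a::euclidean_space"
  shows "emeasure lborel (ball x r) = emeasure lborel (ball y r)"
proof (cases "r \<ge> 0")
  case True
  then show ?thesis
    using content_ball_conv_unit_ball[OF True, of x] content_ball_conv_unit_ball[OF True, of y]
      emeasure_lborel_ball_finite[of x r] emeasure_lborel_ball_finite[of y r]
    by (simp add: emeasure_eq_ennreal_measure)
qed (simp add: ball_empty)

text \<open>By the Vitali covering theorem an open set is a countable disjoint union of balls up to
  a null set. An orthogonal map sends balls to balls of the same radius, and their measure does not
  depend on the centre.\<close>

lemma emeasure_orthogonal_image_open:
  fixes g :: "'a::euclidean_space \<Rightarrow> 'a"
  assumes g: "orthogonal_transformation g" and "open U"
  shows "emeasure lborel (g ` U) = emeasure lborel U"
proof -
  have lin: "linear g" by (rule orthogonal_transformation_linear[OF g])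
  have "inj g" by (rule orthogonal_transformation_inj[OF g])
  have "surj g" by (rule orthogonal_transformation_surj[OF g])
  have op: "open (g ` X)" if "open X" for X
    using open_surjective_linear_image[OF that lin \<open>surj g\<close>] .
  let ?K = "{i. snd i > 0 \<and> ball (fst i) (snd i) \<subseteq> U}"
  obtain C where C: "countable C" "C \<subseteq> ?K"
     "pairwise (\<lambda>i j. disjnt (ball (fst i) (snd i)) (ball (fst j) (snd j))) C"
     "negligible (U - (\<Union>i \<in> C. ball (fst i) (snd i)))"
  proof (rule Vitali_covering_theorem_balls[of U ?K fst snd])
    fix x d assume "x \<in> U" "(0::real) < d"
    then obtain e where e: "e > 0" "ball x e \<subseteq> U" using \<open>open U\<close> open_contains_ball by metis
    then have "ball x (min e (d/2)) \<subseteq> U" by (meson ball_subset_ball_iff min.cobounded1 subset_ball order_trans)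
    then show "\<exists>i. i \<in> ?K \<and> x \<in> ball (fst i) (snd i) \<and> snd i < d"
      using e \<open>0 < d\<close> by (intro exI[of _ "(x, min e (d/2))"]) auto
  qed
  define W where "W = (\<Union>i \<in> C. ball (fst i) (snd i))"
  have W: "open W" "W \<subseteq> U" using C(2) by (auto simp: W_def)
  have gW: "g ` W = (\<Union>i \<in> C. ball (g (fst i)) (snd i))"
    using image_orthogonal_transformation_ball[OF g] by (simp add: W_def image_UN)
  have null: "emeasure lborel (X - Y) = 0" if "open X" "open Y" "negligible (X - Y)" for X Y :: "'a set"
  proof -
    have "X - Y \<in> sets lborel" using that by simp
    then have "X - Y \<in> null_sets lborel"
      using that(3) null_sets_completion_iff[of "X - Y" lborel] by (simp add: negligible_iff_null_sets)
    then show ?thesis by auto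
  qed
  have split: "emeasure lborel X = emeasure lborel Y" if "open X" "open Y" "Y \<subseteq> X" "negligible (X - Y)" for X Y :: "'a set"
  proof -
    have "emeasure lborel (Y \<union> (X - Y)) = emeasure lborel Y + emeasure lborel (X - Y)"
      using that by (intro plus_emeasure[symmetric]) auto
    then show ?thesis using null[OF that(1,2,4)] that(3) by (simp add: Un_absorb1)
  qed
  have "emeasure lborel (g ` U) = emeasure lborel (g ` W)"
  proof (rule split)
    have "g ` U - g ` W = g ` (U - W)" using \<open>inj g\<close> by (simp add: image_set_diff)
    moreover have "negligible (g ` (U - W))"
      using C(4) linear_imp_differentiable_on[OF lin]
      by (intro negligible_differentiable_image_negligible) (auto simp: W_def)
    ultimately show "negligible (g ` U - g ` W)" by simp
  qed (use W op \<open>open U\<close> in auto)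
  also have "\<dots> = (\<integral>\<^sup>+i. emeasure lborel (ball (g (fst i)) (snd i)) \<partial>count_space C)"
    unfolding gW
  proof (rule emeasure_UN_countable)
    show "disjoint_family_on (\<lambda>i. ball (g (fst i)) (snd i)) C"
      using C(3) \<open>inj g\<close>
      by (auto simp: disjoint_family_on_def pairwise_def disjnt_def image_orthogonal_transformation_ball[OF g, symmetric] image_Int[symmetric])
  qed (use C in auto)
  also have "\<dots> = (\<integral>\<^sup>+i. emeasure lborel (ball (fst i) (snd i)) \<partial>count_space C)"
    by (intro nn_integral_cong emeasure_ball_eq)
  also have "\<dots> = emeasure lborel W"
    unfolding W_def by (rule emeasure_UN_countable[symmetric]) (use C in \<open>auto simp: disjoint_family_on_def pairwise_def disjnt_def\<close>)
  also have "\<dots> = emeasure lborel U" using split[OF \<open>open U\<close> W] C(4) by (simp add: W_def)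
  finally show ?thesis .
qed

lemma distr_orthogonal:
  fixes f :: "'a::euclidean_space \<Rightarrow> 'a"
  assumes f: "orthogonal_transformation f"
  shows "distr lborel borel f = lborel"
proof (rule lborel_eqI[symmetric])
  have inv: "orthogonal_transformation (inv f)" "bij f"
    using f orthogonal_transformation_inv orthogonal_transformation_bij by auto
  have "continuous_on UNIV f"
    using orthogonal_transformation_linear[OF f] by (simp add: linear_continuous_on linear_conv_bounded_linear)
  then have meas: "f \<in> borel_measurable borel" by (rule borel_measurable_continuous_onI)
  fix l u :: 'a assume lu: "\<And>b. b \<in> Basis \<Longrightarrow> l \<bullet> b \<le> u \<bullet> b"
  have "f -` box l u = inv f ` box l u" using inv(2) by (simp add: bij_vimage_eq_inv_image)
  then have "emeasure (distr lborel borel f) (box l u) = emeasure lborel (inv f ` box l u)"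
    using meas by (simp add: emeasure_distr)
  also have "\<dots> = emeasure lborel (box l u)" by (rule emeasure_orthogonal_image_open[OF inv(1) open_box])
  finally show "emeasure (distr lborel borel f) (box l u) = (\<Prod>b\<in>Basis. (u - l) \<bullet> b)"
    using lu by (simp add: emeasure_lborel_box_eq inner_diff_left)
qed simp

lemma
  fixes f :: "'a::euclidean_space \<Rightarrow> 'a" and k :: "'a \<Rightarrow> real"
  assumes f: "orthogonal_transformation f" and "r > 0" and k: "k \<in> borel_measurable borel"
  shows integral_similarity: "(\<integral>y. k y \<partial>lborel) = r ^ DIM('a) * (\<integral>h. k (x + r *\<^sub>R f h) \<partial>lborel)"
    and integrable_similarity: "integrable lborel k \<longleftrightarrow> integrable lborel (\<lambda>h. k (x + r *\<^sub>R f h))"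
proof -
  have "continuous_on UNIV f"
    using orthogonal_transformation_linear[OF f] by (simp add: linear_continuous_on linear_conv_bounded_linear)
  then have f_meas [measurable]: "f \<in> borel_measurable borel" by (rule borel_measurable_continuous_onI)
  note k [measurable]
  let ?D = "distr lborel borel (\<lambda>h. x + r *\<^sub>R h)"
  have lb: "lborel = density ?D (\<lambda>_. ennreal (r ^ DIM('a)))"
    using lborel_affine[of r x] \<open>r > 0\<close> by (simp add: ennreal_power)
  have "(\<integral>y. k y \<partial>lborel) = (\<integral>y. k y \<partial>density ?D (\<lambda>_. ennreal (r ^ DIM('a))))"
    using lb by metis
  also have "\<dots> = (\<integral>y. r ^ DIM('a) * k y \<partial>?D)"
    using \<open>r > 0\<close> by (subst integral_density) auto
  also have "\<dots> = r ^ DIM('a) * (\<integral>h. k (x + r *\<^sub>R h) \<partial>lborel)"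
    by (subst integral_distr) auto
  also have "(\<integral>h. k (x + r *\<^sub>R h) \<partial>lborel) = (\<integral>h. k (x + r *\<^sub>R h) \<partial>distr lborel borel f)"
    by (simp add: distr_orthogonal[OF f])
  also have "\<dots> = (\<integral>h. k (x + r *\<^sub>R f h) \<partial>lborel)"
    by (subst integral_distr) auto
  finally show "(\<integral>y. k y \<partial>lborel) = r ^ DIM('a) * (\<integral>h. k (x + r *\<^sub>R f h) \<partial>lborel)" .
  have "integrable lborel k \<longleftrightarrow> integrable (density ?D (\<lambda>_. ennreal (r ^ DIM('a)))) k"
    using lb by metis
  also have "\<dots> \<longleftrightarrow> integrable ?D (\<lambda>y. r ^ DIM('a) * k y)"
    using \<open>r > 0\<close> by (subst integrable_density) auto
  also have "\<dots> \<longleftrightarrow> integrable lborel (\<lambda>h. r ^ DIM('a) * k (x + r *\<^sub>R h))"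
    by (subst integrable_distr_eq) auto
  also have "\<dots> \<longleftrightarrow> integrable lborel (\<lambda>h. k (x + r *\<^sub>R h))"
    using \<open>r > 0\<close> by simp
  also have "\<dots> \<longleftrightarrow> integrable (distr lborel borel f) (\<lambda>h. k (x + r *\<^sub>R h))"
    by (simp add: distr_orthogonal[OF f])
  also have "\<dots> \<longleftrightarrow> integrable lborel (\<lambda>h. k (x + r *\<^sub>R f h))"
    by (subst integrable_distr_eq) auto
  finally show "integrable lborel k \<longleftrightarrow> integrable lborel (\<lambda>h. k (x + r *\<^sub>R f h))" .
qed

lemma orthogonal_transformation_uminus: "orthogonal_transformation (\<lambda>x::'a::euclidean_space. - x)"
  by (simp add: orthogonal_transformation_def linear_conv_bounded_linear bounded_linear_minus bounded_linear_ident)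

text \<open>Dominated convergence. The origin lies in every removed ball, so convergence at that
  point asks for \<open>H 0 = 0\<close>; for integrands with a factor
  \<open>norm h powr (- N)\<close> this is the convention \<open>0 powr a = 0\<close>.\<close>

lemma tendsto_integral_compl_ball:
  fixes H :: "'a::euclidean_space \<Rightarrow> real"
  assumes H: "integrable lborel H" and "H 0 = 0"
  shows "((\<lambda>\<epsilon>. \<integral>h. indicator (- ball 0 \<epsilon>) h * H h \<partial>lborel) \<longlongrightarrow> (\<integral>h. H h \<partial>lborel)) (at_right 0)"
  unfolding tendsto_at_iff_sequentially
proof (intro allI impI)
  fix X :: "nat \<Rightarrow> real" assume X: "\<forall>i. X i \<in> {0<..} - {0}" "X \<longlonglongrightarrow> 0"
  show "((\<lambda>\<epsilon>. \<integral>h. indicator (- ball 0 \<epsilon>) h * H h \<partial>lborel) \<circ> X) \<longlonglongrightarrow> (\<integral>h. H h \<partial>lborel)"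
    unfolding comp_def
  proof (rule integral_dominated_convergence)
    show "integrable lborel (\<lambda>h. \<bar>H h\<bar>)" using H by simp
    show "AE h in lborel. (\<lambda>i. indicator (- ball 0 (X i)) h * H h) \<longlonglongrightarrow> H h"
    proof (rule AE_I2)
      fix h
      show "(\<lambda>i. indicator (- ball 0 (X i)) h * H h) \<longlonglongrightarrow> H h"
      proof (cases "h = 0")
        case False
        then have "\<forall>\<^sub>F i in sequentially. X i < norm h" using X(2) by (intro order_tendstoD(2)) auto
        then have "\<forall>\<^sub>F i in sequentially. H h = indicator (- ball 0 (X i)) h * H h"
          by eventually_elim (auto simp: indicator_def)
        then show ?thesis by (rule Lim_transform_eventually[OF tendsto_const])
      qed (simp add: assms(2))
    qed
    show "(\<lambda>h. indicator (- ball 0 (X i)) h * H h) \<in> borel_measurable lborel" for i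
    proof -
      have [measurable]: "ball (0::'a) (X i) \<in> sets lborel" by simp
      show ?thesis using H by measurable
    qed
    show "AE h in lborel. norm (indicator (- ball 0 (X i)) h * H h) \<le> \<bar>H h\<bar>" for i
      by (auto simp: indicator_def)
  qed (use H in auto)
qed

section \<open>The fractional p-Laplacian of a radial monotone function\<close>

lemma frac_p_kernel_spow:
  "frac_p_kernel \<sigma> p u x (y :: real ^ 'n) = norm (x - y) powr (- (real CARD('n) + \<sigma> * p)) * spow p (u x - u y)"
  unfolding frac_p_kernel_def spow_def powr_minus by (simp add: divide_inverse)

lemma integrable_symmetrize:
  fixes J :: "'a::euclidean_space \<Rightarrow> real"
  assumes "integrable lborel J"
  shows "(\<integral>h. J h \<partial>lborel) = (\<integral>h. (J h + J (- h)) \<partial>lborel) / 2"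
proof -
  have J: "J \<in> borel_measurable borel" using borel_measurable_integrable[OF assms] by simp
  have "(\<integral>h. J (- h) \<partial>lborel) = (\<integral>h. J h \<partial>lborel)" "integrable lborel (\<lambda>h. J (- h))"
    using integral_similarity[OF orthogonal_transformation_uminus _ J, of 1 0]
      integrable_similarity[OF orthogonal_transformation_uminus _ J, of 1 0] assms by auto
  then show ?thesis using assms by simp
qed

context profile
begin

lemma F_const: "t \<le> -1 \<Longrightarrow> F t = F (-1)"
proof -
  assume "t \<le> -1"
  have "F (t + (- 1 - t)) - F t = (- 1 - t) * exp (m * (- 1 - t)) * mean_slope (t, - 1 - t)" by (rule F_diff)
  moreover have "mean_slope (t, - 1 - t) = 0"
  proof -
    have "w (t + \<theta> * (- 1 - t)) = 0" if "\<theta> \<in> {0..1}" for \<theta>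
    proof (rule w_zero)
      have "\<theta> * (- 1 - t) \<le> 1 * (- 1 - t)" using that \<open>t \<le> -1\<close> by (intro mult_right_mono) auto
      then show "t + \<theta> * (- 1 - t) \<le> - 1" by simp
    qed
    then show ?thesis unfolding mean_slope_def
      by (intro integral_eq_zero_AE AE_I2) (simp add: space_unit_int)
  qed
  ultimately show ?thesis by simp
qed

text \<open>Scaling by \<open>r\<close> shifts the logarithm by \<open>ln r\<close>. The truncation
  levels \<open>- 1\<close> and \<open>ln r - B\<close> produce different arguments only in the
  range where \<open>F\<close> is constant.\<close>

lemma F_lognorm_scale:
  assumes "r > 0" "ln r - B \<le> - 1"
  shows "F (lognorm 1 (r *\<^sub>R z)) = F (ln r + lognorm B z)"
proof (cases "norm z \<ge> exp (- B)")
  case True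
  then have z: "norm z > 0" by (rule less_le_trans[OF exp_gt_zero])
  have 1: "ln r + lognorm B z = ln (r * norm z)" using True assms z by (simp add: lognorm_def max_def ln_mult)
  show ?thesis
  proof (cases "r * norm z \<ge> exp (- 1)")
    case True
    then show ?thesis using 1 assms by (simp add: lognorm_def max_def)
  next
    case False
    then have "ln (r * norm z) \<le> ln (exp (- 1))" using assms z by (subst ln_le_cancel_iff) auto
    then have "F (ln (r * norm z)) = F (- 1)" by (intro F_const) simp
    then show ?thesis using 1 False assms by (simp add: lognorm_def max_def)
  qed
next
  case False
  have "r * norm z \<le> exp (ln r) * exp (- B)" using False assms by simp
  also have "\<dots> = exp (ln r - B)" by (simp add: exp_diff exp_minus divide_inverse)
  also have "\<dots> \<le> exp (- 1)" using assms by simp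
  finally have "lognorm 1 (r *\<^sub>R z) = - 1" using assms by (simp add: lognorm_def max_def)
  moreover have "lognorm B z = - B" using False by (simp add: lognorm_def max_def)
  ultimately show ?thesis using F_const[of "ln r - B"] assms by simp
qed

text \<open>The truncation level \<open>exp (- 1)\<close> is the edge of the plateau of
  \<open>F\<close>, so away from \<open>x0\<close> the value is that of the untruncated
  \<open>F (ln (norm (y - x0)))\<close>. With \<open>\<bar>\<delta>\<bar> = 1\<close> the factor
  selects an increasing or a decreasing function.\<close>

definition radial :: "real \<Rightarrow> real \<Rightarrow> 'a::real_normed_vector \<Rightarrow> 'a \<Rightarrow> real" where
  "radial \<kappa> \<delta> x0 y = \<kappa> + \<delta> * F (lognorm 1 (y - x0))"

lemma continuous_radial: "continuous_on UNIV (radial \<kappa> \<delta> x0)"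
  unfolding radial_def
  by (intro continuous_intros continuous_on_compose2[OF smooth_on_imp_continuous_on[OF smooth_F] continuous_lognorm]) auto

text \<open>Substitute for \<open>y\<close> the point \<open>x\<close> plus \<open>r\<close> times
  \<open>f h\<close>, where \<open>f\<close> is orthogonal and takes \<open>e\<close> to the
  direction of \<open>x - x0\<close>. Then \<open>y - x0\<close> is \<open>r\<close> times
  \<open>f (e + h)\<close>, so apart from a power of \<open>r\<close> the integrand sees
  \<open>x\<close> only through \<open>ln r\<close>. The ball removed in the principal value is
  symmetric, hence \<open>h\<close> can be paired with \<open>- h\<close>.\<close>

lemma radial_laplacian_off_center:
  fixes x x0 :: "real ^ 'n::finite" and e :: "real ^ 'n" and c \<sigma> p \<delta> :: real
  assumes "p > 2" "0 < \<sigma>" "\<sigma> < 1" "m * (p - 1) < \<sigma> * p" "norm e = 1" "x \<noteq> x0" "\<bar>\<delta>\<bar> = 1"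
    and B: "B \<ge> 1" "ln (norm (x - x0)) - B \<le> - 1"
  defines "N \<equiv> real CARD('n) + \<sigma> * p" and "r \<equiv> norm (x - x0)"
  shows "has_frac_p_laplacian c \<sigma> p (radial \<kappa> \<delta> x0) x
    (- c * \<delta> * r powr (- (\<sigma> * p)) / 2 *
      (\<integral>h. norm h powr (- N) * (jump p B (ln r) (e + h) + jump p B (ln r) (e - h)) \<partial>lborel))"
proof -
  let ?a = "ln r" and ?u = "radial \<kappa> \<delta> x0"
  have r: "r > 0" using assms(6) by (simp add: r_def)
  have dn: "DIM(real ^ 'n) = CARD('n)" by simp
  obtain f where f: "orthogonal_transformation f" "f e = (x - x0) /\<^sub>R r"
    using orthogonal_transformation_exists_1[OF assms(5), of "(x - x0) /\<^sub>R r"] r by (auto simp: r_def)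
  have fadd: "f (a + b) = f a + f b" for a b
    using orthogonal_transformation_linear[OF f(1)] by (rule linear_add)
  have nf: "norm (f a) = norm a" for a using f(1) by (rule orthogonal_transformation_norm)
  have scale: "F (lognorm 1 (r *\<^sub>R f z)) = F (?a + lognorm B z)" for z
    using F_lognorm_scale[OF r, of B "f z"] B by (simp add: r_def lognorm_def nf)
  have uy: "?u (x + r *\<^sub>R f h) = \<kappa> + \<delta> * F (?a + lognorm B (e + h))" for h
  proof -
    have "x + r *\<^sub>R f h - x0 = r *\<^sub>R f (e + h)" using r f(2) by (simp add: fadd scaleR_add_right)
    then show ?thesis by (simp add: radial_def scale)
  qed
  have "lognorm B e = 0" using assms(5) B(1) by (simp add: lognorm_def max_def)
  then have ux: "?u x = \<kappa> + \<delta> * F ?a" using uy[of 0] linear_0[OF orthogonal_transformation_linear[OF f(1)]] by simp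
  have ker: "frac_p_kernel \<sigma> p ?u x (x + r *\<^sub>R f h) = (- \<delta> * r powr (- N)) * (norm h powr (- N) * jump p B ?a (e + h))" for h
  proof -
    have s\<delta>: "spow p \<delta> = \<delta>" using assms(7) by (simp add: spow_def)
    have "?u x - ?u (x + r *\<^sub>R f h) = - (\<delta> * (F (?a + lognorm B (e + h)) - F ?a))"
      unfolding ux uy by (simp add: algebra_simps)
    then have "spow p (?u x - ?u (x + r *\<^sub>R f h)) = - \<delta> * jump p B ?a (e + h)"
      by (simp add: spow_minus spow_mult s\<delta> jump_def)
    moreover have "norm (x - (x + r *\<^sub>R f h)) = r * norm h" using r by (simp add: nf)
    ultimately show ?thesis
      unfolding frac_p_kernel_spow using r by (simp add: powr_mult N_def mult_ac)
  qed
  let ?k = "\<lambda>\<epsilon> y. indicator (- ball x \<epsilon>) y * frac_p_kernel \<sigma> p ?u x y"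
  let ?J = "\<lambda>\<epsilon> h. indicator (- ball 0 \<epsilon>) h * (norm h powr (- N) * jump p B ?a (e + h))"
  have ind: "indicator (- ball x \<epsilon>) (x + r *\<^sub>R f h) = (indicator (- ball 0 (\<epsilon> / r)) h :: real)" for \<epsilon> h
    using r by (auto simp: indicator_def dist_norm nf pos_less_divide_eq mult.commute)
  have kk: "?k \<epsilon> (x + r *\<^sub>R f h) = (- \<delta> * r powr (- N)) * ?J (\<epsilon> / r) h" for \<epsilon> h
    unfolding ind ker by simp
  have kmeas: "?k \<epsilon> \<in> borel_measurable borel" for \<epsilon>
  proof -
    have "continuous_on UNIV (\<lambda>y. spow p (?u x - ?u y))"
      by (intro continuous_on_spow assms(1) continuous_intros continuous_radial)
    from borel_measurable_continuous_onI[OF this] have [measurable]: "(\<lambda>y. spow p (?u x - ?u y)) \<in> borel_measurable borel" .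
    have [measurable]: "ball x \<epsilon> \<in> sets borel" by simp
    show ?thesis unfolding frac_p_kernel_spow by measurable
  qed
  have mN: "m * (p - 1) < N - DIM(real ^ 'n)" using assms(4) by (simp add: N_def)
  have Np: "N - DIM(real ^ 'n) < p" using assms(1-3) by (simp add: N_def mult_less_cancel_right2)
  have Jint: "integrable lborel (?J \<epsilon>)" if "\<epsilon> > 0" for \<epsilon>
    by (rule jump_integrable[OF assms(1) mN B(1) assms(5) that])
  have kint: "integrable lborel (?k \<epsilon>)" if "\<epsilon> > 0" for \<epsilon>
    unfolding integrable_similarity[OF f(1) r kmeas, of \<epsilon> x] kk
    using Jint[of "\<epsilon> / r"] that r by (intro integrable_mult_right) auto
  let ?H = "\<lambda>h. norm h powr (- N) * (jump p B ?a (e + h) + jump p B ?a (e - h))"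
  have val: "(\<integral>y. ?k \<epsilon> y \<partial>lborel) = (- \<delta> * r powr (- (\<sigma> * p)) / 2) * (\<integral>h. indicator (- ball 0 (\<epsilon> / r)) h * ?H h \<partial>lborel)"
    if "\<epsilon> > 0" for \<epsilon>
  proof -
    have "(\<integral>y. ?k \<epsilon> y \<partial>lborel) = r ^ CARD('n) * (\<integral>h. (- \<delta> * r powr (- N)) * ?J (\<epsilon> / r) h \<partial>lborel)"
      unfolding integral_similarity[OF f(1) r kmeas, of \<epsilon> x] kk dn ..
    also have "\<dots> = r ^ CARD('n) * ((- \<delta> * r powr (- N)) * (\<integral>h. ?J (\<epsilon> / r) h \<partial>lborel))"
      by (subst integral_mult_right_zero) (rule refl)
    also have "(\<integral>h. ?J (\<epsilon> / r) h \<partial>lborel) = (\<integral>h. ?J (\<epsilon> / r) h + ?J (\<epsilon> / r) (- h) \<partial>lborel) / 2"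
      using that r by (intro integrable_symmetrize Jint) auto
    also have "(\<lambda>h. ?J (\<epsilon> / r) h + ?J (\<epsilon> / r) (- h)) = (\<lambda>h. indicator (- ball 0 (\<epsilon> / r)) h * ?H h)"
      by (auto simp: fun_eq_iff indicator_def distrib_left)
    also have "r ^ CARD('n) * ((- \<delta> * r powr (- N)) * ((\<integral>h. indicator (- ball 0 (\<epsilon> / r)) h * ?H h \<partial>lborel) / 2)) =
      (- \<delta> * (r ^ CARD('n) * r powr (- N)) / 2) * (\<integral>h. indicator (- ball 0 (\<epsilon> / r)) h * ?H h \<partial>lborel)"
      by simp
    also have "r ^ CARD('n) * r powr (- N) = r powr (- (\<sigma> * p))"
      using r by (simp add: N_def powr_realpow[symmetric] powr_add[symmetric])
    finally show ?thesis .
  qed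
  have Hint: "integrable lborel ?H" by (rule jump_pair_smooth(1)[OF assms(1) mN Np B(1) assms(5)])
  have "((\<lambda>\<epsilon>. \<epsilon> / r) \<longlongrightarrow> 0 / r) (at_right 0)" using r by (intro tendsto_intros) auto
  then have fl: "filterlim (\<lambda>\<epsilon>. \<epsilon> / r) (at_right 0) (at_right 0)"
    using r by (auto simp: filterlim_at eventually_at_right_less intro: eventually_mono[OF eventually_at_right_less])
  have "((\<lambda>\<epsilon>. \<integral>h. indicator (- ball 0 (\<epsilon> / r)) h * ?H h \<partial>lborel) \<longlongrightarrow> (\<integral>h. ?H h \<partial>lborel)) (at_right 0)"
    by (rule filterlim_compose[OF tendsto_integral_compl_ball[OF Hint] fl]) simp
  then have "((\<lambda>\<epsilon>. c * ((- \<delta> * r powr (- (\<sigma> * p)) / 2) * (\<integral>h. indicator (- ball 0 (\<epsilon> / r)) h * ?H h \<partial>lborel)))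
      \<longlongrightarrow> c * ((- \<delta> * r powr (- (\<sigma> * p)) / 2) * (\<integral>h. ?H h \<partial>lborel))) (at_right 0)"
    by (intro tendsto_mult tendsto_const)
  moreover have "\<forall>\<^sub>F \<epsilon> in at_right 0. c * ((- \<delta> * r powr (- (\<sigma> * p)) / 2) * (\<integral>h. indicator (- ball 0 (\<epsilon> / r)) h * ?H h \<partial>lborel)) =
      c * (\<integral>y. ?k \<epsilon> y \<partial>lborel)"
    using eventually_at_right_less[of "0::real"] by eventually_elim (simp only: val)
  ultimately have "((\<lambda>\<epsilon>. c * (\<integral>y. ?k \<epsilon> y \<partial>lborel))
      \<longlongrightarrow> c * ((- \<delta> * r powr (- (\<sigma> * p)) / 2) * (\<integral>h. ?H h \<partial>lborel))) (at_right 0)"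
    by (rule Lim_transform_eventually)
  then show ?thesis
    unfolding has_frac_p_laplacian_def set_integrable_def set_lebesgue_integral_def
    using kint by (simp add: mult_ac)
qed

end

section \<open>Integrals against the kernel away from its singularity\<close>

text \<open>The derivative is written as a linear factor times the same kind of power with
  \<open>\<gamma> + 2\<close>, so that repeated differentiation becomes an induction with
  \<open>\<gamma>\<close> arbitrary.\<close>

lemma has_derivative_norm_powr:
  fixes z :: "'a::euclidean_space"
  assumes "z \<noteq> 0"
  shows "((\<lambda>z. norm z powr (- \<gamma>)) has_derivative (\<lambda>v. - \<gamma> * ((z \<bullet> v) * norm z powr (- (\<gamma> + 2))))) (at z)"
proof -
  have n: "norm z > 0" using assms by simp
  have 1: "(norm has_derivative (\<lambda>v. (z \<bullet> v) / norm z)) (at z)"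
    using has_derivative_norm[OF assms] by (simp add: sgn_div_norm inner_commute divide_inverse mult_ac)
  have 2: "((\<lambda>t. t powr (- \<gamma>)) has_derivative ((*) (- \<gamma> * norm z powr (- \<gamma> - 1)))) (at (norm z))"
    using has_real_derivative_powr[OF n, of "- \<gamma>"] unfolding has_field_derivative_def .
  have "norm z powr (- (\<gamma> + 2)) = norm z powr (- \<gamma> - 1) / norm z"
    using powr_diff[of "norm z" "- \<gamma> - 1" 1] n by (simp add: algebra_simps)
  then have "- \<gamma> * norm z powr (- \<gamma> - 1) * ((z \<bullet> v) / norm z) = - \<gamma> * ((z \<bullet> v) * norm z powr (- (\<gamma> + 2)))" for v
    by (simp only:) simp
  then show ?thesis using diff_chain_at[OF 1 2] unfolding comp_def by (simp only:)
qed

text \<open>The first derivatives are constants, and on \<open>norm z > d\<close> a constant is at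
  most a multiple of \<open>norm z\<close>; so one weight serves all orders.\<close>

lemma dbd_inner_norm:
  assumes "d > 0"
  shows "dbd n {z. norm z > d} {()} {\<lambda>_ z. norm z} (\<lambda>_ z. (z::'a::euclidean_space) \<bullet> i)"
proof (cases n)
  have op: "open {z::'a. norm z > d}" by (intro open_Collect_less continuous_intros)
  have b: "bounded_by {z. norm z > d} {()} {\<lambda>_ z. norm z} (\<lambda>_ z. (z::'a) \<bullet> i)"
    by (rule bounded_by_singleI[of _ _ _ "norm i"]) (auto simp: Cauchy_Schwarz_ineq2 mult.commute)
  {
    case 0
    then show ?thesis using b by simp
  next
    case (Suc k)
    show ?thesis unfolding Suc
    proof (rule dbd_SucI[OF op b])
      show "((\<lambda>z. z \<bullet> i) has_derivative (\<lambda>v. v \<bullet> i)) (at x)" for x :: 'a by (auto intro!: derivative_eq_intros)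
      show "dbd k {z. norm z > d} {()} {\<lambda>_ z. norm z} (\<lambda>_ x::'a. j \<bullet> i)" for j :: 'a
      proof (rule dbd_param_const[OF op])
        show "bounded_by {z. norm z > d} {()} {\<lambda>_ z. norm z} (\<lambda>_ x::'a. j \<bullet> i)"
        proof (rule bounded_by_singleI[of _ _ _ "\<bar>j \<bullet> i\<bar> / d"])
          show "\<bar>j \<bullet> i\<bar> \<le> \<bar>j \<bullet> i\<bar> / d * norm x" if "x \<in> {z. norm z > d}" for x :: 'a
            using that assms mult_left_mono[of d "norm x" "\<bar>j \<bullet> i\<bar>"] by (simp add: field_simps)
        qed (use assms in auto)
      qed auto
    qed
  }
qed

text \<open>A derivative gains a factor of order \<open>1 / norm x\<close>, which here is at most
  \<open>1 / d\<close>; it is given away so that the weight can stay the same.\<close>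

lemma dbd_norm_powr:
  assumes "d > 0"
  shows "dbd n {z. norm z > d} {()} {\<lambda>_ z. norm z powr (- \<gamma>)} (\<lambda>_ z::'a::euclidean_space. norm z powr (- \<gamma>))"
proof (induction n arbitrary: \<gamma>)
  case 0
  show ?case unfolding dbd.simps by (rule bounded_by_singleI[of _ _ _ 1]) auto
next
  case (Suc n)
  have op: "open {z::'a. norm z > d}" by (intro open_Collect_less continuous_intros)
  show ?case
  proof (rule dbd_SucI[OF op])
    show "bounded_by {z. norm z > d} {()} {\<lambda>_ z. norm z powr (- \<gamma>)} (\<lambda>_ z::'a. norm z powr (- \<gamma>))"
      by (rule bounded_by_singleI[of _ _ _ 1]) auto
    show "((\<lambda>z. norm z powr (- \<gamma>)) has_derivative (\<lambda>v. - \<gamma> * ((x \<bullet> v) * norm x powr (- (\<gamma> + 2))))) (at x)"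
      if "x \<in> {z. norm z > d}" for x :: 'a using that assms by (intro has_derivative_norm_powr) auto
    fix i :: 'a
    have "dbd n {z. norm z > d} {()} {\<lambda>_ z. norm z powr (- \<gamma>)} (\<lambda>_ z. (z \<bullet> i) * norm z powr (- (\<gamma> + 2)))"
    proof (rule dbd_mult[OF op _ dbd_inner_norm[OF assms] Suc[of "\<gamma> + 2"]])
      fix \<beta> :: "unit \<Rightarrow> 'a \<Rightarrow> real" assume \<beta>: "\<beta> \<in> {\<lambda>_ z. norm z powr (- \<gamma>)}"
      have "norm x * norm x powr (- (\<gamma> + 2)) \<le> 1 / d * \<beta> y x" if "x \<in> {z. norm z > d}" for x y
      proof -
        have "norm x * norm x powr (- (\<gamma> + 2)) = norm x powr (- \<gamma>) * (1 / norm x)"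
          using that assms by (simp add: powr_diff powr_minus powr_add power2_eq_square field_simps)
        also have "\<dots> \<le> norm x powr (- \<gamma>) * (1 / d)"
          using that assms less_trans[of 0 d "norm x"] by (intro mult_left_mono divide_left_mono mult_pos_pos) auto
        finally show ?thesis using \<beta> by simp
      qed
      then have "\<exists>C\<ge>0. \<forall>y\<in>{()}. \<forall>x\<in>{z. norm z > d}. norm x * norm x powr (- (\<gamma> + 2)) \<le> C * \<beta> y x"
        using assms by (intro exI[of _ "1 / d"]) auto
      then show "\<exists>\<beta>1\<in>{\<lambda>_ z. norm z}. \<exists>\<beta>2\<in>{\<lambda>_ z. norm z powr (- (\<gamma> + 2))}. \<exists>C\<ge>0. \<forall>y\<in>{()}. \<forall>x\<in>{z. norm z > d}. \<beta>1 y x * \<beta>2 y x \<le> C * \<beta> y x"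
        by simp
    qed
    then show "dbd n {z. norm z > d} {()} {\<lambda>_ z. norm z powr (- \<gamma>)} (\<lambda>_ z. - \<gamma> * ((z \<bullet> i) * norm z powr (- (\<gamma> + 2))))"
      by (rule dbd_param_mult[OF op order_refl])
  qed
qed

lemma dbd_shift:
  fixes f :: "'a::euclidean_space \<Rightarrow> real"
  assumes "open S" "\<And>y x. y \<in> P \<Longrightarrow> x \<in> S \<Longrightarrow> x - y \<in> T"
  shows "dbd n T {()} B (\<lambda>_. f) \<Longrightarrow> dbd n S P ((\<lambda>\<beta> y x. \<beta> () (x - y)) ` B) (\<lambda>y x. f (x - y))"
proof (induction n arbitrary: f)
  case (0 f)
  have "bounded_by T {()} B (\<lambda>_. f)" using 0 by simp
  then show ?case using assms(2) by (fastforce simp: bounded_by_def)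
next
  case (Suc n)
  show ?case
  proof (rule dbd_SucI[OF assms(1)])
    have "bounded_by T {()} B (\<lambda>_. f)" using Suc.prems by simp
    then show "bounded_by S P ((\<lambda>\<beta> y x. \<beta> () (x - y)) ` B) (\<lambda>y x. f (x - y))"
      using assms(2) by (fastforce simp: bounded_by_def)
    show "((\<lambda>x. f (x - y)) has_derivative (\<lambda>v. dir_deriv v f (x - y))) (at x)" if "y \<in> P" "x \<in> S" for x y
    proof -
      have 1: "((\<lambda>x. x - y) has_derivative (\<lambda>v. v)) (at x)" by (auto intro!: derivative_eq_intros)
      have "f differentiable at (x - y)" using Suc.prems assms(2)[OF that] by simp
      from diff_chain_at[OF 1 has_derivative_dir_deriv[OF this]] show ?thesis by (simp add: comp_def)
    qed
    show "dbd n S P ((\<lambda>\<beta> y x. \<beta> () (x - y)) ` B) (\<lambda>y x. dir_deriv i f (x - y))" if "i \<in> Basis" for i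
      using Suc.prems that by (intro Suc.IH) simp
  qed
qed

text \<open>For \<open>x\<close> in a bounded set and \<open>norm (x - y) > d\<close>,
  \<open>1 + norm y\<close> is at most a multiple of \<open>norm (x - y)\<close>. The weight thus
  becomes independent of \<open>x\<close>, as differentiation under the integral requires.\<close>

lemma dbd_kernel:
  fixes S P :: "'a::euclidean_space set"
  assumes "open S" "S \<subseteq> ball 0 \<rho>" "d > 0" "\<And>y x. y \<in> P \<Longrightarrow> x \<in> S \<Longrightarrow> norm (x - y) > d" "N \<ge> 0"
  shows "dbd n S P {\<lambda>y x. (1 + norm y) powr (- N)} (\<lambda>y x. norm (x - y) powr (- N))"
proof -
  have 1: "dbd n S P ((\<lambda>\<beta> y x. \<beta> () (x - y)) ` {\<lambda>_ z. norm z powr (- N)}) (\<lambda>y x. norm (x - y) powr (- N))"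
    by (rule dbd_shift[OF assms(1) _ dbd_norm_powr[OF assms(3)]]) (use assms(4) in auto)
  show ?thesis
  proof (rule dbd_weaken[OF order_refl order_refl _ 1])
    fix \<beta> :: "'a \<Rightarrow> 'a \<Rightarrow> real" assume \<beta>: "\<beta> \<in> {\<lambda>y x. (1 + norm y) powr (- N)}"
    \<comment> \<open>From \<open>1 + norm y \<le> 1 + norm x + norm (x - y)\<close>, where the
      constant \<open>1 + \<bar>\<rho>\<bar>\<close> is bounded by a multiple of
      \<open>norm (x - y)\<close>, which exceeds \<open>d\<close>.\<close>
    let ?M = "(1 + \<bar>\<rho>\<bar>) / d + 1"
    have "norm (x - y) powr (- N) \<le> ?M powr N * \<beta> y x" if "y \<in> P" "x \<in> S" for y x
    proof -
      have xy: "norm (x - y) > d" using assms(4)[OF that] .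
      have "norm x < \<rho>" using that assms(2) by auto
      moreover have "norm y \<le> norm x + norm (x - y)" using norm_triangle_ineq4[of x "x - y"] by simp
      moreover have "1 + \<bar>\<rho>\<bar> \<le> (1 + \<bar>\<rho>\<bar>) / d * norm (x - y)"
        using xy assms(3) mult_left_mono[of d "norm (x - y)" "1 + \<bar>\<rho>\<bar>"] by (simp add: field_simps)
      ultimately have "1 + norm y \<le> ?M * norm (x - y)" by (simp add: distrib_right)
      then have "(?M * norm (x - y)) powr (- N) \<le> (1 + norm y) powr (- N)"
        using assms(5) by (intro powr_mono2') (auto intro: add_pos_nonneg)
      moreover have "?M > 0" using assms(3) by (intro add_nonneg_pos) auto
      ultimately have "?M powr N * (?M powr (- N) * norm (x - y) powr (- N)) \<le> ?M powr N * (1 + norm y) powr (- N)"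
        by (intro mult_left_mono) (auto simp: powr_mult)
      moreover have "?M powr N * ?M powr (- N) = 1" using \<open>?M > 0\<close> by (simp add: powr_add[symmetric])
      ultimately show ?thesis using \<beta> by (simp add: mult.assoc[symmetric])
    qed
    then show "\<exists>\<beta>'\<in>(\<lambda>\<beta> y x. \<beta> () (x - y)) ` {\<lambda>_ z. norm z powr (- N)}. \<exists>C\<ge>0. \<forall>y\<in>P. \<forall>x\<in>S. \<beta>' y x \<le> C * \<beta> y x"
      by (auto intro!: exI[of _ "?M powr N"])
  qed
qed

text \<open>In the application \<open>N\<close> exceeds the dimension, so the kernel is not locally
  integrable; the potential is estimated at points a fixed distance away from the set where
  \<open>W\<close> is nonzero.\<close>

definition potential :: "real \<Rightarrow> ('a::euclidean_space \<Rightarrow> real) \<Rightarrow> 'a \<Rightarrow> real" where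
  "potential N W x = (\<integral>y. W y * norm (x - y) powr (- N) \<partial>lborel)"

lemma dir_deriv_mult_const:
  "f differentiable (at x) \<Longrightarrow> dir_deriv i (\<lambda>x. c * f x) x = c * dir_deriv i f x"
  by (rule dir_deriv_eq) (auto intro!: derivative_eq_intros has_derivative_dir_deriv)

text \<open>The measure is restricted to the set where \<open>W\<close> is nonzero, because for
  those \<open>y\<close> the kernel is smooth on \<open>S\<close> with uniform bounds. The integrals
  are not changed by this.\<close>

lemma
  fixes S :: "'a::euclidean_space set"
  assumes S: "open S" "S \<subseteq> ball 0 \<rho>" and "d > 0" "N \<ge> 0"
    and W: "W \<in> borel_measurable borel" "integrable lborel (\<lambda>y. \<bar>W y\<bar> * (1 + norm y) powr (- N))"
    and WS: "\<And>x y. x \<in> S \<Longrightarrow> W y \<noteq> 0 \<Longrightarrow> norm (x - y) > d"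
  shows smooth_on_potential: "smooth_on S (potential N W)"
    and integrable_potential: "x \<in> S \<Longrightarrow> integrable lborel (\<lambda>y. W y * norm (x - y) powr (- N))"
    and dir_deriv_potential: "x \<in> S \<Longrightarrow> i \<in> Basis \<Longrightarrow>
      dir_deriv i (potential N W) x = (\<integral>y. W y * dir_deriv i (\<lambda>x. norm (x - y) powr (- N)) x \<partial>lborel)"
    and dir_deriv2_potential: "x \<in> S \<Longrightarrow> i \<in> Basis \<Longrightarrow> j \<in> Basis \<Longrightarrow>
      dir_deriv i (dir_deriv j (potential N W)) x =
      (\<integral>y. W y * dir_deriv i (dir_deriv j (\<lambda>x. norm (x - y) powr (- N))) x \<partial>lborel)"
proof -
  have [measurable]: "W \<in> borel_measurable borel" by (rule W(1))
  let ?P = "{y. W y \<noteq> 0}" and ?B = "\<lambda>y. \<bar>W y\<bar> * (1 + norm y) powr (- N)"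
  let ?k = "\<lambda>y x::'a. norm (x - y) powr (- N)" and ?M = "restrict_space lborel {y. W y \<noteq> 0}"
  have Ps: "?P \<in> sets lborel" using W(1) by measurable
  have sp: "space ?M = ?P" by (simp add: space_restrict_space)
  have conv: "(\<integral>y. W y * g y \<partial>?M) = (\<integral>y. W y * g y \<partial>lborel)" for g
    using Ps by (subst integral_restrict_space) (auto intro!: Bochner_Integration.integral_cong simp: indicator_def)
  have convi: "integrable ?M (\<lambda>y. W y * g y) \<longleftrightarrow> integrable lborel (\<lambda>y. W y * g y)" for g
    using Ps by (subst integrable_restrict_space) (auto intro!: Bochner_Integration.integrable_cong simp: indicator_def)
  have dk: "dbd n S ?P {\<lambda>y x. (1 + norm y) powr (- N)} ?k" for n
    using WS by (intro dbd_kernel[OF S assms(3) _ assms(4)]) auto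
  have mult: "dbd n S ?P {\<lambda>y x. ?B y} (\<lambda>y x. W y * f y x)"
    if "dbd n S ?P {\<lambda>y x. (1 + norm y) powr (- N)} f" for n f
  proof (rule dbd_mult[where ?B1.0 = "{\<lambda>y x. \<bar>W y\<bar>}", OF S(1) _ _ that])
    show "dbd n S ?P {\<lambda>y x. \<bar>W y\<bar>} (\<lambda>y x. W y)"
      by (rule dbd_param_const[OF S(1)]) (auto intro: bounded_by_singleI[of _ _ _ 1])
  qed (auto intro!: exI[of _ "1::real"])
  have Bi: "integrable ?M ?B"
  proof -
    have "(\<lambda>y. \<bar>W y\<bar> * (1 + norm y) powr (- N)) = (\<lambda>y. W y * (sgn (W y) * (1 + norm y) powr (- N)))"
      by (auto simp: fun_eq_iff abs_sgn)
    then show ?thesis using W(2) convi by simp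
  qed
  have meas: "(\<lambda>y. W y * norm (x - y) powr (- N)) \<in> borel_measurable ?M" for x
    using W(1) by (intro measurable_restrict_space1) measurable
  have P: "potential N W x = (\<integral>y. W y * ?k y x \<partial>?M)" for x
    by (simp add: potential_def conv)
  have d: "dbd n S (space ?M) {\<lambda>y x. ?B y} (\<lambda>y x. W y * ?k y x)" for n
    unfolding sp by (rule mult[OF dk])
  have "dbd n S {()} {} (\<lambda>_. potential N W)" for n
    unfolding P[abs_def]
  proof (rule dbd_integral[OF S(1) Bi, where Bs = "{}"])
    show "dbd n S (space ?M) {} (\<lambda>y x. W y * ?k y x)"
      by (rule dbd_weaken[OF order_refl order_refl _ d]) simp
  qed (use d meas in auto)
  then show "smooth_on S (potential N W)" by (simp add: smooth_on_def)
  show "x \<in> S \<Longrightarrow> integrable lborel (\<lambda>y. W y * norm (x - y) powr (- N))"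
    using dbd_integrable[OF d[of 0] Bi _ meas] convi by simp
  have kd: "?k y differentiable (at x)" "dir_deriv j (?k y) differentiable (at x)" if "y \<in> ?P" "x \<in> S" "j \<in> Basis" for x y j
    using dk[of "Suc (Suc 0)"] that by auto
  have D: "dir_deriv i (potential N W) x = (\<integral>y. W y * dir_deriv i (?k y) x \<partial>?M)" if "x \<in> S" "i \<in> Basis" for x i
  proof -
    have "dir_deriv i (potential N W) x = (\<integral>y. dir_deriv i (\<lambda>x. W y * ?k y x) x \<partial>?M)"
      unfolding P[abs_def]
      by (rule dbd_has_derivative_integral(2)[OF S(1) Bi d[of "Suc 0"] meas that])
    also have "\<dots> = (\<integral>y. W y * dir_deriv i (?k y) x \<partial>?M)"
      using kd(1)[OF _ that] by (intro Bochner_Integration.integral_cong refl dir_deriv_mult_const) (auto simp: sp)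
    finally show ?thesis .
  qed
  then show "x \<in> S \<Longrightarrow> i \<in> Basis \<Longrightarrow>
      dir_deriv i (potential N W) x = (\<integral>y. W y * dir_deriv i (\<lambda>x. norm (x - y) powr (- N)) x \<partial>lborel)"
    by (simp add: conv)
  show "dir_deriv i (dir_deriv j (potential N W)) x =
      (\<integral>y. W y * dir_deriv i (dir_deriv j (\<lambda>x. norm (x - y) powr (- N))) x \<partial>lborel)"
    if "x \<in> S" "i \<in> Basis" "j \<in> Basis"
  proof -
    have m: "(\<lambda>y. W y * dir_deriv j (?k y) z) \<in> borel_measurable ?M" if z: "z \<in> S" for z
    proof -
      have "(\<lambda>y. dir_deriv j (?k y) z) \<in> borel_measurable ?M"
      proof (rule borel_measurable_dir_deriv[OF S(1) z])
        show "(\<lambda>y. norm (z - y) powr (- N)) \<in> borel_measurable ?M" for z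
          by (intro measurable_restrict_space1) measurable
      qed (use kd(1)[OF _ z \<open>j \<in> Basis\<close>] sp in auto)
      moreover have "W \<in> borel_measurable ?M" using W(1) by (intro measurable_restrict_space1) simp
      ultimately show ?thesis by (rule borel_measurable_times[rotated])
    qed
    have dj: "dbd (Suc 0) S ?P {\<lambda>y x. (1 + norm y) powr (- N)} (\<lambda>y. dir_deriv j (?k y))"
      using dk[of "Suc (Suc 0)"] that(3) by auto
    have md: "dbd (Suc 0) S (space ?M) {\<lambda>y x. ?B y} (\<lambda>y x. W y * dir_deriv j (?k y) x)"
      unfolding sp by (rule mult[OF dj])
    have "dir_deriv i (dir_deriv j (potential N W)) x = dir_deriv i (\<lambda>x. \<integral>y. W y * dir_deriv j (?k y) x \<partial>?M) x"
      by (rule dir_deriv_cong(2)[OF S(1) that(1)]) (rule D[OF _ that(3)])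
    also have "\<dots> = (\<integral>y. dir_deriv i (\<lambda>x. W y * dir_deriv j (?k y) x) x \<partial>?M)"
      by (rule dbd_has_derivative_integral(2)[OF S(1) Bi md m that(1,2)])
    also have "\<dots> = (\<integral>y. W y * dir_deriv i (dir_deriv j (?k y)) x \<partial>?M)"
      using kd(2)[OF _ that(1,3)] by (intro Bochner_Integration.integral_cong refl dir_deriv_mult_const) (auto simp: sp)
    finally show ?thesis by (simp add: conv)
  qed
qed

section \<open>The operator at points of a plateau, and its smoothness for radial functions\<close>

text \<open>The integrand vanishes within distance \<open>d\<close> of \<open>x\<close>, so the
  truncated integrals do not change for \<open>\<epsilon> < d\<close> and the principal value is an
  ordinary integral.\<close>

lemma has_frac_p_laplacian_plateau:
  fixes u :: "real ^ 'n::finite \<Rightarrow> real"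
  assumes "d > 0" and u: "\<And>y. norm (x - y) \<le> d \<Longrightarrow> u y = u x"
    and int: "integrable lborel (\<lambda>y. spow p (u x - u y) * norm (x - y) powr (- (real CARD('n) + \<sigma> * p)))"
  shows "has_frac_p_laplacian c \<sigma> p u x (c * potential (real CARD('n) + \<sigma> * p) (\<lambda>y. spow p (u x - u y)) x)"
proof -
  let ?k = "\<lambda>y. spow p (u x - u y) * norm (x - y) powr (- (real CARD('n) + \<sigma> * p))"
  have k: "frac_p_kernel \<sigma> p u x = ?k" by (auto simp: fun_eq_iff frac_p_kernel_spow)
  have meas: "ball x \<epsilon> \<in> sets lborel" for \<epsilon> by simp
  have "integrable lborel (\<lambda>y. indicator (- ball x \<epsilon>) y * ?k y)" for \<epsilon>
  proof (rule Bochner_Integration.integrable_bound[OF int])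
    show "(\<lambda>y. indicator (- ball x \<epsilon>) y * ?k y) \<in> borel_measurable lborel"
      using meas[of \<epsilon>] by (intro borel_measurable_times[OF borel_measurable_indicator borel_measurable_integrable[OF int]]) auto
  qed (auto simp: indicator_def)
  moreover have eq: "c * (\<integral>y. indicator (- ball x \<epsilon>) y * ?k y \<partial>lborel) = c * (\<integral>y. ?k y \<partial>lborel)" if "\<epsilon> < d" for \<epsilon>
  proof -
    have "(\<lambda>y. indicator (- ball x \<epsilon>) y * ?k y) = ?k"
      using u that by (auto simp: fun_eq_iff indicator_def dist_norm spow_def)
    then show ?thesis by simp
  qed
  have "\<forall>\<^sub>F \<epsilon> in at_right 0. c * (\<integral>y. ?k y \<partial>lborel) = c * (\<integral>y. indicator (- ball x \<epsilon>) y * ?k y \<partial>lborel)"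
    using eventually_at_right_real[OF assms(1)] by eventually_elim (rule eq[symmetric], simp)
  from Lim_transform_eventually[OF tendsto_const this]
  have "((\<lambda>\<epsilon>. c * (\<integral>y. indicator (- ball x \<epsilon>) y * ?k y \<partial>lborel)) \<longlongrightarrow> c * (\<integral>y. ?k y \<partial>lborel)) (at_right 0)" .
  ultimately show ?thesis
    unfolding has_frac_p_laplacian_def set_integrable_def set_lebesgue_integral_def k potential_def by simp
qed

lemma integrable_one_plus_norm_powr:
  assumes "\<alpha> < - real DIM('a::euclidean_space)"
  shows "integrable lborel (\<lambda>y::'a. (1 + norm y) powr \<alpha>)"
proof -
  have \<alpha>: "\<alpha> < 0" using assms by (rule less_le_trans) simp
  have "integrable lborel (indicator (ball (0::'a) 1) :: 'a \<Rightarrow> real)"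
    using emeasure_lborel_ball_finite[of "0::'a" 1] by (simp add: integrable_indicator_iff)
  then have "integrable lborel (\<lambda>y::'a. indicator (ball 0 1) y + indicator (- ball 0 1) y * norm y powr \<alpha>)"
    using integrable_norm_powr_compl[OF assms, of 1] by simp
  then show ?thesis
  proof (rule Bochner_Integration.integrable_bound)
    show "AE y::'a in lborel. norm ((1 + norm y) powr \<alpha>) \<le> norm (indicator (ball 0 1) y + indicator (- ball 0 1) y * norm y powr \<alpha>)"
    proof (rule AE_I2)
      fix y :: 'a
      show "norm ((1 + norm y) powr \<alpha>) \<le> norm (indicator (ball 0 1) y + indicator (- ball 0 1) y * norm y powr \<alpha>)"
      proof (cases "norm y < 1")
        case True
        have "(1 + norm y) powr \<alpha> \<le> (1 + norm y) powr 0" using \<alpha> by (intro powr_mono) auto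
        then show ?thesis using True by (simp add: add_nonneg_eq_0_iff)
      next
        case False
        then have "norm y > 0" by linarith
        then have "(1 + norm y) powr \<alpha> \<le> norm y powr \<alpha>" using \<alpha> by (intro powr_mono2') auto
        then show ?thesis using False by simp
      qed
    qed
  qed measurable
qed

lemma one_plus_norm_shift: "1 + norm (y - x) \<le> (1 + norm x) * (1 + norm (y::'a::real_normed_vector))"
proof -
  have "norm (y - x) \<le> norm y + norm x" by (rule norm_triangle_ineq4)
  moreover have "0 \<le> norm x * norm y" by simp
  moreover have "(1 + norm x) * (1 + norm y) = 1 + norm x + norm y + norm x * norm y"
    by (simp add: algebra_simps)
  ultimately show ?thesis by linarith
qed

lemma has_frac_p_laplacian_unique:
  "has_frac_p_laplacian c \<sigma> p u x L \<Longrightarrow> has_frac_p_laplacian c \<sigma> p u x L' \<Longrightarrow> L = L'"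
  unfolding has_frac_p_laplacian_def using tendsto_unique[OF trivial_limit_at_right_real] by blast

lemma powr_add_le:
  fixes a b :: real
  assumes "0 \<le> a" "0 \<le> b" "k \<ge> 0"
  shows "(a + b) powr k \<le> 2 powr k * (a powr k + b powr k)"
proof -
  have "(a + b) powr k \<le> (2 * max a b) powr k" using assms by (intro powr_mono2) auto
  also have "\<dots> = 2 powr k * max a b powr k" using assms by (simp add: powr_mult)
  also have "max a b powr k \<le> a powr k + b powr k" by (simp add: max_def)
  finally show ?thesis by simp
qed

context profile
begin

lemma F_lognorm:
  assumes "z \<noteq> 0"
  shows "F (lognorm 1 z) = F (ln (norm z))"
proof (cases "norm z \<ge> exp (- 1)")
  case False
  then have "ln (norm z) \<le> ln (exp (- 1))" using assms by (subst ln_le_cancel_iff) auto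
  then have "F (ln (norm z)) = F (- 1)" by (intro F_const) simp
  then show ?thesis using False by (simp add: lognorm_def max_def)
qed (simp add: lognorm_def max_def)

lemma radial_center:
  assumes "norm (y - x0) \<le> exp (- 1)"
  shows "radial \<kappa> \<delta> x0 y = radial \<kappa> \<delta> x0 x0"
  using assms by (simp add: radial_def lognorm_def max_def)

text \<open>The centre is the only point where the logarithm of the distance fails to be smooth, and
  the function is constant on a ball about it.\<close>

lemma smooth_radial: "smooth_on UNIV (radial \<kappa> \<delta> (x0::'a::euclidean_space))"
proof (rule smooth_on_local)
  fix x :: 'a
  show "\<exists>T. x \<in> T \<and> smooth_on T (radial \<kappa> \<delta> x0)"
  proof (cases "x = x0")
    case False
    have op: "open (- {x0})" by auto
    have "smooth_on (- {x0}) (\<lambda>y. norm (y - x0))" by (rule smooth_on_norm[OF op]) auto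
    then have "smooth_on (- {x0}) (\<lambda>y. ln (norm (y - x0)))"
      by (rule smooth_on_compose[OF op smooth_on_ln]) auto
    then have "smooth_on (- {x0}) (\<lambda>y. F (ln (norm (y - x0))))"
      by (rule smooth_on_compose[OF op smooth_F]) auto
    then have "smooth_on (- {x0}) (\<lambda>y. \<kappa> + \<delta> * F (ln (norm (y - x0))))"
      by (intro smooth_on_add smooth_on_mult smooth_on_const op)
    moreover have "\<kappa> + \<delta> * F (ln (norm (y - x0))) = radial \<kappa> \<delta> x0 y" if "y \<in> - {x0}" for y
      using that F_lognorm[of "y - x0"] by (simp add: radial_def)
    ultimately have "smooth_on (- {x0}) (radial \<kappa> \<delta> x0)"
      using smooth_on_cong[OF op, of "\<lambda>y. \<kappa> + \<delta> * F (ln (norm (y - x0)))" "radial \<kappa> \<delta> x0"] by blast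
    then show ?thesis using False by (intro exI[of _ "- {x0}"]) auto
  next
    case True
    have op: "open (ball x0 (exp (- 1)))" by simp
    have "smooth_on (ball x0 (exp (- 1))) (\<lambda>_. radial \<kappa> \<delta> x0 x0)" by (rule smooth_on_const[OF op])
    moreover have "radial \<kappa> \<delta> x0 x0 = radial \<kappa> \<delta> x0 y" if "y \<in> ball x0 (exp (- 1))" for y
      by (rule radial_center[symmetric]) (use that in \<open>simp add: dist_norm norm_minus_commute\<close>)
    ultimately have "smooth_on (ball x0 (exp (- 1))) (radial \<kappa> \<delta> x0)"
      using smooth_on_cong[OF op, of "\<lambda>_. radial \<kappa> \<delta> x0 x0" "radial \<kappa> \<delta> x0"] by blast
    then show ?thesis using True by (intro exI[of _ "ball x0 (exp (- 1))"]) auto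
  qed
qed

text \<open>The increment of \<open>F\<close> above its plateau value is at most a constant times a
  logarithm times the power \<open>m\<close> of the distance. Its power \<open>p - 1\<close>
  therefore stays below every exponent greater than \<open>m * (p - 1)\<close>.\<close>

lemma radial_growth:
  fixes x0 :: "'a::euclidean_space" and p N v \<kappa> \<delta> \<gamma> :: real
  assumes "p > 2" "\<bar>\<delta>\<bar> = 1" "\<gamma> > m * (p - 1)"
  obtains C where "C \<ge> 0" "\<And>y. \<bar>spow p (v - radial \<kappa> \<delta> x0 y)\<bar> \<le> C * (1 + norm y) powr \<gamma>"
proof -
  have \<kappa>: "m * (p - 1) \<ge> 0" using m assms by simp
  have \<gamma>: "\<gamma> > 0" using \<kappa> assms by linarith
  obtain i :: 'a where i: "i \<in> Basis" by (meson nonempty_Basis ex_in_conv)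
  obtain K where K: "K \<ge> 0" "\<And>(z::'a) (h::'a). norm h \<ge> 1 \<Longrightarrow> norm z \<le> 1 + norm h \<Longrightarrow>
    \<bar>spow p (lognorm 0 z) * exp (m * (p - 1) * lognorm 0 z)\<bar> \<le> K * norm h powr (m * (p - 1) + (\<gamma> - m * (p - 1)))"
    using spow_exp_far[OF assms(1) \<kappa>, of "\<gamma> - m * (p - 1)" 0 1] assms(3) by auto
  obtain C where C: "C \<ge> 0" "\<And>b. b > - 2 \<Longrightarrow> \<bar>mean_slope (- 1, b) powr (p - 1)\<bar> \<le> C"
    using dbd_bounded_by[OF dbd_mean_slope_powr[OF assms(1) _ refl, of 1 0 "- 2" 0]] by (auto simp: bounded_by_def)
  have growF: "\<bar>F (lognorm 1 z) - F (- 1)\<bar> powr (p - 1) \<le> (K * exp 1 powr \<gamma> * C) * (1 + norm z) powr \<gamma>" for z :: 'a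
  proof -
    \<comment> \<open>An auxiliary vector that supplies a length comparable with
      \<open>1 + norm z\<close> to the bound for far points.\<close>
    define h where "h = (exp 1 * (1 + norm z)) *\<^sub>R i"
    have nh: "norm h = exp 1 * (1 + norm z)" using i by (simp add: h_def)
    have "1 \<le> exp (1::real)" by simp
    then have h1: "norm h \<ge> 1" unfolding nh using mult_mono[of 1 "exp 1" 1 "1 + norm z"] by simp
    have nz: "norm (exp 1 *\<^sub>R z) \<le> 1 + norm h" unfolding nh by (simp add: distrib_left add_increasing)
    \<comment> \<open>Scaling by \<open>exp 1\<close> moves the truncation level to 1, so the
      increment \<open>b\<close> is nonnegative and starts from the plateau point
      \<open>- 1\<close>.\<close>
    have "lognorm 0 (exp 1 *\<^sub>R z) = 1 + lognorm 1 z"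
    proof -
      have "max (exp 1 * norm z) 1 = exp 1 * max (norm z) (exp (- 1))"
        by (simp add: max_mult_distrib_left exp_minus)
      moreover have "max (norm z) (exp (- 1)) > 0" by (simp add: less_max_iff_disj)
      ultimately show ?thesis by (simp add: lognorm_def ln_mult)
    qed
    then have "F (lognorm 1 z) = F (- 1 + lognorm 0 (exp 1 *\<^sub>R z))" by simp
    then have "\<bar>F (lognorm 1 z) - F (- 1)\<bar> powr (p - 1) =
        \<bar>spow p (lognorm 0 (exp 1 *\<^sub>R z)) * exp (m * (p - 1) * lognorm 0 (exp 1 *\<^sub>R z))\<bar> * \<bar>mean_slope (- 1, lognorm 0 (exp 1 *\<^sub>R z)) powr (p - 1)\<bar>"
      unfolding abs_spow[symmetric] by (simp only: spow_F_diff abs_mult)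
    also have "\<dots> \<le> (K * norm h powr \<gamma>) * C"
      using K(2)[OF h1 nz] C(2)[of "lognorm 0 (exp 1 *\<^sub>R z)"] lognorm_ge[of 0 "exp 1 *\<^sub>R z"] K(1)
      by (intro mult_mono) auto
    also have "\<dots> = (K * exp 1 powr \<gamma> * C) * (1 + norm z) powr \<gamma>" unfolding nh by (simp add: powr_mult)
    finally show ?thesis .
  qed
  let ?v = "\<bar>v - \<kappa> - \<delta> * F (- 1)\<bar>"
  let ?C = "2 powr (p - 1) * (?v powr (p - 1) + K * exp 1 powr \<gamma> * C) * (1 + norm x0) powr \<gamma>"
  have "\<bar>spow p (v - radial \<kappa> \<delta> x0 y)\<bar> \<le> ?C * (1 + norm y) powr \<gamma>" for y
  proof -
    let ?z = "y - x0"
    have "v - radial \<kappa> \<delta> x0 y = (v - \<kappa> - \<delta> * F (- 1)) + (- (\<delta> * (F (lognorm 1 ?z) - F (- 1))))"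
      by (simp add: radial_def algebra_simps)
    then have "\<bar>v - radial \<kappa> \<delta> x0 y\<bar> \<le> ?v + \<bar>- (\<delta> * (F (lognorm 1 ?z) - F (- 1)))\<bar>"
      by (metis abs_triangle_ineq)
    also have "\<bar>- (\<delta> * (F (lognorm 1 ?z) - F (- 1)))\<bar> = \<bar>F (lognorm 1 ?z) - F (- 1)\<bar>"
      using assms(2) by (simp add: abs_mult)
    finally have "\<bar>spow p (v - radial \<kappa> \<delta> x0 y)\<bar> \<le> (?v + \<bar>F (lognorm 1 ?z) - F (- 1)\<bar>) powr (p - 1)"
      unfolding abs_spow using assms(1) by (intro powr_mono2) auto
    also have "\<dots> \<le> 2 powr (p - 1) * (?v powr (p - 1) + \<bar>F (lognorm 1 ?z) - F (- 1)\<bar> powr (p - 1))"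
      using assms(1) by (intro powr_add_le) auto
    also have "\<dots> \<le> 2 powr (p - 1) * (?v powr (p - 1) * (1 + norm ?z) powr \<gamma> + (K * exp 1 powr \<gamma> * C) * (1 + norm ?z) powr \<gamma>)"
      using growF[of ?z] \<gamma> by (intro mult_left_mono add_mono) (auto intro!: ge_one_powr_ge_zero simp: mult_le_cancel_left1)
    also have "\<dots> = 2 powr (p - 1) * (?v powr (p - 1) + K * exp 1 powr \<gamma> * C) * (1 + norm ?z) powr \<gamma>"
      by (simp add: algebra_simps)
    also have "\<dots> \<le> 2 powr (p - 1) * (?v powr (p - 1) + K * exp 1 powr \<gamma> * C) * ((1 + norm x0) * (1 + norm y)) powr \<gamma>"
      using \<gamma> K(1) C(1) one_plus_norm_shift[of y x0] by (intro mult_left_mono powr_mono2) auto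
    also have "\<dots> = ?C * (1 + norm y) powr \<gamma>" by (simp add: powr_mult)
    finally show ?thesis .
  qed
  moreover have "?C \<ge> 0" using K(1) C(1) by simp
  ultimately show ?thesis using that by blast
qed

lemma radial_integrable:
  fixes x0 :: "'a::euclidean_space" and p N v \<kappa> \<delta> \<gamma> :: real
  assumes "p > 2" "\<bar>\<delta>\<bar> = 1" "m * (p - 1) < N - DIM('a)"
  shows "integrable lborel (\<lambda>y. \<bar>spow p (v - radial \<kappa> \<delta> x0 y)\<bar> * (1 + norm y) powr (- N))"
    and "(\<lambda>y. spow p (v - radial \<kappa> \<delta> x0 y)) \<in> borel_measurable borel"
proof -
  have "continuous_on UNIV (\<lambda>y. spow p (v - radial \<kappa> \<delta> x0 y))"
    by (intro continuous_on_spow assms(1) continuous_intros continuous_radial)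
  then show meas [measurable]: "(\<lambda>y. spow p (v - radial \<kappa> \<delta> x0 y)) \<in> borel_measurable borel"
    by (rule borel_measurable_continuous_onI)
  define \<gamma> where "\<gamma> = (m * (p - 1) + (N - DIM('a))) / 2"
  have \<gamma>: "\<gamma> > m * (p - 1)" "\<gamma> - N < - real DIM('a)" using assms(3) by (auto simp: \<gamma>_def field_simps)
  obtain C where C: "C \<ge> 0" "\<And>y. \<bar>spow p (v - radial \<kappa> \<delta> x0 y)\<bar> \<le> C * (1 + norm y) powr \<gamma>"
    using radial_growth[OF assms(1,2) \<gamma>(1)] by blast
  have "integrable lborel (\<lambda>y::'a. C * (1 + norm y) powr (\<gamma> - N))"
    by (intro integrable_mult_right integrable_one_plus_norm_powr \<gamma>(2))
  then show "integrable lborel (\<lambda>y. \<bar>spow p (v - radial \<kappa> \<delta> x0 y)\<bar> * (1 + norm y) powr (- N))"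
  proof (rule Bochner_Integration.integrable_bound)
    show "AE y in lborel. norm (\<bar>spow p (v - radial \<kappa> \<delta> x0 y)\<bar> * (1 + norm y) powr (- N)) \<le> norm (C * (1 + norm y) powr (\<gamma> - N))"
    proof (rule AE_I2)
      fix y :: 'a
      have "\<bar>spow p (v - radial \<kappa> \<delta> x0 y)\<bar> * (1 + norm y) powr (- N) \<le> (C * (1 + norm y) powr \<gamma>) * (1 + norm y) powr (- N)"
        by (intro mult_right_mono C) simp
      also have "\<dots> = C * (1 + norm y) powr (\<gamma> - N)" by (simp add: mult.assoc powr_add[symmetric])
      finally show "norm (\<bar>spow p (v - radial \<kappa> \<delta> x0 y)\<bar> * (1 + norm y) powr (- N)) \<le> norm (C * (1 + norm y) powr (\<gamma> - N))"
        using C(1) by (simp add: abs_mult)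
    qed
  qed measurable
qed

lemma radial_laplacian_plateau:
  fixes x0 :: "real ^ 'n::finite" and c \<sigma> p \<delta> :: real
  assumes "p > 2" "0 < \<sigma>" "m * (p - 1) < \<sigma> * p" "\<bar>\<delta>\<bar> = 1"
    and S: "open S" "S \<subseteq> ball 0 \<rho>" "d > 0"
    and v: "\<And>x y. x \<in> S \<Longrightarrow> norm (x - y) \<le> d \<Longrightarrow> radial \<kappa> \<delta> x0 y = v"
  defines "N \<equiv> real CARD('n) + \<sigma> * p" and "W \<equiv> \<lambda>y. spow p (v - radial \<kappa> \<delta> x0 y)"
  shows "smooth_on S (\<lambda>x. c * potential N W x)"
    and "x \<in> S \<Longrightarrow> has_frac_p_laplacian c \<sigma> p (radial \<kappa> \<delta> x0) x (c * potential N W x)"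
proof -
  have mN: "m * (p - 1) < N - DIM(real ^ 'n)" using assms(3) by (simp add: N_def)
  have N: "N \<ge> 0" using assms(1,2) by (simp add: N_def)
  have W: "integrable lborel (\<lambda>y. \<bar>W y\<bar> * (1 + norm y) powr (- N))" "W \<in> borel_measurable borel"
    unfolding W_def by (rule radial_integrable[OF assms(1,4) mN])+
  have WS: "norm (x - y) > d" if "x \<in> S" "W y \<noteq> 0" for x y
  proof (rule ccontr)
    assume "\<not> norm (x - y) > d"
    then have "radial \<kappa> \<delta> x0 y = v" using v[OF that(1)] by simp
    then show False using that(2) by (simp add: W_def spow_def)
  qed
  show "smooth_on S (\<lambda>x. c * potential N W x)"
    by (intro smooth_on_mult smooth_on_const S smooth_on_potential[OF S N W(2,1) WS])
  show "has_frac_p_laplacian c \<sigma> p (radial \<kappa> \<delta> x0) x (c * potential N W x)" if x: "x \<in> S"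
  proof -
    have ux: "radial \<kappa> \<delta> x0 x = v" using v[OF x, of x] S(3) by simp
    have "integrable lborel (\<lambda>y. W y * norm (x - y) powr (- N))"
      by (rule integrable_potential[OF S N W(2,1) WS x])
    then show ?thesis
      using has_frac_p_laplacian_plateau[OF S(3), of x "radial \<kappa> \<delta> x0" p \<sigma> c] v[OF x] unfolding ux
      by (simp add: N_def W_def)
  qed
qed

text \<open>Off the centre the operator is a power of the distance times a smooth function of its
  logarithm; near the centre it is a smooth potential. Uniqueness of the principal value glues the
  local formulas.\<close>

theorem radial_laplacian_smooth:
  fixes x0 :: "real ^ 'n::finite" and c \<sigma> p \<delta> :: real
  assumes "p > 2" "0 < \<sigma>" "\<sigma> < 1" "m * (p - 1) < \<sigma> * p" "\<bar>\<delta>\<bar> = 1"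
  obtains L where "smooth_on UNIV L" "\<And>x. has_frac_p_laplacian c \<sigma> p (radial \<kappa> \<delta> x0) x (L x)"
proof -
  let ?u = "radial \<kappa> \<delta> x0"
  define N where "N = real CARD('n) + \<sigma> * p"
  have mN: "m * (p - 1) < N - DIM(real ^ 'n)" using assms(4) by (simp add: N_def)
  have Np: "N - DIM(real ^ 'n) < p" using assms(1-3) by (simp add: N_def mult_less_cancel_right2)
  have loc: "\<exists>T L. open T \<and> x \<in> T \<and> smooth_on T L \<and> (\<forall>y\<in>T. has_frac_p_laplacian c \<sigma> p ?u y (L y))" for x
  proof (cases "x = x0")
    case True
    \<comment> \<open>Half the radius of the plateau, so that two steps of length \<open>d\<close>
      from the centre stay inside it.\<close>
    define d where "d = exp (- 1) / (2::real)"
    have d: "d > 0" by (simp add: d_def)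
    have pl: "?u y = ?u x0" if "z \<in> ball x0 d" "norm (z - y) \<le> d" for z y
    proof (rule radial_center)
      have "norm (y - x0) \<le> norm (y - z) + norm (z - x0)" using norm_triangle_ineq[of "y - z" "z - x0"] by simp
      also have "\<dots> \<le> d + d" using that by (simp add: dist_norm norm_minus_commute)
      finally show "norm (y - x0) \<le> exp (- 1)" by (simp add: d_def)
    qed
    have "ball x0 d \<subseteq> ball 0 (norm x0 + d)"
      using norm_triangle_ineq4 by (auto simp: dist_norm) (smt (verit, best) norm_minus_commute norm_triangle_ineq2)
    then have sub: "ball x0 d \<subseteq> ball 0 (norm x0 + d)" .
    have "smooth_on (ball x0 d) (\<lambda>x. c * potential N (\<lambda>y. spow p (?u x0 - ?u y)) x)"
      unfolding N_def by (rule radial_laplacian_plateau(1)[OF assms(1,2,4,5) open_ball sub d]) (rule pl)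
    moreover have "has_frac_p_laplacian c \<sigma> p ?u x (c * potential N (\<lambda>y. spow p (?u x0 - ?u y)) x)" if "x \<in> ball x0 d" for x
      unfolding N_def by (rule radial_laplacian_plateau(2)[OF assms(1,2,4,5) open_ball sub d _ that]) (rule pl)
    ultimately show ?thesis
      using d True by (intro exI[of _ "ball x0 d"]) auto
  next
    case False
    define R where "R = norm (x - x0) + 1"
    \<comment> \<open>One \<open>B\<close> has to serve the whole neighbourhood \<open>T\<close>, as
      it occurs in the local formula; the bound \<open>R\<close> on the distance to the centre
      provides it.\<close>
    define B where "B = max 1 (ln R + 1)"
    define T where "T = - {x0} \<inter> ball x0 R"
    have T: "open T" "x \<in> T" using False by (auto simp: T_def R_def dist_norm norm_minus_commute)
    define e :: "real ^ 'n" where "e = axis undefined 1"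
    have e: "norm e = 1" by (simp add: e_def)
    let ?G = "\<lambda>a. \<integral>h. norm h powr (- N) * (jump p B a (e + h) + jump p B a (e - h)) \<partial>lborel"
    let ?L = "\<lambda>y. (- c * \<delta> / 2) * norm (y - x0) powr (- (\<sigma> * p)) * ?G (ln (norm (y - x0)))"
    have B: "B \<ge> 1" by (simp add: B_def)
    have nT: "smooth_on T (\<lambda>y. norm (y - x0))" by (rule smooth_on_norm[OF T(1)]) (auto simp: T_def)
    have "smooth_on T ?L"
      by (intro smooth_on_mult smooth_on_const T(1) smooth_on_compose[OF T(1) smooth_on_powr_real nT]
          smooth_on_compose[OF T(1) jump_pair_smooth(2)[OF assms(1) mN Np B e]] smooth_on_compose[OF T(1) smooth_on_ln nT])
        (auto simp: T_def)
    moreover have "has_frac_p_laplacian c \<sigma> p ?u y (?L y)" if y: "y \<in> T" for y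
    proof -
      have yx: "y \<noteq> x0" "norm (y - x0) < R" using y by (auto simp: T_def dist_norm norm_minus_commute)
      then have "ln (norm (y - x0)) \<le> ln R" by (subst ln_le_cancel_iff) (auto intro: le_less_trans[OF norm_ge_zero])
      then have "ln (norm (y - x0)) - B \<le> - 1" by (simp add: B_def)
      from radial_laplacian_off_center[OF assms(1-4) e yx(1) assms(5) B this, of c \<kappa>]
      show ?thesis by (simp add: N_def)
    qed
    ultimately show ?thesis using T by (intro exI[of _ T] exI[of _ ?L]) simp
  qed
  define L where "L x = (SOME l. has_frac_p_laplacian c \<sigma> p ?u x l)" for x
  have L: "has_frac_p_laplacian c \<sigma> p ?u x (L x)" for x
  proof -
    have "\<exists>l. has_frac_p_laplacian c \<sigma> p ?u x l" using loc[of x] by blast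
    then show ?thesis unfolding L_def by (rule someI_ex)
  qed
  have "smooth_on UNIV L"
  proof (rule smooth_on_local)
    fix x
    obtain T L' where T: "open T" "x \<in> T" "smooth_on T L'" "\<And>y. y \<in> T \<Longrightarrow> has_frac_p_laplacian c \<sigma> p ?u y (L' y)"
      using loc[of x] by blast
    have "L y = L' y" if "y \<in> T" for y by (rule has_frac_p_laplacian_unique[OF L T(4)[OF that]])
    then have "smooth_on T L" using smooth_on_cong[OF T(1), of L L'] T(3) by simp
    then show "\<exists>T. x \<in> T \<and> smooth_on T L" using T(2) by blast
  qed
  then show ?thesis using L that by blast
qed

end

section \<open>The profiles\<close>

lemma DERIV_shift_const:
  assumes "(f has_real_derivative D) (at (t - a))"
  shows "((\<lambda>t. f (t - a)) has_real_derivative D) (at t)"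
proof -
  have "((\<lambda>t. t - a) has_real_derivative 1) (at t)" by (auto intro!: derivative_eq_intros)
  from DERIV_chain2[OF assms this] show ?thesis by simp
qed

text \<open>Left unnormalised: the final value is \<open>step 1\<close>, which is positive. The
  lower limit lies to the left of the support of \<open>bump\<close>, so every
  \<open>t \<ge> 0\<close> is interior to \<open>{-1..t+1}\<close> and the integral can be
  differentiated there.\<close>

definition step :: "real \<Rightarrow> real" where
  "step t = integral {-1..t} bump"

lemma step_eq_0: "t \<le> 0 \<Longrightarrow> step t = 0"
proof -
  assume "t \<le> 0"
  then have "step t = integral {-1..t} (\<lambda>_. 0)"
    unfolding step_def by (intro Henstock_Kurzweil_Integration.integral_cong bump_zero) auto
  then show ?thesis by simp
qed

lemma step_deriv: "(step has_real_derivative bump t) (at t)"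
proof (cases "t < 0")
  case True
  have "((\<lambda>_. 0) has_real_derivative 0) (at t)" by simp
  then have "(step has_real_derivative 0) (at t)"
    by (rule has_field_derivative_transform_within_open[of _ _ _ "{..<0}"]) (use True step_eq_0 in auto)
  then show ?thesis using True by (simp add: bump_zero)
next
  case False
  have "((\<lambda>x. integral {-1..x} bump) has_real_derivative bump t) (at t within {-1..t+1})"
    by (rule integral_has_real_derivative) (use False continuous_on_bump in auto)
  moreover have "at t within {-1..t+1} = at t" by (rule at_within_interior) (use False in auto)
  ultimately show ?thesis by (simp add: step_def[abs_def])
qed

lemma step_mono: "x \<le> y \<Longrightarrow> step x \<le> step y"
  using DERIV_nonneg_imp_nondecreasing[of x y step] step_deriv bump_nonneg by blast

lemma step_nonneg: "step t \<ge> 0"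
  using step_mono[of 0 t] step_mono[of t 0] step_eq_0[of 0] step_eq_0[of t] by (cases "t \<le> 0") auto

lemma step_eq: "t \<ge> 1 \<Longrightarrow> step t = step 1"
proof -
  assume t: "t \<ge> 1"
  have "step t \<le> step 1"
  proof (rule DERIV_nonpos_imp_nonincreasing[OF t])
    fix x :: real assume "1 \<le> x"
    then show "\<exists>y. (step has_real_derivative y) (at x) \<and> y \<le> 0"
      using step_deriv[of x] bump_zero[of x] by auto
  qed
  then show ?thesis using step_mono[OF t] by simp
qed

lemma step_le: "step t \<le> step 1"
  using step_mono[of t 1] step_eq[of t] by (cases "t \<le> 1") auto

lemma step_1_pos: "step 1 > 0"
proof -
  have "step (1/4) < step (3/4)"
  proof (rule DERIV_pos_imp_increasing[where f = step])
    fix x :: real assume "1/4 \<le> x" "x \<le> 3/4"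
    then show "\<exists>y. (step has_real_derivative y) (at x) \<and> 0 < y"
      using step_deriv[of x] bump_pos[of x] by (intro exI[of _ "bump x"]) auto
  qed simp
  then show ?thesis using step_nonneg[of "1/4"] step_mono[of "3/4" 1] by linarith
qed

lemma step_pos: "t > 0 \<Longrightarrow> step t > 0"
proof (cases "t \<ge> 1")
  case False
  assume t: "t > 0"
  have "step (t/2) < step t"
  proof (rule DERIV_pos_imp_increasing[where f = step])
    fix x :: real assume "t/2 \<le> x" "x \<le> t"
    then show "\<exists>y. (step has_real_derivative y) (at x) \<and> 0 < y"
      using step_deriv[of x] bump_pos[of x] t False by (intro exI[of _ "bump x"]) auto
  qed (use t in simp)
  then show ?thesis using step_nonneg[of "t/2"] by linarith
qed (use step_eq[of t] step_1_pos in simp)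

lemma continuous_on_step: "continuous_on S step"
  using step_deriv by (meson DERIV_isCont continuous_at_imp_continuous_on)

text \<open>For positive \<open>t\<close> this is t exp (-1/t): it leaves 0 with infinite order and
  approaches \<open>t - 1\<close>. Inside an exponential it joins a constant smoothly to a power of
  the distance.\<close>

definition ramp :: "real \<Rightarrow> real" where
  "ramp t = t * flat 0 t"

lemma ramp_deriv: "(ramp has_real_derivative (flat 0 t + flat 1 t)) (at t)"
proof -
  have "flat (0 + 2) t * t = flat 1 t" by (simp add: flat_def power2_eq_square)
  then show ?thesis
    unfolding ramp_def using DERIV_mult[OF DERIV_ident flat_deriv[of 0 t]] by (simp add: add.commute)
qed

lemma ramp_bounds: "0 \<le> ramp t" "ramp t \<le> max 0 t" "t \<le> 0 \<Longrightarrow> ramp t = 0"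
proof -
  have "t * flat 0 t \<le> t * 1" if "t > 0" using that by (intro mult_left_mono) (auto simp: flat_def)
  then show "0 \<le> ramp t" "ramp t \<le> max 0 t" "t \<le> 0 \<Longrightarrow> ramp t = 0"
    by (auto simp: ramp_def flat_def max_def)
qed

lemma ramp_asymp: "((\<lambda>t. ramp t - t) \<longlongrightarrow> - 1) at_top"
proof -
  have "((\<lambda>t::real. t * exp (- 1 / t) - t) \<longlongrightarrow> - 1) at_top" by real_asymp
  moreover have "\<forall>\<^sub>F t in at_top. t * exp (- 1 / t) - t = ramp t - t"
    using eventually_gt_at_top[of 0] by eventually_elim (simp add: ramp_def flat_def)
  ultimately show ?thesis by (rule Lim_transform_eventually)
qed

section \<open>Functions comparable with all of their derivatives\<close>

text \<open>Comparability and boundedness together, as the locale asks of a weight on each right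
  half-line. Closure under sums and products lets weights be assembled from bumps, flat functions
  and exponentials.\<close>

definition tame :: "real set \<Rightarrow> (real \<Rightarrow> real) \<Rightarrow> bool" where
  "tame S f \<longleftrightarrow> (\<exists>K. \<forall>x\<in>S. 0 \<le> f x \<and> f x \<le> K) \<and> (\<forall>n. dbd n S {()} (powers (\<lambda>_. f) 1) (\<lambda>_. f))"

lemma tame_mult:
  assumes "open S" "tame S f" "tame S g"
  shows "tame S (\<lambda>x. f x * g x)"
proof -
  obtain K K' where K: "\<And>x. x \<in> S \<Longrightarrow> 0 \<le> f x \<and> f x \<le> K" "\<And>x. x \<in> S \<Longrightarrow> 0 \<le> g x \<and> g x \<le> K'"
    using assms(2,3) unfolding tame_def by metis
  have "0 \<le> f x * g x \<and> f x * g x \<le> K * K'" if "x \<in> S" for x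
    using K(1)[OF that] K(2)[OF that] by (auto intro!: mult_mono)
  moreover have "dbd n S {()} (powers (\<lambda>_ x. f x * g x) 1) (\<lambda>_ x. f x * g x)" for n
    using assms K by (intro dbd_powers_mult_weight) (auto simp: tame_def)
  ultimately show ?thesis unfolding tame_def by blast
qed

text \<open>Nonnegativity is decisive: each summand is at most the sum, so its powers are controlled
  by powers of the sum.\<close>

lemma tame_add:
  assumes "open S" "tame S f" "tame S g"
  shows "tame S (\<lambda>x. f x + g x)"
proof -
  obtain K K' where K: "\<And>x. x \<in> S \<Longrightarrow> 0 \<le> f x \<and> f x \<le> K" "\<And>x. x \<in> S \<Longrightarrow> 0 \<le> g x \<and> g x \<le> K'"
    using assms(2,3) unfolding tame_def by metis
  have "0 \<le> f x + g x \<and> f x + g x \<le> K + K'" if "x \<in> S" for x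
    using K(1)[OF that] K(2)[OF that] by auto
  moreover have "dbd n S {()} (powers (\<lambda>_ x. f x + g x) 1) (\<lambda>_ x. f x + g x)" for n
  proof (rule dbd_add[OF assms(1)])
    show "dbd n S {()} (powers (\<lambda>_ x. f x + g x) 1) (\<lambda>_ x. f x)"
      by (rule dbd_powers_le[where w = "\<lambda>_. f"]) (use assms(2) K in \<open>auto simp: tame_def\<close>)
    show "dbd n S {()} (powers (\<lambda>_ x. f x + g x) 1) (\<lambda>_ x. g x)"
      by (rule dbd_powers_le[where w = "\<lambda>_. g"]) (use assms(3) K in \<open>auto simp: tame_def\<close>)
  qed
  ultimately show ?thesis unfolding tame_def by blast
qed

lemma tame_const:
  assumes "open S" "c \<ge> 0"
  shows "tame S (\<lambda>_. c)"
proof -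
  have "dbd n S {()} (powers (\<lambda>_ _. c) 1) (\<lambda>_ _. c)" for n
  proof (rule dbd_powers_self_bounded)
    show "dbd n S {()} {\<lambda>_ _. c} (\<lambda>_ _. c)"
      using assms by (intro dbd_param_const bounded_by_singleI[of _ _ _ 1]) auto
  qed (use assms in auto)
  then show ?thesis using assms unfolding tame_def by auto
qed

lemma tame_exp:
  assumes "open S" "\<And>x. x \<in> S \<Longrightarrow> (\<zeta> has_real_derivative \<zeta>' x) (at x)"
    and "\<And>n. dbd n S {()} {\<lambda>_ _. 1} (\<lambda>_. \<zeta>')" "\<And>x. x \<in> S \<Longrightarrow> \<zeta> x \<le> K"
  shows "tame S (\<lambda>x. exp (\<zeta> x))"
proof -
  have "dbd n S {()} (powers (\<lambda>_ x. exp (\<zeta> x)) 1) (\<lambda>_ x. exp (\<zeta> x))" for n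
  proof (rule dbd_powers_self_bounded)
    show "dbd n S {()} {\<lambda>_ x. exp (\<zeta> x)} (\<lambda>_ x. exp (\<zeta> x))"
    proof (rule dbd_exp[where G = "\<lambda>_ x v. v * \<zeta>' x", OF assms(1)])
      show "(\<zeta> has_derivative (\<lambda>v. v * \<zeta>' x)) (at x)" if "x \<in> S" for x
        using assms(2)[OF that] by (simp add: has_field_derivative_def mult_commute_abs)
      show "dbd n S {()} {\<lambda>_ _. 1} (\<lambda>_ x. i * \<zeta>' x)" for n and i :: real
        by (rule dbd_param_mult[OF assms(1) order_refl assms(3)])
    qed
  qed (use assms(4) in auto)
  moreover have "\<forall>x\<in>S. 0 \<le> exp (\<zeta> x) \<and> exp (\<zeta> x) \<le> exp K" using assms(4) by auto
  ultimately show ?thesis unfolding tame_def by blast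
qed

lemma tame_shift:
  assumes "tame UNIV f" "open S"
  shows "tame S (\<lambda>x. f (x - a))"
proof -
  have "dbd n S {()} (powers (\<lambda>_ x. f (x + (- a))) 1) (\<lambda>_ x. f (x + (- a)))" for n
    using assms by (intro dbd_affine_powers[where l = "\<lambda>_ x. x" and c = "\<lambda>_. - a" and T = UNIV])
      (auto simp: tame_def bounded_linear_ident)
  then show ?thesis using assms(1) unfolding tame_def by auto
qed

lemma tame_bump: "tame UNIV bump"
  unfolding tame_def using dbd_bump bump_nonneg bump_le by auto

lemma flat_le_fact: "flat k t \<le> fact k"
proof -
  have "flat k t \<le> fact k / 1 ^ k * flat 0 t powr (1 - 1)" by (rule flat_le) simp
  also have "\<dots> \<le> fact k" by (simp add: powr_def)
  finally show ?thesis .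
qed

lemma tame_ramp_deriv: "tame UNIV (\<lambda>t. flat 0 t + flat 1 t)"
proof -
  have "dbd n UNIV {()} (powers (\<lambda>_ t. flat 0 t + flat 1 t) 1) (\<lambda>_ t. flat 0 t + flat 1 t)" for n
    by (intro dbd_add dbd_powers_le[OF dbd_flat]) (auto simp: flat_nonneg)
  moreover have "0 \<le> flat 0 t + flat 1 t \<and> flat 0 t + flat 1 t \<le> 2" for t
    using flat_le_fact[of 0 t] flat_le_fact[of 1 t] flat_nonneg[of 0 t] flat_nonneg[of 1 t] by simp
  ultimately show ?thesis unfolding tame_def by blast
qed

lemma tame_bounded_derivs:
  assumes "tame S f"
  shows "dbd n S {()} {\<lambda>_ _. 1} (\<lambda>_. f)"
proof -
  obtain K where K: "\<And>x. x \<in> S \<Longrightarrow> 0 \<le> f x \<and> f x \<le> K" using assms unfolding tame_def by metis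
  have d: "dbd n S {()} (powers (\<lambda>_. f) 1) (\<lambda>_. f)" using assms unfolding tame_def by blast
  show ?thesis
  proof (rule dbd_weaken[OF order_refl order_refl _ d])
    fix \<beta> :: "unit \<Rightarrow> real \<Rightarrow> real" assume \<beta>: "\<beta> \<in> {\<lambda>_ _. 1}"
    have 1: "(\<lambda>_ x. f x powr (1 - 1/2)) \<in> powers (\<lambda>_::unit. f) 1"
      unfolding powers_def by (rule image_eqI[of _ _ "1/2"]) auto
    have "f x powr (1 - 1/2) \<le> K powr (1 - 1/2) * \<beta> () x" if "x \<in> S" for x
      using K[OF that] \<beta> by (auto intro!: powr_mono2)
    then show "\<exists>\<beta>'\<in>powers (\<lambda>_. f) 1. \<exists>C\<ge>0. \<forall>y\<in>{()}. \<forall>x\<in>S. \<beta>' y x \<le> C * \<beta> y x"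
      by (intro bexI[OF _ 1] exI[of _ "K powr (1 - 1/2)"]) auto
  qed
qed

section \<open>Profiles with a prescribed power tail\<close>

text \<open>With \<open>t\<close> the logarithm of the distance, \<open>exp (- s * t)\<close> is a
  power of the distance. The term \<open>a + 1 + ramp (t - a)\<close> is constant up to
  \<open>a\<close> and asymptotic to \<open>t\<close>, the 1 compensating the limit of
  \<open>ramp t - t\<close>. The factor \<open>- sgn s\<close> makes the profile increasing for
  either sign of \<open>s\<close>. The \<open>M\<close> term adjusts the height at the start of the
  tail, and the last term is the perturbation.\<close>

definition tail_profile :: "real \<Rightarrow> real \<Rightarrow> real \<Rightarrow> real \<Rightarrow> real \<Rightarrow> real \<Rightarrow> real" where
  "tail_profile s a M \<alpha> \<epsilon> t =
    - sgn s * exp (- s * (a + 1 + ramp (t - a))) + M * step (t - a) + \<epsilon> * step (t - \<alpha>)"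

text \<open>The derivative of \<open>tail_profile\<close> divided by
  \<open>exp (m * t)\<close>.\<close>

definition tail_weight :: "real \<Rightarrow> real \<Rightarrow> real \<Rightarrow> real \<Rightarrow> real \<Rightarrow> real \<Rightarrow> real \<Rightarrow> real" where
  "tail_weight m s a M \<alpha> \<epsilon> t =
    \<bar>s\<bar> * (exp (- s * (a + 1 + ramp (t - a)) - m * t) * (flat 0 (t - a) + flat 1 (t - a))) +
    exp (- m * t) * (M * bump (t - a) + \<epsilon> * bump (t - \<alpha>))"

text \<open>A decaying tail has \<open>m = 0\<close>. A growing one has \<open>m = - s\<close>, and
  then \<open>exp (- m * t)\<close> balances the exponential because \<open>ramp (t - a)\<close> is
  at most \<open>max 0 (t - a)\<close>.\<close>

lemma profile_tail:
  assumes "s \<noteq> 0" "m = max 0 (- s)" "a \<ge> -1" "\<alpha> \<ge> -1" "M \<ge> 0" "\<epsilon> \<ge> 0"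
  shows "profile (tail_weight m s a M \<alpha> \<epsilon>) (tail_profile s a M \<alpha> \<epsilon>) m"
proof -
  have tame: "tame {- A<..} (tail_weight m s a M \<alpha> \<epsilon>)" for A
  proof -
    have op: "open {- A<..}" by simp
    have ramp': "((\<lambda>t. ramp (t - a)) has_real_derivative (flat 0 (t - a) + flat 1 (t - a))) (at t)" for t
      by (rule DERIV_shift_const[OF ramp_deriv])
    have tr: "tame {- A<..} (\<lambda>t. flat 0 (t - a) + flat 1 (t - a))"
      by (rule tame_shift[OF tame_ramp_deriv op])
    have const: "dbd n {- A<..} {()} {\<lambda>_ _. 1} (\<lambda>_ _. c)" for n c
      by (rule dbd_param_const) (auto intro: bounded_by_singleI[of _ _ _ "\<bar>c\<bar>"])
    have 1: "tame {- A<..} (\<lambda>t. exp (- s * (a + 1 + ramp (t - a)) - m * t))"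
    proof (rule tame_exp[OF op, where \<zeta>' = "\<lambda>t. (- s) * (flat 0 (t - a) + flat 1 (t - a)) + (- m)"])
      show "((\<lambda>t. - s * (a + 1 + ramp (t - a)) - m * t) has_real_derivative (- s) * (flat 0 (t - a) + flat 1 (t - a)) + (- m)) (at t)" for t
        by (auto intro!: derivative_eq_intros ramp')
      show "dbd n {- A<..} {()} {\<lambda>_ _. 1} (\<lambda>_ t. (- s) * (flat 0 (t - a) + flat 1 (t - a)) + (- m))" for n
        by (rule dbd_add[OF op dbd_param_mult[OF op order_refl tame_bounded_derivs[OF tr]] const])
      show "- s * (a + 1 + ramp (t - a)) - m * t \<le> m * (1 + \<bar>A\<bar> + \<bar>a\<bar>)" if "t \<in> {- A<..}" for t
      proof (cases "s > 0")
        case True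
        then have "s * (a + 1 + ramp (t - a)) \<ge> 0" using ramp_bounds(1)[of "t - a"] assms(3) by simp
        then show ?thesis using True assms(2) by simp
      next
        case False
        then have m: "m = - s" "m \<ge> 0" using assms(2) by auto
        have "a + 1 + ramp (t - a) - t \<le> 1 + \<bar>A\<bar> + \<bar>a\<bar>"
          using ramp_bounds(2)[of "t - a"] that by (auto simp: max_def split: if_splits)
        then have "m * (a + 1 + ramp (t - a) - t) \<le> m * (1 + \<bar>A\<bar> + \<bar>a\<bar>)" using m by (intro mult_left_mono)
        then show ?thesis using m by (simp add: algebra_simps)
      qed
    qed
    have 2: "tame {- A<..} (\<lambda>t. exp (- m * t))"
    proof (rule tame_exp[OF op _ const, where K = "m * \<bar>A\<bar>"])
      show "((*) (- m) has_real_derivative - m) (at t)" for t by (auto intro!: derivative_eq_intros)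
      show "- m * t \<le> m * \<bar>A\<bar>" if "t \<in> {- A<..}" for t
        using mult_left_mono[of "- t" "\<bar>A\<bar>" m] that assms(2) by auto
    qed
    show ?thesis
      unfolding tail_weight_def
    proof (rule tame_add[OF op])
      show "tame {- A<..} (\<lambda>t. \<bar>s\<bar> * (exp (- s * (a + 1 + ramp (t - a)) - m * t) * (flat 0 (t - a) + flat 1 (t - a))))"
        by (intro tame_mult tame_const op 1 tr) simp
      show "tame {- A<..} (\<lambda>t. exp (- m * t) * (M * bump (t - a) + \<epsilon> * bump (t - \<alpha>)))"
        using assms by (intro tame_mult tame_add tame_const op 2 tame_shift[OF tame_bump op])
    qed
  qed
  show ?thesis
  proof
    show "0 \<le> m" using assms(2) by simp
    show "(tail_profile s a M \<alpha> \<epsilon> has_real_derivative exp (m * t) * tail_weight m s a M \<alpha> \<epsilon> t) (at t)" for t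
    proof -
      have d1: "((\<lambda>t. ramp (t - a)) has_real_derivative (flat 0 (t - a) + flat 1 (t - a))) (at t)"
        by (rule DERIV_shift_const[OF ramp_deriv])
      have d2: "((\<lambda>t. step (t - b)) has_real_derivative bump (t - b)) (at t)" for b
        by (rule DERIV_shift_const[OF step_deriv])
      have "(tail_profile s a M \<alpha> \<epsilon> has_real_derivative
          - sgn s * (exp (- s * (a + 1 + ramp (t - a))) * (- s * (flat 0 (t - a) + flat 1 (t - a)))) + M * bump (t - a) + \<epsilon> * bump (t - \<alpha>)) (at t)"
        unfolding tail_profile_def by (auto intro!: derivative_eq_intros d1 d2)
      also have "- sgn s * (exp (- s * (a + 1 + ramp (t - a))) * (- s * (flat 0 (t - a) + flat 1 (t - a)))) + M * bump (t - a) + \<epsilon> * bump (t - \<alpha>)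
        = exp (m * t) * tail_weight m s a M \<alpha> \<epsilon> t"
      proof -
        have "exp (- s * (a + 1 + ramp (t - a)) - m * t) = exp (- s * (a + 1 + ramp (t - a))) * exp (- m * t)"
          by (simp add: exp_add[symmetric])
        moreover have "exp (m * t) * exp (- m * t) = 1" by (simp add: exp_add[symmetric])
        ultimately have "exp (m * t) * tail_weight m s a M \<alpha> \<epsilon> t = 
          \<bar>s\<bar> * exp (- s * (a + 1 + ramp (t - a))) * (flat 0 (t - a) + flat 1 (t - a)) + (M * bump (t - a) + \<epsilon> * bump (t - \<alpha>))"
          unfolding tail_weight_def by algebra
        moreover have "\<bar>s\<bar> = sgn s * s" by (simp add: abs_sgn mult.commute)
        ultimately show ?thesis by (simp add: algebra_simps)
      qed
      finally show ?thesis .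
    qed
    show "0 \<le> tail_weight m s a M \<alpha> \<epsilon> t" for t
      using tame[of "1 - t"] unfolding tame_def by auto
    show "tail_weight m s a M \<alpha> \<epsilon> t = 0" if "t \<le> - 1" for t
      using that assms by (simp add: tail_weight_def flat_def bump_zero)
    show "\<exists>K. \<forall>t>- A. tail_weight m s a M \<alpha> \<epsilon> t \<le> K" for A
      using tame[of A] unfolding tame_def by auto
    show "dbd n {- A<..} {()} (powers (\<lambda>_. tail_weight m s a M \<alpha> \<epsilon>) 1) (\<lambda>_. tail_weight m s a M \<alpha> \<epsilon>)" for A n
      using tame[of A] unfolding tame_def by auto
  qed
qed

lemma integral_tail_small:
  fixes g :: "'a::euclidean_space \<Rightarrow> real"
  assumes g: "integrable lborel g" "\<And>y. g y \<ge> 0" and "\<eta> > 0"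
  obtains a where "a \<ge> b" "(\<integral>y. indicator {y. norm (y - x0) > exp a} y * g y \<partial>lborel) \<le> \<eta>"
proof -
  have "(\<lambda>n. \<integral>y. indicator {y. norm (y - x0) > exp (real n)} y * g y \<partial>lborel) \<longlonglongrightarrow> (\<integral>y. (0::real) \<partial>(lborel :: 'a measure))"
  proof (rule integral_dominated_convergence[where w = g])
    show "AE y in lborel. (\<lambda>n. indicator {y. norm (y - x0) > exp (real n)} y * g y) \<longlonglongrightarrow> 0"
    proof (rule AE_I2)
      fix y
      have "\<forall>\<^sub>F n in sequentially. norm (y - x0) \<le> exp (real n)"
        using filterlim_compose[OF exp_at_top filterlim_real_sequentially] by (simp add: filterlim_at_top)
      then have "\<forall>\<^sub>F n in sequentially. 0 = indicator {y. norm (y - x0) > exp (real n)} y * g y"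
        by eventually_elim auto
      then show "(\<lambda>n. indicator {y. norm (y - x0) > exp (real n)} y * g y) \<longlonglongrightarrow> 0"
        by (rule Lim_transform_eventually[OF tendsto_const])
    qed
    show "(\<lambda>y. indicator {y. norm (y - x0) > exp (real n)} y * g y) \<in> borel_measurable lborel" for n
      using g(1) by measurable
    show "AE y in lborel. norm (indicator {y. norm (y - x0) > exp (real n)} y * g y) \<le> g y" for n
      using g(2) by (auto simp: indicator_def)
  qed (use g in auto)
  then have "\<forall>\<^sub>F n in sequentially. (\<integral>y. indicator {y. norm (y - x0) > exp (real n)} y * g y \<partial>lborel) < \<eta>"
    using assms(3) by (intro order_tendstoD(2)) auto
  moreover have "\<forall>\<^sub>F n in sequentially. real n \<ge> b"
    using filterlim_real_sequentially by (simp add: filterlim_at_top)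
  ultimately have "\<forall>\<^sub>F n in sequentially. real n \<ge> b \<and> (\<integral>y. indicator {y. norm (y - x0) > exp (real n)} y * g y \<partial>lborel) < \<eta>"
    by eventually_elim simp
  then obtain n where "real n \<ge> b" "(\<integral>y. indicator {y. norm (y - x0) > exp (real n)} y * g y \<partial>lborel) < \<eta>"
    by (auto dest: eventually_happens)
  then show ?thesis using that[of "real n"] by simp
qed

section \<open>Deforming a constant\<close>

text \<open>Any constant \<open>v\<close> on \<open>ball 0 (5/2)\<close> extends to a solution whose operator there is, up to an
  error measured by \<open>\<eta>\<close>, that of the fixed perturbation \<open>\<epsilon> * A\<close>.\<close>

definition deforms ::
  "real \<Rightarrow> real \<Rightarrow> real \<Rightarrow> real \<Rightarrow> (real ^ 'n::finite \<Rightarrow> real) \<Rightarrow> bool" where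
  "deforms c \<sigma> p s A \<longleftrightarrow> (\<forall>v\<ge>2. \<forall>\<epsilon>>0. \<forall>\<eta>>0. \<exists>u L E.
     smooth_on UNIV u \<and> (\<forall>x. u x > 0) \<and> (\<forall>x\<in>ball 0 (5/2). u x = v) \<and>
     ((\<lambda>x. norm x powr s * u x) \<longlongrightarrow> 1) at_infinity \<and>
     smooth_on UNIV L \<and> (\<forall>x. has_frac_p_laplacian c \<sigma> p u x (L x)) \<and>
     E \<in> borel_measurable borel \<and>
     integrable lborel (\<lambda>y. \<bar>E y\<bar> * (1 + norm y) powr (- (real CARD('n) + \<sigma> * p))) \<and>
     (\<integral>y. \<bar>E y\<bar> * (1 + norm y) powr (- (real CARD('n) + \<sigma> * p)) \<partial>lborel) \<le> \<eta> \<and>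
     (\<forall>x\<in>ball 0 (5/2). \<forall>y. E y \<noteq> 0 \<longrightarrow> norm (x - y) > 1/2) \<and>
     (\<forall>x\<in>ball 0 (5/2). L x = c * (potential (real CARD('n) + \<sigma> * p) E x -
        \<epsilon> powr (p - 1) * potential (real CARD('n) + \<sigma> * p) (\<lambda>y. A y powr (p - 1)) x)))"

context profile
begin

text \<open>Moving the centre from the origin to \<open>x0\<close> does not affect the limit, since
  \<open>norm x / norm (x - x0)\<close> tends to 1.\<close>

lemma radial_asymptotics:
  fixes x0 :: "'a::euclidean_space" and s \<kappa> \<delta> :: real
  assumes "((\<lambda>t. exp (s * t) * (\<kappa> + \<delta> * F t)) \<longlongrightarrow> 1) at_top"
  shows "((\<lambda>x. norm x powr s * radial \<kappa> \<delta> x0 x) \<longlongrightarrow> 1) at_infinity"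
proof -
  have n0: "filterlim (\<lambda>x::'a. norm x) at_top at_infinity" by (rule filterlim_norm_at_top)
  have n1: "filterlim (\<lambda>x. norm (x - x0)) at_top at_infinity"
  proof (rule filterlim_at_top_mono)
    show "filterlim (\<lambda>x::'a. - norm x0 + norm x) at_top at_infinity"
      by (rule filterlim_tendsto_add_at_top[OF tendsto_const n0])
    show "\<forall>\<^sub>F x in at_infinity. - norm x0 + norm x \<le> norm (x - x0)"
      using norm_triangle_ineq2[of _ x0] by (intro always_eventually) (auto simp: algebra_simps)
  qed
  have 1: "((\<lambda>x. exp (s * ln (norm (x - x0))) * (\<kappa> + \<delta> * F (ln (norm (x - x0))))) \<longlongrightarrow> 1) at_infinity"
    by (rule filterlim_compose[OF assms filterlim_compose[OF ln_at_top n1]])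
  have inv0: "((\<lambda>x. norm x0 * inverse (norm (x - x0))) \<longlongrightarrow> norm x0 * 0) at_infinity"
    by (intro tendsto_mult tendsto_const filterlim_compose[OF tendsto_inverse_0_at_top n1] filterlim_ident) 
  have "((\<lambda>x. norm x / norm (x - x0) - 1) \<longlongrightarrow> 0) at_infinity"
  proof (rule Lim_null_comparison)
    show "\<forall>\<^sub>F x in at_infinity. norm (norm x / norm (x - x0) - 1) \<le> norm x0 * inverse (norm (x - x0))"
      using filterlim_at_top_dense[THEN iffD1, OF n1, rule_format, of 0]
    proof eventually_elim
      case (elim x)
      have "norm x / norm (x - x0) - 1 = (norm x - norm (x - x0)) / norm (x - x0)" using elim by (simp add: field_simps)
      moreover have "\<bar>norm x - norm (x - x0)\<bar> \<le> norm x0" using norm_triangle_ineq3[of x "x - x0"] by simp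
      ultimately show ?case using elim by (simp add: divide_inverse abs_mult mult_right_mono)
    qed
    show "((\<lambda>x. norm x0 * inverse (norm (x - x0))) \<longlongrightarrow> 0) at_infinity" using inv0 by simp
  qed
  from tendsto_add[OF this tendsto_const[of 1]]
  have "((\<lambda>x. norm x / norm (x - x0)) \<longlongrightarrow> 1) at_infinity" by simp
  from tendsto_powr[OF this tendsto_const[of s]]
  have 2: "((\<lambda>x. (norm x / norm (x - x0)) powr s) \<longlongrightarrow> 1) at_infinity" by simp
  have "((\<lambda>x. (norm x / norm (x - x0)) powr s * (exp (s * ln (norm (x - x0))) * (\<kappa> + \<delta> * F (ln (norm (x - x0)))))) \<longlongrightarrow> 1 * 1) at_infinity"
    by (rule tendsto_mult[OF 2 1])
  moreover have "\<forall>\<^sub>F x in at_infinity. (norm x / norm (x - x0)) powr s * (exp (s * ln (norm (x - x0))) * (\<kappa> + \<delta> * F (ln (norm (x - x0)))))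
      = norm x powr s * radial \<kappa> \<delta> x0 x"
    using filterlim_at_top_dense[THEN iffD1, OF n1, rule_format, of 0]
  proof eventually_elim
    case (elim x)
    have "(norm x / norm (x - x0)) powr s * exp (s * ln (norm (x - x0))) = norm x powr s"
      using elim by (simp add: powr_divide) (simp add: powr_def)
    then show ?case using F_lognorm[of "x - x0"] elim by (simp add: radial_def mult.assoc[symmetric])
  qed
  ultimately show ?thesis by (simp add: Lim_transform_eventually)
qed

text \<open>On the core \<open>u = v + \<epsilon> * A\<close>, so the nonlinearity at
  \<open>v - u\<close> is exactly \<open>- ((\<epsilon> * A) powr (p - 1))\<close>. The error
  \<open>E\<close> is the sum of the true density and of this power; it vanishes on the core, and
  \<open>small\<close> bounds the rest. Linearity of the potential in its density then splits the
  operator.\<close>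

lemma deformation_step:
  fixes x0 :: "real ^ 'n::finite" and A :: "real ^ 'n \<Rightarrow> real" and c \<sigma> p \<kappa> \<delta> v \<epsilon> \<eta> C R K :: real
  assumes p: "p > 2" "0 < \<sigma>" "\<sigma> < 1" "m * (p - 1) < \<sigma> * p" "\<bar>\<delta>\<bar> = 1" and "\<epsilon> > 0"
    and A: "continuous_on UNIV A" "\<And>y. 0 \<le> A y \<and> A y \<le> K"
    and core: "\<And>y. norm (y - x0) \<le> R \<Longrightarrow> radial \<kappa> \<delta> x0 y = v + \<epsilon> * A y"
    and near: "\<And>x y. x \<in> ball 0 (5/2) \<Longrightarrow> norm (x - y) \<le> 1/2 \<Longrightarrow> norm (y - x0) \<le> R \<and> A y = 0"
    and far: "\<And>y. norm (y - x0) > R \<Longrightarrow> \<bar>spow p (v - radial \<kappa> \<delta> x0 y) + (\<epsilon> * A y) powr (p - 1)\<bar> \<le> C * (1 + norm y) powr (m * (p - 1))"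
    and small: "(\<integral>y. indicator {y. norm (y - x0) > R} y * (C * (1 + norm y) powr (m * (p - 1) - (real CARD('n) + \<sigma> * p))) \<partial>lborel) \<le> \<eta>"
    and "C \<ge> 0"
  defines "N \<equiv> real CARD('n) + \<sigma> * p"
  shows "\<exists>L E. smooth_on UNIV L \<and> (\<forall>x. has_frac_p_laplacian c \<sigma> p (radial \<kappa> \<delta> x0) x (L x)) \<and>
     E \<in> borel_measurable borel \<and> integrable lborel (\<lambda>y. \<bar>E y\<bar> * (1 + norm y) powr (- N)) \<and>
     (\<integral>y. \<bar>E y\<bar> * (1 + norm y) powr (- N) \<partial>lborel) \<le> \<eta> \<and>
     (\<forall>x\<in>ball 0 (5/2). \<forall>y. E y \<noteq> 0 \<longrightarrow> norm (x - y) > 1/2) \<and>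
     (\<forall>x\<in>ball 0 (5/2). L x = c * (potential N E x - \<epsilon> powr (p - 1) * potential N (\<lambda>y. A y powr (p - 1)) x))"
proof -
  let ?u = "radial \<kappa> \<delta> x0" and ?S = "ball 0 (5/2) :: (real ^ 'n) set"
  define W where "W y = spow p (v - ?u y)" for y
  define G where "G y = (\<epsilon> * A y) powr (p - 1)" for y
  define E where "E y = W y + G y" for y
  have mN: "m * (p - 1) < N - DIM(real ^ 'n)" using p(4) by (simp add: N_def)
  have N: "N \<ge> 0" using p by (simp add: N_def)
  have near': "?u y = v" if "x \<in> ?S" "norm (x - y) \<le> 1/2" for x y
    using core[of y] near[OF that] by simp
  have E0: "E y = 0" if "norm (y - x0) \<le> R" for y
    using core[OF that] A(2)[of y] \<open>\<epsilon> > 0\<close> spow_minus[of p "\<epsilon> * A y"] by (simp add: E_def W_def G_def spow_nonneg)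
  have G0: "G y = 0" if "x \<in> ?S" "norm (x - y) \<le> 1/2" for x y
    using near[OF that] by (simp add: G_def)
  have GS: "norm (x - y) > 1/2" if "x \<in> ?S" "G y \<noteq> 0" for x y using G0 that by force
  have ES: "norm (x - y) > 1/2" if "x \<in> ?S" "E y \<noteq> 0" for x y using E0 near that by (metis not_less)
  have Wm: "W \<in> borel_measurable borel" "integrable lborel (\<lambda>y. \<bar>W y\<bar> * (1 + norm y) powr (- N))"
    unfolding W_def by (rule radial_integrable[OF p(1,5) mN])+
  have Am [measurable]: "A \<in> borel_measurable borel" using A(1) by (rule borel_measurable_continuous_onI)
  have Gm: "G \<in> borel_measurable borel" unfolding G_def[abs_def] by measurable
  have Gi: "integrable lborel (\<lambda>y. \<bar>G y\<bar> * (1 + norm y) powr (- N))"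
  proof (rule Bochner_Integration.integrable_bound)
    show "integrable lborel (\<lambda>y::real^'n. (\<epsilon> * K) powr (p - 1) * (1 + norm y) powr (- N))"
      using p by (intro integrable_mult_right integrable_one_plus_norm_powr) (simp add: N_def)
    show "AE y in lborel. norm (\<bar>G y\<bar> * (1 + norm y) powr (- N)) \<le> norm ((\<epsilon> * K) powr (p - 1) * (1 + norm y) powr (- N))"
      using A(2) \<open>\<epsilon> > 0\<close> p(1) by (intro AE_I2) (auto simp: G_def abs_mult intro!: mult_right_mono powr_mono2 mult_left_mono)
    show "(\<lambda>y. \<bar>G y\<bar> * (1 + norm y) powr (- N)) \<in> borel_measurable lborel" using Gm by measurable
  qed
  have Em: "E \<in> borel_measurable borel" unfolding E_def[abs_def] using Wm(1) Gm by measurable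
  let ?g = "\<lambda>y. indicator {y. norm (y - x0) > R} y * (C * (1 + norm y) powr (m * (p - 1) - N))"
  have gi: "integrable lborel ?g"
  proof -
    have i: "integrable lborel (\<lambda>y::real^'n. C * (1 + norm y) powr (m * (p - 1) - N))"
      using mN by (intro integrable_mult_right integrable_one_plus_norm_powr) simp
    have "{y. norm (y - x0) > R} \<in> sets lborel" by measurable
    from integrable_mult_indicator[OF this i] show ?thesis by simp
  qed
  have Eg: "\<bar>E y\<bar> * (1 + norm y) powr (- N) \<le> ?g y" for y
  proof (cases "norm (y - x0) > R")
    case True
    have "\<bar>E y\<bar> * (1 + norm y) powr (- N) \<le> (C * (1 + norm y) powr (m * (p - 1))) * (1 + norm y) powr (- N)"
      using far[OF True] by (intro mult_right_mono) (auto simp: E_def W_def G_def)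
    also have "\<dots> = ?g y" using True by (simp add: mult.assoc powr_add[symmetric])
    finally show ?thesis .
  qed (use E0 in simp)
  have Ei: "integrable lborel (\<lambda>y. \<bar>E y\<bar> * (1 + norm y) powr (- N))"
    by (rule Bochner_Integration.integrable_bound[OF gi])
      (use Em in measurable, use Eg in \<open>auto intro!: AE_I2 intro: order_trans[OF _ abs_ge_self]\<close>)
  have "(\<integral>y. \<bar>E y\<bar> * (1 + norm y) powr (- N) \<partial>lborel) \<le> (\<integral>y. ?g y \<partial>lborel)"
    by (intro integral_mono Ei gi Eg)
  also have "\<dots> \<le> \<eta>" using small by (simp add: N_def)
  finally have E\<eta>: "(\<integral>y. \<bar>E y\<bar> * (1 + norm y) powr (- N) \<partial>lborel) \<le> \<eta>" .
  obtain L where L: "smooth_on UNIV L" "\<And>x. has_frac_p_laplacian c \<sigma> p ?u x (L x)"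
    using radial_laplacian_smooth[OF p(1-5), of c \<kappa> x0] by blast
  have half: "(1/2::real) > 0" by simp
  have "L x = c * (potential N E x - \<epsilon> powr (p - 1) * potential N (\<lambda>y. A y powr (p - 1)) x)" if x: "x \<in> ?S" for x
  proof -
    have "has_frac_p_laplacian c \<sigma> p ?u x (c * potential N W x)"
      unfolding N_def W_def[abs_def]
      by (rule radial_laplacian_plateau(2)[OF p(1,2,4,5) open_ball order_refl half _ x]) (rule near')
    then have "L x = c * potential N W x" by (rule has_frac_p_laplacian_unique[OF L(2)])
    also have "potential N W x = potential N E x - potential N G x"
    proof -
      have "potential N W x = (\<integral>y. E y * norm (x - y) powr (- N) - G y * norm (x - y) powr (- N) \<partial>lborel)"
        unfolding potential_def by (intro Bochner_Integration.integral_cong) (auto simp: E_def left_diff_distrib distrib_right)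
      also have "\<dots> = potential N E x - potential N G x"
        unfolding potential_def
        by (intro Bochner_Integration.integral_diff integrable_potential[OF open_ball order_refl half N _ _ _ x] Em Ei ES Gm Gi GS)
      finally show ?thesis .
    qed
    also have "potential N G x = \<epsilon> powr (p - 1) * potential N (\<lambda>y. A y powr (p - 1)) x"
    proof -
      have "(\<lambda>y. G y * norm (x - y) powr (- N)) = (\<lambda>y. \<epsilon> powr (p - 1) * (A y powr (p - 1) * norm (x - y) powr (- N)))"
        using A(2) \<open>\<epsilon> > 0\<close> by (auto simp: fun_eq_iff G_def powr_mult)
      then show ?thesis unfolding potential_def by simp
    qed
    finally show ?thesis .
  qed
  then show ?thesis using L Em Ei E\<eta> ES by blast
qed

end

section \<open>The two deformations of a constant: decaying and growing tails\<close>

lemma ramp_exp_asymp: "((\<lambda>t. exp (s * (t - (a + 1 + ramp (t - a))))) \<longlongrightarrow> 1) at_top"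
proof -
  have "filterlim (\<lambda>t::real. - a + t) at_top at_top"
    by (rule filterlim_tendsto_add_at_top[OF tendsto_const filterlim_ident])
  then have "((\<lambda>t. ramp (t - a) - (t - a)) \<longlongrightarrow> - 1) at_top"
    using filterlim_compose[OF ramp_asymp, of "\<lambda>t. - a + t"] by simp
  then have "((\<lambda>t. exp (s * (- 1 - (ramp (t - a) - (t - a))))) \<longlongrightarrow> exp (s * (- 1 - - 1))) at_top"
    by (intro tendsto_intros)
  then show ?thesis by (simp add: algebra_simps)
qed

text \<open>These place all points at distance less than 7 from the centre inside the balls of
  radius \<open>exp 3\<close> and \<open>exp 4\<close>.\<close>

lemma exp_four: "exp (3::real) \<ge> 8" "exp (4::real) \<ge> 16"
proof -
  have 1: "exp (1::real) \<ge> 2" using exp_ge_add_one_self[of 1] by simp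
  have "exp (3::real) = exp 1 ^ 3" "exp (4::real) = exp 1 ^ 4" by (simp_all add: exp_of_nat_mult[symmetric])
  then show "exp (3::real) \<ge> 8" "exp (4::real) \<ge> 16" using power_mono[OF 1, of 3] power_mono[OF 1, of 4] by auto
qed

lemma exp_lognorm: "exp (lognorm 1 z) = max (norm z) (exp (- 1))"
  unfolding lognorm_def by (subst exp_ln) (auto simp: less_max_iff_disj)

lemma lognorm_le_iff: "a \<ge> - 1 \<Longrightarrow> lognorm 1 z \<le> a \<longleftrightarrow> norm z \<le> exp a"
  using exp_le_cancel_iff[of "lognorm 1 z" a] by (simp add: exp_lognorm)

text \<open>The two bounds are 4 - 5/2 - 1/2 and 4 + 5/2 + 1/2. Points near
  \<open>ball 0 (5/2)\<close> thus avoid the unit ball about \<open>x0\<close>, which carries the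
  perturbation in the decaying case, and the exterior of the ball of radius \<open>exp 3\<close>,
  which carries it in the growing case.\<close>

lemma center_distance:
  fixes x x0 y :: "'a::real_normed_vector"
  assumes "norm x0 = 4" "x \<in> ball 0 (5/2)" "norm (x - y) \<le> 1/2"
  shows "1 < norm (y - x0)" "norm (y - x0) < 7"
proof -
  have "norm x0 \<le> norm (y - x0) + norm (x - y) + norm x"
    using norm_triangle_ineq[of "y - x0" "x - y"] norm_triangle_ineq2[of x0 x] by (simp add: norm_minus_commute)
  then show "1 < norm (y - x0)" using assms by simp
  have "norm (y - x0) \<le> norm (x - y) + norm x + norm x0"
    using norm_triangle_ineq4[of x "x - y"] norm_triangle_ineq4[of y x0] by simp
  then show "norm (y - x0) < 7" using assms by simp
qed

text \<open>The function decreases away from \<open>x0\<close>: it exceeds \<open>v\<close> inside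
  the unit ball about \<open>x0\<close>, equals \<open>v\<close> from there to the radius
  \<open>exp a\<close>, and then passes into the tail. The perturbation sits at the centre because a
  decreasing function can exceed \<open>v\<close> only there.\<close>

lemma deforms_decay:
  fixes x0 :: "real ^ 'n::finite" and c \<sigma> p s :: real
  assumes p: "p > 2" "0 < \<sigma>" "\<sigma> < 1" and "s \<ge> 0" and x0: "norm x0 = 4"
  shows "deforms c \<sigma> p s (\<lambda>y. step 1 - step (lognorm 1 (y - x0) + 1))"
  unfolding deforms_def
proof (intro allI impI)
  fix v \<epsilon> \<eta> :: real assume v: "v \<ge> 2" "\<epsilon> > 0" "\<eta> > 0"
  let ?N = "real CARD('n) + \<sigma> * p" and ?A = "\<lambda>y. step 1 - step (lognorm 1 (y - x0) + 1)"
  \<comment> \<open>For \<open>s = 0\<close> the tail must tend to the constant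
    \<open>l = 1\<close>, and the rate 1 of this approach is an arbitrary choice.\<close>
  define s1 where "s1 = (if s = 0 then 1 else s)"
  define l :: real where "l = (if s = 0 then 1 else 0)"
  have s1: "s1 > 0" using assms by (simp add: s1_def)
  have l: "0 \<le> l" "l \<le> 1" by (simp_all add: l_def)
  \<comment> \<open>Beyond the core \<open>0 < u \<le> v\<close>, so this bounds the density
    whatever \<open>a\<close> is, and \<open>a\<close> can be chosen afterwards.\<close>
  let ?C = "v powr (p - 1)"
  obtain a where a: "a \<ge> 4" "(\<integral>y. indicator {y. norm (y - x0) > exp a} y * (?C * (1 + norm y) powr (- ?N)) \<partial>lborel) \<le> \<eta>"
  proof (rule integral_tail_small[where b = 4 and ?x0.0 = x0 and \<eta> = \<eta>])
    show "integrable lborel (\<lambda>y::real^'n. ?C * (1 + norm y) powr (- ?N))"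
      using p by (intro integrable_mult_right integrable_one_plus_norm_powr) simp
  qed (use v in auto)
  \<comment> \<open>\<open>M * step 1\<close> is the drop from the level \<open>v\<close> to the
    height \<open>l + exp (- s1 * (a + 1))\<close> at which the tail starts;
    \<open>v \<ge> 2\<close> makes it nonnegative.\<close>
  define M where "M = (v - l - exp (- s1 * (a + 1))) / step 1"
  have "exp (- s1 * (a + 1)) \<le> 1" using s1 a by simp
  then have "0 \<le> v - l - exp (- s1 * (a + 1))" using v l by linarith
  then have M: "M \<ge> 0" "M * step 1 = v - l - exp (- s1 * (a + 1))" using step_1_pos by (simp_all add: M_def)
  define \<kappa> where "\<kappa> = l + M * step 1 + \<epsilon> * step 1"
  interpret profile "tail_weight 0 s1 a M (-1) \<epsilon>" "tail_profile s1 a M (-1) \<epsilon>" 0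
    using s1 a v M by (intro profile_tail) auto
  let ?u = "radial \<kappa> (- 1) x0"
  define U where "U t = l + exp (- s1 * (a + 1 + ramp (t - a))) + M * (step 1 - step (t - a)) + \<epsilon> * (step 1 - step (t + 1))" for t
  have FU: "\<kappa> + (- 1) * tail_profile s1 a M (-1) \<epsilon> t = U t" for t
    using s1 by (simp add: U_def tail_profile_def \<kappa>_def algebra_simps)
  have uU: "?u y = U (lognorm 1 (y - x0))" for y by (simp only: radial_def FU)
  have U_far: "0 < U t \<and> U t \<le> v" if "t \<ge> 0" for t
  proof -
    have "step (t + 1) = step 1" using that by (intro step_eq) simp
    then have "\<epsilon> * (step 1 - step (t + 1)) = 0" by simp
    moreover have "exp (- s1 * (a + 1 + ramp (t - a))) \<le> exp (- s1 * (a + 1))" using ramp_bounds(1) s1 by simp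
    moreover have "M * (step 1 - step (t - a)) \<le> M * step 1" using M(1) step_nonneg by (intro mult_left_mono) auto
    moreover have "0 \<le> M * (step 1 - step (t - a))" using M(1) step_le by simp
    moreover have "exp (- s1 * (a + 1 + ramp (t - a))) > 0" by simp
    ultimately show ?thesis unfolding U_def using l M(2) by (intro conjI) linarith+
  qed
  have core: "?u y = v + \<epsilon> * ?A y" if "norm (y - x0) \<le> exp a" for y
  proof -
    have t: "lognorm 1 (y - x0) - a \<le> 0" using that a lognorm_le_iff[of a "y - x0"] by simp
    show ?thesis unfolding uU U_def using ramp_bounds(3)[OF t] step_eq_0[OF t] M(2) by simp
  qed
  have near: "norm (y - x0) \<le> exp a \<and> ?A y = 0" if "x \<in> ball 0 (5/2)" "norm (x - y) \<le> 1/2" for x y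
  proof -
    note d = center_distance[OF x0 that]
    have "exp 4 \<le> exp a" using a by simp
    then have "norm (y - x0) \<le> exp a" using d(2) exp_four by linarith
    moreover have "lognorm 1 (y - x0) \<ge> 0" 
      unfolding lognorm_def using d(1) by (intro ln_ge_zero) (simp add: le_max_iff_disj)
    then have "step (lognorm 1 (y - x0) + 1) = step 1" by (intro step_eq) simp
    ultimately show ?thesis by simp
  qed
  have far: "\<bar>spow p (v - ?u y) + (\<epsilon> * ?A y) powr (p - 1)\<bar> \<le> ?C * (1 + norm y) powr (0 * (p - 1))"
    if "norm (y - x0) > exp a" for y
  proof -
    have "\<not> lognorm 1 (y - x0) \<le> a" using that a lognorm_le_iff[of a "y - x0"] by simp
    then have t: "lognorm 1 (y - x0) \<ge> 0" using a by simp
    have "step (lognorm 1 (y - x0) + 1) = step 1" using t by (intro step_eq) simp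
    moreover have "\<bar>spow p (v - ?u y)\<bar> \<le> ?C"
      unfolding abs_spow uU using U_far[OF t] p(1) by (intro powr_mono2) auto
    ultimately show ?thesis by (simp add: add_nonneg_eq_0_iff)
  qed
  have small: "(\<integral>y. indicator {y. norm (y - x0) > exp a} y * (?C * (1 + norm y) powr (0 * (p - 1) - ?N)) \<partial>lborel) \<le> \<eta>"
    using a(2) by simp
  have A: "continuous_on UNIV ?A" "\<And>y. 0 \<le> ?A y \<and> ?A y \<le> step 1"
    using step_le step_nonneg
    by (auto intro!: continuous_intros continuous_on_compose2[OF continuous_on_step[of UNIV]] continuous_lognorm)
  have "\<exists>L E. smooth_on UNIV L \<and> (\<forall>x. has_frac_p_laplacian c \<sigma> p ?u x (L x)) \<and>
     E \<in> borel_measurable borel \<and> integrable lborel (\<lambda>y. \<bar>E y\<bar> * (1 + norm y) powr (- ?N)) \<and>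
     (\<integral>y. \<bar>E y\<bar> * (1 + norm y) powr (- ?N) \<partial>lborel) \<le> \<eta> \<and>
     (\<forall>x\<in>ball 0 (5/2). \<forall>y. E y \<noteq> 0 \<longrightarrow> norm (x - y) > 1/2) \<and>
     (\<forall>x\<in>ball 0 (5/2). L x = c * (potential ?N E x - \<epsilon> powr (p - 1) * potential ?N (\<lambda>y. ?A y powr (p - 1)) x))" (is "\<exists>L E. ?P L E")
    by (rule deformation_step[OF p _ _ v(2) A core near far small]) (use p in auto)
  then obtain L E where LE: "?P L E" by blast
  have u1: "smooth_on UNIV ?u" by (rule smooth_radial)
  have u2: "?u y > 0" for y
  proof (cases "norm (y - x0) \<le> exp a")
    case True
    then show ?thesis using core[OF True] A(2)[of y] v by (simp add: add_pos_nonneg)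
  next
    case False
    then have "\<not> lognorm 1 (y - x0) \<le> a" using a lognorm_le_iff[of a "y - x0"] by simp
    then show ?thesis unfolding uU using U_far[of "lognorm 1 (y - x0)"] a by simp
  qed
  have u3: "?u x = v" if "x \<in> ball 0 (5/2)" for x using core[of x] near[OF that, of x] by simp
  have u4: "((\<lambda>x. norm x powr s * ?u x) \<longlongrightarrow> 1) at_infinity"
  proof (rule radial_asymptotics)
    have ev: "\<forall>\<^sub>F t in at_top. exp (s * t) * (l + exp (- s1 * (a + 1 + ramp (t - a)))) = exp (s * t) * U t"
      using eventually_ge_at_top[of "a + 1"]
    proof eventually_elim
      case (elim t)
      then have "step (t - a) = step 1" "step (t + 1) = step 1" using a by (auto intro!: step_eq)
      then show ?case by (simp add: U_def)
    qed
    have "((\<lambda>t. exp (s * t) * (l + exp (- s1 * (a + 1 + ramp (t - a))))) \<longlongrightarrow> 1) at_top"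
    proof (cases "s = 0")
      case False
      then have "exp (s * t) * (l + exp (- s1 * (a + 1 + ramp (t - a)))) = exp (s * (t - (a + 1 + ramp (t - a))))" for t
        by (simp add: l_def s1_def exp_add[symmetric] algebra_simps)
      then show ?thesis using ramp_exp_asymp[of s a] by simp
    next
      case True
      have "((\<lambda>t. 1 + exp (t - (a + 1 + ramp (t - a))) * exp (- t)) \<longlongrightarrow> 1 + 1 * 0) at_top"
        using ramp_exp_asymp[of 1 a]
        by (intro tendsto_add tendsto_mult tendsto_const) (auto intro: filterlim_compose[OF exp_at_bot filterlim_uminus_at_bot_at_top])
      then show ?thesis using True by (simp add: l_def s1_def exp_add[symmetric] algebra_simps)
    qed
    from Lim_transform_eventually[OF this ev]
    show "((\<lambda>t. exp (s * t) * (\<kappa> + (- 1) * tail_profile s1 a M (- 1) \<epsilon> t)) \<longlongrightarrow> 1) at_top" unfolding FU .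
  qed
  show "\<exists>u L E.
     smooth_on UNIV u \<and> (\<forall>x. u x > 0) \<and> (\<forall>x\<in>ball 0 (5/2). u x = v) \<and>
     ((\<lambda>x. norm x powr s * u x) \<longlongrightarrow> 1) at_infinity \<and>
     smooth_on UNIV L \<and> (\<forall>x. has_frac_p_laplacian c \<sigma> p u x (L x)) \<and>
     E \<in> borel_measurable borel \<and> integrable lborel (\<lambda>y. \<bar>E y\<bar> * (1 + norm y) powr (- ?N)) \<and>
     (\<integral>y. \<bar>E y\<bar> * (1 + norm y) powr (- ?N) \<partial>lborel) \<le> \<eta> \<and>
     (\<forall>x\<in>ball 0 (5/2). \<forall>y. E y \<noteq> 0 \<longrightarrow> norm (x - y) > 1/2) \<and>
     (\<forall>x\<in>ball 0 (5/2). L x = c * (potential ?N E x - \<epsilon> powr (p - 1) * potential ?N (\<lambda>y. ?A y powr (p - 1)) x))"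
    by (rule exI[of _ ?u], rule exI[of _ L], rule exI[of _ E]) (use LE u1 u2 u3 u4 in blast)
qed

text \<open>An increasing function can exceed \<open>v\<close> only far out, so the perturbation
  lies outside the ball of radius \<open>exp 3\<close>. The condition on \<open>s\<close> makes the
  power \<open>p - 1\<close> of the tail integrable against the kernel at infinity.\<close>

lemma deforms_growth:
  fixes x0 :: "real ^ 'n::finite" and c \<sigma> p s :: real
  assumes p: "p > 2" "0 < \<sigma>" "\<sigma> < 1" and s: "s < 0" "- s * (p - 1) < \<sigma> * p" and x0: "norm x0 = 4"
  shows "deforms c \<sigma> p s (\<lambda>y. step (lognorm 1 (y - x0) - 3))"
  unfolding deforms_def
proof (intro allI impI)
  fix v \<epsilon> \<eta> :: real assume v: "v \<ge> 2" "\<epsilon> > 0" "\<eta> > 0"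
  let ?N = "real CARD('n) + \<sigma> * p" and ?A = "\<lambda>y. step (lognorm 1 (y - x0) - 3)"
  define m where "m = - s"
  have mp: "m > 0" "m * (p - 1) < \<sigma> * p" using s by (auto simp: m_def)
  \<comment> \<open>\<open>exp m\<close> bounds the tail relative to the power \<open>m\<close> of
    the distance, since \<open>a + 1 + ramp (t - a) \<le> t + 1\<close> for \<open>t > a\<close>;
    the second term bounds the perturbation. In \<open>?C\<close> below, 5 is
    \<open>1 + norm x0\<close>, from the passage to \<open>1 + norm y\<close>, and 2 counts the two
    densities. Nothing here involves \<open>a\<close>.\<close>
  let ?D = "exp m + \<epsilon> * step 1"
  have D: "?D > 0" using v step_1_pos by (intro add_pos_pos) auto
  let ?C = "2 * (?D powr (p - 1) * 5 powr (m * (p - 1)))"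
  obtain a where a: "a \<ge> 4" "(\<integral>y. indicator {y. norm (y - x0) > exp a} y * (?C * (1 + norm y) powr (m * (p - 1) - ?N)) \<partial>lborel) \<le> \<eta>"
  proof (rule integral_tail_small[where b = 4 and ?x0.0 = x0 and \<eta> = \<eta>])
    show "integrable lborel (\<lambda>y::real^'n. ?C * (1 + norm y) powr (m * (p - 1) - ?N))"
      using mp by (intro integrable_mult_right integrable_one_plus_norm_powr) simp
  qed (use v in auto)
  \<comment> \<open>Up to radius \<open>exp a\<close> the tail term has the value
    \<open>exp (m * (a + 1))\<close>; this shift brings it to the level \<open>v\<close>.\<close>
  define \<kappa> where "\<kappa> = v - exp (m * (a + 1))"
  interpret profile "tail_weight m s a 0 3 \<epsilon>" "tail_profile s a 0 3 \<epsilon>" m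
    using s a v mp by (intro profile_tail) (auto simp: m_def)
  let ?u = "radial \<kappa> 1 x0"
  define U where "U t = v + (exp (m * (a + 1 + ramp (t - a))) - exp (m * (a + 1))) + \<epsilon> * step (t - 3)" for t
  have FU: "\<kappa> + 1 * tail_profile s a 0 3 \<epsilon> t = U t" for t
    using s by (simp add: U_def tail_profile_def \<kappa>_def m_def algebra_simps)
  have uU: "?u y = U (lognorm 1 (y - x0))" for y by (simp only: radial_def FU)
  have Uv: "U t \<ge> v" for t
  proof -
    have "exp (m * (a + 1)) \<le> exp (m * (a + 1 + ramp (t - a)))" using ramp_bounds(1)[of "t - a"] mp by simp
    moreover have "0 \<le> \<epsilon> * step (t - 3)" using v step_nonneg by simp
    ultimately show ?thesis unfolding U_def by linarith
  qed
  have core: "?u y = v + \<epsilon> * ?A y" if "norm (y - x0) \<le> exp a" for y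
  proof -
    have t: "lognorm 1 (y - x0) - a \<le> 0" using that a lognorm_le_iff[of a "y - x0"] by simp
    show ?thesis unfolding uU U_def using ramp_bounds(3)[OF t] by simp
  qed
  have near: "norm (y - x0) \<le> exp a \<and> ?A y = 0" if "x \<in> ball 0 (5/2)" "norm (x - y) \<le> 1/2" for x y
  proof -
    note d = center_distance[OF x0 that]
    have "exp 4 \<le> exp a" using a by simp
    then have "norm (y - x0) \<le> exp a" using d(2) exp_four by linarith
    moreover have "norm (y - x0) \<le> exp 3" using d(2) exp_four by linarith
    then have "lognorm 1 (y - x0) \<le> 3" by (simp add: lognorm_le_iff)
    ultimately show ?thesis by (simp add: step_eq_0)
  qed
  have far: "\<bar>spow p (v - ?u y) + (\<epsilon> * ?A y) powr (p - 1)\<bar> \<le> ?C * (1 + norm y) powr (m * (p - 1))"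
    if "norm (y - x0) > exp a" for y
  proof -
    let ?t = "lognorm 1 (y - x0)" and ?z = "1 + norm (y - x0)"
    have t: "?t > a" using that a lognorm_le_iff[of a "y - x0"] by simp
    have "exp (- 1) \<le> exp a" using a by simp
    then have "exp (- 1) \<le> norm (y - x0)" using that by linarith
    then have et: "exp ?t = norm (y - x0)" by (simp add: exp_lognorm)
    have "a + 1 + ramp (?t - a) \<le> ?t + 1" using ramp_bounds(2)[of "?t - a"] t by (simp add: max_def)
    then have "exp (m * (a + 1 + ramp (?t - a))) \<le> exp (m * (?t + 1))" using mp by simp
    also have "\<dots> = exp m * norm (y - x0) powr m"
    proof -
      have "norm (y - x0) powr m = exp (m * ?t)" unfolding et[symmetric] by (simp add: powr_def)
      then show ?thesis by (simp add: exp_add[symmetric] algebra_simps)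
    qed
    also have "\<dots> \<le> exp m * ?z powr m" using mp by (intro mult_left_mono powr_mono2) auto
    finally have 1: "exp (m * (a + 1 + ramp (?t - a))) \<le> exp m * ?z powr m" .
    have z1: "?z powr m \<ge> 1" using mp by (intro ge_one_powr_ge_zero) auto
    have "\<epsilon> * step (?t - 3) \<le> \<epsilon> * step 1" using v step_le by (intro mult_left_mono) auto
    also have "\<dots> \<le> \<epsilon> * step 1 * ?z powr m" using z1 v step_1_pos by simp
    finally have 2: "\<epsilon> * step (?t - 3) \<le> \<epsilon> * step 1 * ?z powr m" .
    have "\<bar>v - ?u y\<bar> = U ?t - v" unfolding uU using Uv[of ?t] by simp
    also have "\<dots> \<le> exp (m * (a + 1 + ramp (?t - a))) + \<epsilon> * step (?t - 3)" by (simp add: U_def)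
    also have "\<dots> \<le> ?D * ?z powr m" using 1 2 by (simp add: distrib_right)
    finally have "\<bar>spow p (v - ?u y)\<bar> \<le> (?D * ?z powr m) powr (p - 1)"
      unfolding abs_spow using p(1) by (intro powr_mono2) auto
    moreover have "\<epsilon> * ?A y \<le> ?D * ?z powr m" using 2 by (simp add: distrib_right add_increasing)
    then have "(\<epsilon> * ?A y) powr (p - 1) \<le> (?D * ?z powr m) powr (p - 1)"
      using p(1) v step_nonneg by (intro powr_mono2) auto
    moreover have "(?D * ?z powr m) powr (p - 1) \<le> ?D powr (p - 1) * 5 powr (m * (p - 1)) * (1 + norm y) powr (m * (p - 1))"
    proof -
      have "?z \<le> 5 * (1 + norm y)" using one_plus_norm_shift[of y x0] x0 by simp
      then have "?z powr (m * (p - 1)) \<le> (5 * (1 + norm y)) powr (m * (p - 1))" using mp p by (intro powr_mono2) auto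
      then have "?D powr (p - 1) * ?z powr (m * (p - 1)) \<le> ?D powr (p - 1) * (5 * (1 + norm y)) powr (m * (p - 1))"
        by (intro mult_left_mono) auto
      moreover have "(5 * (1 + norm y)) powr (m * (p - 1)) = 5 powr (m * (p - 1)) * (1 + norm y) powr (m * (p - 1))"
        by (rule powr_mult)
      ultimately show ?thesis using D by (simp only: powr_mult powr_powr mult.assoc)
    qed
    moreover have "\<bar>spow p (v - ?u y) + (\<epsilon> * ?A y) powr (p - 1)\<bar> \<le> \<bar>spow p (v - ?u y)\<bar> + (\<epsilon> * ?A y) powr (p - 1)"
      using abs_triangle_ineq[of "spow p (v - ?u y)" "(\<epsilon> * ?A y) powr (p - 1)"] by simp
    ultimately show ?thesis by linarith
  qed
  have A: "continuous_on UNIV ?A" "\<And>y. 0 \<le> ?A y \<and> ?A y \<le> step 1"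
    using step_le step_nonneg
    by (auto intro!: continuous_intros continuous_on_compose2[OF continuous_on_step[of UNIV]] continuous_lognorm)
  have "\<exists>L E. smooth_on UNIV L \<and> (\<forall>x. has_frac_p_laplacian c \<sigma> p ?u x (L x)) \<and>
     E \<in> borel_measurable borel \<and> integrable lborel (\<lambda>y. \<bar>E y\<bar> * (1 + norm y) powr (- ?N)) \<and>
     (\<integral>y. \<bar>E y\<bar> * (1 + norm y) powr (- ?N) \<partial>lborel) \<le> \<eta> \<and>
     (\<forall>x\<in>ball 0 (5/2). \<forall>y. E y \<noteq> 0 \<longrightarrow> norm (x - y) > 1/2) \<and>
     (\<forall>x\<in>ball 0 (5/2). L x = c * (potential ?N E x - \<epsilon> powr (p - 1) * potential ?N (\<lambda>y. ?A y powr (p - 1)) x))" (is "\<exists>L E. ?P L E")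
    by (rule deformation_step[OF p mp(2) _ v(2) A core near far a(2)]) auto
  then obtain L E where LE: "?P L E" by blast
  have u1: "smooth_on UNIV ?u" by (rule smooth_radial)
  have u2: "?u y > 0" for y unfolding uU using Uv[of "lognorm 1 (y - x0)"] v by linarith
  have u3: "?u x = v" if "x \<in> ball 0 (5/2)" for x using core[of x] near[OF that, of x] by simp
  have u4: "((\<lambda>x. norm x powr s * ?u x) \<longlongrightarrow> 1) at_infinity"
  proof (rule radial_asymptotics)
    have "((\<lambda>t. exp (s * t)) \<longlongrightarrow> 0) at_top"
    proof -
      have "filterlim (\<lambda>t. s * t) at_bot at_top"
        using s(1) by (simp add: filterlim_tendsto_neg_mult_at_bot[OF tendsto_const _ filterlim_ident])
      then show ?thesis by (rule filterlim_compose[OF exp_at_bot])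
    qed
    then have 1: "((\<lambda>t. exp (s * t) * (v - exp (m * (a + 1)) + \<epsilon> * step 1)) \<longlongrightarrow> 0 * (v - exp (m * (a + 1)) + \<epsilon> * step 1)) at_top"
      by (intro tendsto_mult tendsto_const)
    have 2: "((\<lambda>t. exp (s * (t - (a + 1 + ramp (t - a)))) + exp (s * t) * (v - exp (m * (a + 1)) + \<epsilon> * step 1)) \<longlongrightarrow> 1) at_top"
      using tendsto_add[OF ramp_exp_asymp[of s a] 1] by simp
    have ev: "\<forall>\<^sub>F t in at_top. exp (s * (t - (a + 1 + ramp (t - a)))) + exp (s * t) * (v - exp (m * (a + 1)) + \<epsilon> * step 1) = exp (s * t) * U t"
      using eventually_ge_at_top[of 4]
    proof eventually_elim
      case (elim t)
      then have st: "step (t - 3) = step 1" by (intro step_eq) simp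
      have "exp (s * (t - (a + 1 + ramp (t - a)))) = exp (s * t) * exp (m * (a + 1 + ramp (t - a)))"
        by (simp add: m_def exp_add[symmetric] algebra_simps)
      then show ?case by (simp add: U_def st algebra_simps)
    qed
    from Lim_transform_eventually[OF 2 ev]
    show "((\<lambda>t. exp (s * t) * (\<kappa> + 1 * tail_profile s a 0 3 \<epsilon> t)) \<longlongrightarrow> 1) at_top" unfolding FU .
  qed
  show "\<exists>u L E.
     smooth_on UNIV u \<and> (\<forall>x. u x > 0) \<and> (\<forall>x\<in>ball 0 (5/2). u x = v) \<and>
     ((\<lambda>x. norm x powr s * u x) \<longlongrightarrow> 1) at_infinity \<and>
     smooth_on UNIV L \<and> (\<forall>x. has_frac_p_laplacian c \<sigma> p u x (L x)) \<and>
     E \<in> borel_measurable borel \<and> integrable lborel (\<lambda>y. \<bar>E y\<bar> * (1 + norm y) powr (- ?N)) \<and>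
     (\<integral>y. \<bar>E y\<bar> * (1 + norm y) powr (- ?N) \<partial>lborel) \<le> \<eta> \<and>
     (\<forall>x\<in>ball 0 (5/2). \<forall>y. E y \<noteq> 0 \<longrightarrow> norm (x - y) > 1/2) \<and>
     (\<forall>x\<in>ball 0 (5/2). L x = c * (potential ?N E x - \<epsilon> powr (p - 1) * potential ?N (\<lambda>y. ?A y powr (p - 1)) x))"
    by (rule exI[of _ ?u], rule exI[of _ L], rule exI[of _ E]) (use LE u1 u2 u3 u4 in blast)
qed

section \<open>The potential of a radially monotone density\<close>

lemma integral_pos_continuous:
  fixes g :: "'a::euclidean_space \<Rightarrow> real"
  assumes "integrable lborel g" "\<And>y. g y \<ge> 0" "open U" "z \<in> U" "continuous_on U g" "g z > 0"
  shows "(\<integral>y. g y \<partial>lborel) > 0"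
proof -
  have "isCont g z" using assms(3-5) continuous_on_eq_continuous_at by blast
  then have "(g \<longlongrightarrow> g z) (at z)" by (simp add: isCont_def)
  then have "\<forall>\<^sub>F y in at z. g y > g z / 2" by (rule order_tendstoD) (use assms(6) in simp)
  then obtain r where r: "r > 0" "\<And>y. y \<noteq> z \<Longrightarrow> dist y z < r \<Longrightarrow> g y > g z / 2"
    unfolding eventually_at by auto
  have le: "g z / 2 * indicator (ball z r) y \<le> g y" for y
    using r(2)[of y] assms(2)[of y] assms(6) by (cases "y = z") (auto simp: indicator_def dist_commute intro: less_imp_le)
  have ib: "integrable lborel (indicator (ball z r) :: 'a \<Rightarrow> real)"
    using emeasure_lborel_ball_finite[of z r] by (simp add: integrable_indicator_iff)
  have "0 < g z / 2 * measure lborel (ball z r)" using assms(6) content_ball_pos[OF r(1), of z] by simp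
  also have "\<dots> = (\<integral>y. g z / 2 * indicator (ball z r) y \<partial>lborel)" by simp
  also have "\<dots> \<le> (\<integral>y. g y \<partial>lborel)"
    by (rule integral_mono[OF integrable_mult_right[OF ib] assms(1) le])
  finally show ?thesis .
qed

lemma dir_deriv_kernel:
  fixes x y :: "'a::euclidean_space"
  assumes "x \<noteq> y"
  shows "dir_deriv v (\<lambda>x. norm (x - y) powr (- N)) x = - N * (((x - y) \<bullet> v) * norm (x - y) powr (- (N + 2)))"
proof -
  have "((\<lambda>x. x - y) has_derivative (\<lambda>v. v)) (at x)" by (auto intro!: derivative_eq_intros)
  from diff_chain_at[OF this has_derivative_norm_powr[of "x - y" N]] assms show ?thesis
    by (intro dir_deriv_eq) (simp add: comp_def)
qed

lemma bounded_by_singleE: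
  assumes "bounded_by S P {\<beta>} g"
  obtains C where "C \<ge> 0" "\<And>y x. y \<in> P \<Longrightarrow> x \<in> S \<Longrightarrow> \<bar>g y x\<bar> \<le> C * \<beta> y x"
  using assms unfolding bounded_by_def by blast

text \<open>\<open>C\<close> comes from the kernel alone and is common to all densities supported
  away from \<open>S\<close>. The error density changes with the solution, so such a uniform
  constant is needed.\<close>

lemma potential_bounds:
  fixes S :: "'a::euclidean_space set"
  assumes S: "open S" "S \<subseteq> ball 0 \<rho>" "d > 0" "N \<ge> 0"
  obtains C where "C \<ge> 0" "\<And>W x (i::'a) (j::'a). W \<in> borel_measurable borel \<Longrightarrow> integrable lborel (\<lambda>y. \<bar>W y\<bar> * (1 + norm y) powr (- N)) \<Longrightarrow>
      (\<And>x y. x \<in> S \<Longrightarrow> W y \<noteq> 0 \<Longrightarrow> norm (x - y) > d) \<Longrightarrow> x \<in> S \<Longrightarrow> i \<in> Basis \<Longrightarrow> j \<in> Basis \<Longrightarrow>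
      \<bar>potential N W x\<bar> \<le> C * (\<integral>y. \<bar>W y\<bar> * (1 + norm y) powr (- N) \<partial>lborel) \<and>
      \<bar>dir_deriv i (potential N W) x\<bar> \<le> C * (\<integral>y. \<bar>W y\<bar> * (1 + norm y) powr (- N) \<partial>lborel) \<and>
      \<bar>dir_deriv i (dir_deriv j (potential N W)) x\<bar> \<le> C * (\<integral>y. \<bar>W y\<bar> * (1 + norm y) powr (- N) \<partial>lborel)"
proof -
  let ?P = "{y. \<forall>x\<in>S. norm (x - y) > d}" and ?k = "\<lambda>y x::'a. norm (x - y) powr (- N)"
  let ?w = "\<lambda>y::'a. (1 + norm y) powr (- N)"
  have dk: "dbd n S ?P {\<lambda>y x. ?w y} ?k" for n
    by (rule dbd_kernel[OF S(1,2,3) _ S(4)]) auto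
  obtain C0 where C0: "C0 \<ge> 0" "\<And>y x. y \<in> ?P \<Longrightarrow> x \<in> S \<Longrightarrow> \<bar>?k y x\<bar> \<le> C0 * ?w y"
    using bounded_by_singleE[OF dbd_bounded_by[OF dk[of 0]]] by blast
  obtain C1 where C1: "C1 \<ge> 0" "\<And>y x i. y \<in> ?P \<Longrightarrow> x \<in> S \<Longrightarrow> i \<in> Basis \<Longrightarrow> \<bar>dir_deriv i (?k y) x\<bar> \<le> C1 * \<bar>?w y\<bar>"
    by (rule dbd_Suc_deriv_bound[OF dk[of "Suc 0"]]) blast
  have "\<exists>C\<ge>0. \<forall>y x i. y \<in> ?P \<longrightarrow> x \<in> S \<longrightarrow> i \<in> Basis \<longrightarrow> \<bar>dir_deriv i (dir_deriv j (?k y)) x\<bar> \<le> C * \<bar>?w y\<bar>" if j: "j \<in> Basis" for j :: 'a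
  proof -
    have "dbd (Suc 0) S ?P {\<lambda>y x. ?w y} (\<lambda>y. dir_deriv j (?k y))" using dk[of "Suc (Suc 0)"] j by auto
    then obtain C where "C \<ge> 0" "\<And>y x i. y \<in> ?P \<Longrightarrow> x \<in> S \<Longrightarrow> i \<in> Basis \<Longrightarrow> \<bar>dir_deriv i (dir_deriv j (?k y)) x\<bar> \<le> C * \<bar>?w y\<bar>"
      by (rule dbd_Suc_deriv_bound) blast
    then show ?thesis by (intro exI[of _ C]) simp
  qed
  then have "\<forall>j\<in>Basis. \<exists>C. C \<ge> 0 \<and> (\<forall>y x i. y \<in> ?P \<longrightarrow> x \<in> S \<longrightarrow> i \<in> Basis \<longrightarrow> \<bar>dir_deriv i (dir_deriv j (?k y)) x\<bar> \<le> C * \<bar>?w y\<bar>)"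
    by blast
  from bchoice[OF this] obtain Cj where "\<forall>j\<in>Basis. Cj j \<ge> 0 \<and> (\<forall>y x i. y \<in> ?P \<longrightarrow> x \<in> S \<longrightarrow> i \<in> Basis \<longrightarrow> \<bar>dir_deriv i (dir_deriv j (?k y)) x\<bar> \<le> Cj j * \<bar>?w y\<bar>)" ..
  then have Cj: "\<And>j. j \<in> Basis \<Longrightarrow> Cj j \<ge> 0"
    "\<And>j y x i. j \<in> Basis \<Longrightarrow> y \<in> ?P \<Longrightarrow> x \<in> S \<Longrightarrow> i \<in> Basis \<Longrightarrow> \<bar>dir_deriv i (dir_deriv j (?k y)) x\<bar> \<le> Cj j * \<bar>?w y\<bar>"
    by blast+
  define C2 where "C2 = (\<Sum>j\<in>Basis. Cj j)"
  have C2: "C2 \<ge> 0" "\<And>j y x i. j \<in> Basis \<Longrightarrow> y \<in> ?P \<Longrightarrow> x \<in> S \<Longrightarrow> i \<in> Basis \<Longrightarrow> \<bar>dir_deriv i (dir_deriv j (?k y)) x\<bar> \<le> C2 * \<bar>?w y\<bar>"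
  proof -
    show "C2 \<ge> 0" unfolding C2_def using Cj(1) by (simp add: sum_nonneg)
    fix j i :: 'a and y x assume *: "j \<in> Basis" "y \<in> ?P" "x \<in> S" "i \<in> Basis"
    have "Cj j \<le> C2" unfolding C2_def using * Cj(1) by (intro member_le_sum) auto
    then show "\<bar>dir_deriv i (dir_deriv j (?k y)) x\<bar> \<le> C2 * \<bar>?w y\<bar>"
      using Cj(2)[OF *] mult_right_mono[of "Cj j" C2 "\<bar>?w y\<bar>"] by linarith
  qed
  define C where "C = C0 + C1 + C2"
  show ?thesis
  proof (rule that)
    show "C \<ge> 0" using C0(1) C1(1) C2(1) by (simp add: C_def)
    fix W :: "'a \<Rightarrow> real" and x i j :: 'a
    assume W: "W \<in> borel_measurable borel" "integrable lborel (\<lambda>y. \<bar>W y\<bar> * ?w y)"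
      and WS: "\<And>x y. x \<in> S \<Longrightarrow> W y \<noteq> 0 \<Longrightarrow> norm (x - y) > d" and x: "x \<in> S" and ij: "i \<in> Basis" "j \<in> Basis"
    have bd: "\<bar>\<integral>y. W y * g y \<partial>lborel\<bar> \<le> C * (\<integral>y. \<bar>W y\<bar> * ?w y \<partial>lborel)"
      if g: "\<And>y. y \<in> ?P \<Longrightarrow> \<bar>g y\<bar> \<le> C * ?w y" for g
    proof -
      have "\<bar>\<integral>y. W y * g y \<partial>lborel\<bar> \<le> (\<integral>y. \<bar>W y * g y\<bar> \<partial>lborel)" by (rule integral_abs_bound)
      also have "\<dots> \<le> (\<integral>y. C * (\<bar>W y\<bar> * ?w y) \<partial>lborel)"
      proof (rule integral_mono')
        show "integrable lborel (\<lambda>y. C * (\<bar>W y\<bar> * ?w y))" using W(2) by simp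
        show "\<bar>W y * g y\<bar> \<le> C * (\<bar>W y\<bar> * ?w y)" for y
        proof (cases "W y = 0")
          case False
          then have "y \<in> ?P" using WS by auto
          then have "\<bar>W y\<bar> * \<bar>g y\<bar> \<le> \<bar>W y\<bar> * (C * ?w y)" by (intro mult_left_mono g) auto
          then show ?thesis by (simp add: abs_mult mult_ac)
        qed simp
        show "0 \<le> C * (\<bar>W y\<bar> * ?w y)" for y using \<open>C \<ge> 0\<close> by simp
      qed
      finally show ?thesis by simp
    qed
    have le: "D * ?w y \<le> C * ?w y" if "D \<le> C" for D y using that by (intro mult_right_mono) auto
    note W' = S W WS
    show "\<bar>potential N W x\<bar> \<le> C * (\<integral>y. \<bar>W y\<bar> * ?w y \<partial>lborel) \<and>
      \<bar>dir_deriv i (potential N W) x\<bar> \<le> C * (\<integral>y. \<bar>W y\<bar> * ?w y \<partial>lborel) \<and>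
      \<bar>dir_deriv i (dir_deriv j (potential N W)) x\<bar> \<le> C * (\<integral>y. \<bar>W y\<bar> * ?w y \<partial>lborel)"
    proof (intro conjI)
      show "\<bar>potential N W x\<bar> \<le> C * (\<integral>y. \<bar>W y\<bar> * ?w y \<partial>lborel)"
        unfolding potential_def
      proof (rule bd)
        show "\<bar>norm (x - y) powr (- N)\<bar> \<le> C * ?w y" if "y \<in> ?P" for y
          using order_trans[OF C0(2)[OF that x] le[of C0 y]] C1(1) C2(1) by (simp add: C_def)
      qed
      show "\<bar>dir_deriv i (potential N W) x\<bar> \<le> C * (\<integral>y. \<bar>W y\<bar> * ?w y \<partial>lborel)"
      proof -
        have eq: "dir_deriv i (potential N W) x = (\<integral>y. W y * dir_deriv i (\<lambda>x. norm (x - y) powr (- N)) x \<partial>lborel)"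
          by (rule dir_deriv_potential[OF W' x ij(1)])
        show ?thesis unfolding eq
        proof (rule bd)
          show "\<bar>dir_deriv i (\<lambda>x. norm (x - y) powr (- N)) x\<bar> \<le> C * ?w y" if "y \<in> ?P" for y
            using C1(2)[OF that x ij(1)] le[of C1 y] C0(1) C2(1) by (simp add: C_def)
        qed
      qed
      show "\<bar>dir_deriv i (dir_deriv j (potential N W)) x\<bar> \<le> C * (\<integral>y. \<bar>W y\<bar> * ?w y \<partial>lborel)"
      proof -
        have eq: "dir_deriv i (dir_deriv j (potential N W)) x =
            (\<integral>y. W y * dir_deriv i (dir_deriv j (\<lambda>x. norm (x - y) powr (- N))) x \<partial>lborel)"
          by (rule dir_deriv2_potential[OF W' x ij])
        show ?thesis unfolding eq
        proof (rule bd)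
          show "\<bar>dir_deriv i (dir_deriv j (\<lambda>x. norm (x - y) powr (- N))) x\<bar> \<le> C * ?w y" if "y \<in> ?P" for y
            using C2(2)[OF ij(2) that x ij(1)] le[of C2 y] C0(1) C1(1) by (simp add: C_def)
        qed
      qed
    qed
  qed
qed

text \<open>Pairing \<open>h\<close> with \<open>- h\<close> shows that the radial derivative has the sign of \<open>\<delta>\<close>: of the two
  points \<open>x + h\<close>, \<open>x - h\<close> the one on the outer side is farther from the centre.\<close>

lemma potential_radial_deriv_nonzero:
  fixes S :: "'a::euclidean_space set"
  assumes S: "open S" "S \<subseteq> ball 0 \<rho>" "d > 0" "N > 0"
    and A: "continuous_on UNIV A" "integrable lborel (\<lambda>y. \<bar>A y\<bar> * (1 + norm y) powr (- N))"
      "\<And>x y. x \<in> S \<Longrightarrow> A y \<noteq> 0 \<Longrightarrow> norm (x - y) > d"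
    and mono: "\<And>y z. norm (y - x0) \<le> norm (z - x0) \<Longrightarrow> \<delta> * A y \<le> \<delta> * A z" "\<delta> \<noteq> 0"
    and x: "x \<in> S" and z: "(x - x0) \<bullet> z \<noteq> 0" "A (x + z) \<noteq> A (x - z)"
  shows "dir_deriv (x - x0) (potential N A) x \<noteq> 0"
proof -
  let ?v = "x - x0"
  have N0: "N \<ge> 0" using S(4) by simp
  have Am [measurable]: "A \<in> borel_measurable borel" using A(1) by (rule borel_measurable_continuous_onI)
  note P = S(1-3) N0 Am A(2,3)
  \<comment> \<open>The integrand of the derivative in direction \<open>v\<close>. It is linear in
    \<open>v\<close>, which carries the formula from the basis directions to the radial one.\<close>
  define J where "J v y = A y * (- N * (((x - y) \<bullet> v) * norm (x - y) powr (- (N + 2))))" for v y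
  have Jm: "J v \<in> borel_measurable borel" for v unfolding J_def[abs_def] by measurable
  have Ji: "integrable lborel (J v)" for v
  proof (rule Bochner_Integration.integrable_bound)
    show "integrable lborel (\<lambda>y. (N * norm v / d) * (A y * norm (x - y) powr (- N)))"
      by (intro integrable_mult_right integrable_potential[OF P x])
    show "AE y in lborel. norm (J v y) \<le> norm ((N * norm v / d) * (A y * norm (x - y) powr (- N)))"
    proof (rule AE_I2)
      fix y
      show "norm (J v y) \<le> norm ((N * norm v / d) * (A y * norm (x - y) powr (- N)))"
      proof (cases "A y = 0")
        case False
        have xy: "norm (x - y) > d" by (rule A(3)[OF x False])
        have "\<bar>(x - y) \<bullet> v\<bar> * norm (x - y) powr (- (N + 2)) \<le> (norm (x - y) * norm v) * norm (x - y) powr (- (N + 2))"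
          by (intro mult_right_mono Cauchy_Schwarz_ineq2) simp
        also have "\<dots> = norm v * norm (x - y) powr (- N) / norm (x - y)"
          using xy S(3) by (simp add: powr_diff powr_minus powr_add power2_eq_square field_simps)
        also have "\<dots> \<le> norm v * norm (x - y) powr (- N) / d"
          using xy S(3) by (intro divide_left_mono mult_nonneg_nonneg mult_pos_pos) auto
        finally have "(\<bar>A y\<bar> * N) * (\<bar>(x - y) \<bullet> v\<bar> * norm (x - y) powr (- (N + 2))) \<le> (\<bar>A y\<bar> * N) * (norm v * norm (x - y) powr (- N) / d)"
          using S(4) by (intro mult_left_mono) auto
        then show ?thesis using S(3,4) by (simp add: J_def abs_mult mult_ac)
      qed (simp add: J_def)
    qed
  qed (use Jm in simp)
  have di: "dir_deriv i (potential N A) x = (\<integral>y. J i y \<partial>lborel)" if "i \<in> Basis" for i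
  proof -
    have "A y * dir_deriv i (\<lambda>x. norm (x - y) powr (- N)) x = J i y" for y
    proof (cases "A y = 0")
      case False
      then have "x \<noteq> y" using A(3)[OF x False] S(3) by auto
      then show ?thesis by (simp add: J_def dir_deriv_kernel)
    qed (simp add: J_def)
    then show ?thesis using dir_deriv_potential[OF P x that] by simp
  qed
  have "potential N A differentiable (at x)"
    using smooth_on_potential[OF P] x smooth_on_iff by blast
  then have "dir_deriv ?v (potential N A) x = (\<Sum>i\<in>Basis. (?v \<bullet> i) * (\<integral>y. J i y \<partial>lborel))"
    by (subst dir_deriv_Basis_sum) (auto simp: di)
  also have "\<dots> = (\<integral>y. (\<Sum>i\<in>Basis. (?v \<bullet> i) * J i y) \<partial>lborel)"
    using Ji by (subst Bochner_Integration.integral_sum) auto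
  also have "(\<lambda>y. \<Sum>i\<in>Basis. (?v \<bullet> i) * J i y) = J ?v"
  proof
    fix y
    have "(x - y) \<bullet> ?v = (\<Sum>i\<in>Basis. (?v \<bullet> i) * ((x - y) \<bullet> i))"
      by (subst euclidean_inner) (simp add: mult.commute)
    then show "(\<Sum>i\<in>Basis. (?v \<bullet> i) * J i y) = J ?v y"
      by (simp add: J_def sum_distrib_left sum_distrib_right mult_ac)
  qed
  also have "(\<integral>y. J ?v y \<partial>lborel) = (\<integral>h. J ?v (x + h) \<partial>lborel)"
    using integral_similarity[OF orthogonal_transformation_id _ Jm, of 1 ?v x] by simp
  also have "\<dots> = (\<integral>h. J ?v (x + h) + J ?v (x + - h) \<partial>lborel) / 2"
    using integrable_similarity[OF orthogonal_transformation_id _ Jm, of 1 ?v x] Ji[of ?v]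
    by (intro integrable_symmetrize) simp
  finally have eq: "2 * dir_deriv ?v (potential N A) x = (\<integral>h. J ?v (x + h) + J ?v (x + - h) \<partial>lborel)" by simp
  define g where "g h = \<delta> * (J ?v (x + h) + J ?v (x + - h))" for h
  have g: "g h = N * norm h powr (- (N + 2)) * ((?v \<bullet> h) * (\<delta> * A (x + h) - \<delta> * A (x - h)))" for h
    by (simp add: g_def J_def inner_commute algebra_simps)
  have g0: "g h \<ge> 0" for h
  proof -
    have sq: "(norm (x + h - x0))\<^sup>2 - (norm (x - h - x0))\<^sup>2 = 4 * (?v \<bullet> h)"
      unfolding power2_norm_eq_inner by (simp add: inner_add inner_diff inner_commute algebra_simps)
    have "0 \<le> (?v \<bullet> h) * (\<delta> * A (x + h) - \<delta> * A (x - h))"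
    proof (cases "?v \<bullet> h \<ge> 0")
      case True
      then have "(norm (x - h - x0))\<^sup>2 \<le> (norm (x + h - x0))\<^sup>2" using sq by linarith
      then have "norm (x - h - x0) \<le> norm (x + h - x0)" by (rule power2_le_imp_le) simp
      then show ?thesis using True mono(1) by simp
    next
      case False
      then have "(norm (x + h - x0))\<^sup>2 \<le> (norm (x - h - x0))\<^sup>2" using sq by linarith
      then have "norm (x + h - x0) \<le> norm (x - h - x0)" by (rule power2_le_imp_le) simp
      then show ?thesis using False mono(1)[of "x + h" "x - h"] by (simp add: mult_nonpos_nonpos)
    qed
    then show ?thesis unfolding g using S(4) by simp
  qed
  have "(\<integral>h. g h \<partial>lborel) > 0"
  \<comment> \<open>The power of the norm is continuous off the origin, and \<open>z\<close> is
    nonzero because its inner product with \<open>?v\<close> is.\<close>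
  proof (rule integral_pos_continuous[where U = "- {0}" and z = z])
    have "integrable lborel (\<lambda>h. J ?v (x + h))"
      using integrable_similarity[OF orthogonal_transformation_id _ Jm, of 1 ?v x] Ji[of ?v] by simp
    moreover have "integrable lborel (\<lambda>h. J ?v (x + - h))"
      using integrable_similarity[OF orthogonal_transformation_uminus _ Jm, of 1 ?v x] Ji[of ?v] by simp
    ultimately show "integrable lborel g" unfolding g_def by (intro integrable_mult_right Bochner_Integration.integrable_add)
    show z0: "z \<in> - {0}" using z(1) by auto
    show "continuous_on (- {0}) g"
      unfolding g by (intro continuous_intros continuous_on_compose2[OF A(1)]) auto
    have "g z \<noteq> 0" unfolding g using z mono(2) S(4) z0 by (simp add: right_diff_distrib[symmetric])
    then show "g z > 0" using g0[of z] by simp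
  qed (use g0 in auto)
  moreover have "(\<integral>h. g h \<partial>lborel) = \<delta> * (2 * dir_deriv ?v (potential N A) x)" unfolding g_def eq by simp
  ultimately show ?thesis by auto
qed

section \<open>The theorem\<close>

text \<open>The decaying and the growing case behind one interface. The sign of
  \<open>\<delta>\<close> records the direction in which \<open>A\<close> is monotone; the last
  property supplies, for each \<open>x\<close>, a symmetric pair on which the monotonicity is
  strict.\<close>

lemma ex_deformation:
  fixes c \<sigma> p s :: real
  assumes p: "p > 2" "0 < \<sigma>" "\<sigma> < 1" and s: "s > - (\<sigma> * p / (p - 1))"
  obtains x0 :: "real ^ 'n::finite" and A \<delta> K where "norm x0 = 4" "deforms c \<sigma> p s A" "\<delta> \<noteq> (0::real)"
    "continuous_on UNIV A" "\<And>y. 0 \<le> A y \<and> A y \<le> K"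
    "\<And>x y. x \<in> ball 0 (5/2) \<Longrightarrow> norm (x - y) \<le> 1/2 \<Longrightarrow> A y = 0"
    "\<And>y z. norm (y - x0) \<le> norm (z - x0) \<Longrightarrow> \<delta> * A y \<le> \<delta> * A z"
    "\<And>x. x \<in> cball 0 2 \<Longrightarrow> \<exists>z. (x - x0) \<bullet> z \<noteq> 0 \<and> A (x + z) \<noteq> A (x - z)"
proof -
  define x0 :: "real ^ 'n" where "x0 = 4 *\<^sub>R axis undefined 1"
  have x0: "norm x0 = 4" by (simp add: x0_def)
  have lm: "lognorm 1 (y - x0) \<le> lognorm 1 (z - x0)" if "norm (y - x0) \<le> norm (z - x0)" for y z
    using that unfolding lognorm_def by (subst ln_le_cancel_iff) (auto simp: less_max_iff_disj)
  have cont: "continuous_on UNIV (\<lambda>y. step (lognorm 1 (y - x0) + b))" for b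
    by (intro continuous_intros continuous_on_compose2[OF continuous_on_step[of UNIV]] continuous_lognorm) auto
  have dist: "2 \<le> norm (x - x0)" "norm (x - x0) \<le> 6" if "x \<in> cball 0 2" for x
    using that x0 norm_triangle_ineq2[of x0 x] norm_triangle_ineq4[of x x0] by (auto simp: norm_minus_commute)
  show ?thesis
  proof (cases "s \<ge> 0")
    case True
    let ?A = "\<lambda>y. step 1 - step (lognorm 1 (y - x0) + 1)"
    show ?thesis
    proof (rule that[OF x0 deforms_decay[OF p True x0], of "- 1" "step 1"])
      show "continuous_on UNIV ?A" by (intro continuous_intros cont)
      show "0 \<le> ?A y \<and> ?A y \<le> step 1" for y using step_le step_nonneg by simp
      show "?A y = 0" if "x \<in> ball 0 (5/2)" "norm (x - y) \<le> 1/2" for x y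
      proof -
        have "lognorm 1 (y - x0) \<ge> 0"
          unfolding lognorm_def using center_distance(1)[OF x0 that] by (intro ln_ge_zero) (simp add: le_max_iff_disj)
        then show ?thesis using step_eq[of "lognorm 1 (y - x0) + 1"] by simp
      qed
      show "- 1 * ?A y \<le> - 1 * ?A z" if "norm (y - x0) \<le> norm (z - x0)" for y z
        using step_mono[of "lognorm 1 (y - x0) + 1" "lognorm 1 (z - x0) + 1"] lm[OF that] by simp
      show "\<exists>z. (x - x0) \<bullet> z \<noteq> 0 \<and> ?A (x + z) \<noteq> ?A (x - z)" if "x \<in> cball 0 2" for x
      proof (intro exI conjI)
        have xx: "norm (x - x0) \<ge> 2" using dist[OF that] by simp
        \<comment> \<open>The witness is \<open>x0 - x\<close>: one point of the pair is the centre,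
          where \<open>A\<close> is maximal, and the other is at distance at least 4 from it, where
          \<open>A\<close> vanishes.\<close>
        show "(x - x0) \<bullet> (x0 - x) \<noteq> 0"
          using xx by (metis inner_eq_zero_iff inner_minus_right minus_diff_eq neg_equal_0_iff_equal norm_zero not_numeral_le_zero)
        have "lognorm 1 (x + (x0 - x) - x0) = - 1" by (simp add: lognorm_def)
        then have 1: "?A (x + (x0 - x)) = step 1" by (simp add: step_eq_0)
        have e: "x - (x0 - x) - x0 = 2 *\<^sub>R (x - x0)" by (simp add: scaleR_2)
        have "lognorm 1 (x - (x0 - x) - x0) \<ge> 0"
          unfolding lognorm_def e using xx by (intro ln_ge_zero) (simp add: le_max_iff_disj)
        then have "?A (x - (x0 - x)) = 0" using step_eq[of "lognorm 1 (x - (x0 - x) - x0) + 1"] by simp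
        then show "?A (x + (x0 - x)) \<noteq> ?A (x - (x0 - x))" using 1 step_1_pos by simp
      qed
    qed simp
  next
    case False
    let ?A = "\<lambda>y. step (lognorm 1 (y - x0) - 3)"
    have "- s * (p - 1) < \<sigma> * p" using s p by (simp add: field_simps)
    with False have s': "s < 0" "- s * (p - 1) < \<sigma> * p" by auto
    show ?thesis
    proof (rule that[OF x0 deforms_growth[OF p s' x0], of 1 "step 1"])
      show "continuous_on UNIV ?A" using cont[of "- 3"] by simp
      show "0 \<le> ?A y \<and> ?A y \<le> step 1" for y using step_le step_nonneg by simp
      show "?A y = 0" if "x \<in> ball 0 (5/2)" "norm (x - y) \<le> 1/2" for x y
      proof -
        have "norm (y - x0) \<le> exp 3" using center_distance(2)[OF x0 that] exp_four by linarith
        then have "lognorm 1 (y - x0) \<le> 3" by (simp add: lognorm_le_iff)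
        then show ?thesis by (simp add: step_eq_0)
      qed
      show "1 * ?A y \<le> 1 * ?A z" if "norm (y - x0) \<le> norm (z - x0)" for y z
        using step_mono[of "lognorm 1 (y - x0) - 3" "lognorm 1 (z - x0) - 3"] lm[OF that] by simp
      show "\<exists>z. (x - x0) \<bullet> z \<noteq> 0 \<and> ?A (x + z) \<noteq> ?A (x - z)" if "x \<in> cball 0 2" for x
      proof (intro exI conjI)
        have xx: "norm (x - x0) \<ge> 2" "norm (x - x0) \<le> 6" using dist[OF that] by simp_all
        \<comment> \<open>The pair on the radial line then has distances
          \<open>norm (x - x0) + exp 3\<close> and \<open>\<bar>norm (x - x0) - exp 3\<bar>\<close>
          from the centre: one beyond and one within the ball on which \<open>A\<close>
          vanishes.\<close>
        define t where "t = exp 3 / norm (x - x0)"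
        have nz: "x \<noteq> x0" using xx(1) by auto
        have t: "t > 0" using xx by (auto simp: t_def intro!: divide_pos_pos)
        have "x - x0 \<noteq> 0" using xx by auto
        then show "(x - x0) \<bullet> (t *\<^sub>R (x - x0)) \<noteq> 0" using t by simp
        have e: "x + t *\<^sub>R (x - x0) - x0 = (1 + t) *\<^sub>R (x - x0)" "x - t *\<^sub>R (x - x0) - x0 = (1 - t) *\<^sub>R (x - x0)"
          by (simp_all add: algebra_simps)
        have tn: "t * norm (x - x0) = exp 3" using nz by (simp add: t_def)
        have "norm ((1 + t) *\<^sub>R (x - x0)) = norm (x - x0) + exp 3" using t tn by (simp add: distrib_right)
        then have "\<not> norm (x + t *\<^sub>R (x - x0) - x0) \<le> exp 3" unfolding e using xx(1) by linarith
        then have "lognorm 1 (x + t *\<^sub>R (x - x0) - x0) > 3" by (simp add: lognorm_le_iff[symmetric])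
        then have 1: "?A (x + t *\<^sub>R (x - x0)) > 0" by (intro step_pos) simp
        have "\<bar>1 - t\<bar> * norm (x - x0) = \<bar>norm (x - x0) - exp 3\<bar>"
          using tn abs_mult[of "1 - t" "norm (x - x0)"] by (simp add: left_diff_distrib)
        then have "norm ((1 - t) *\<^sub>R (x - x0)) \<le> exp 3" using xx exp_four by simp
        then have "lognorm 1 (x - t *\<^sub>R (x - x0) - x0) \<le> 3" unfolding e by (simp add: lognorm_le_iff)
        then have "?A (x - t *\<^sub>R (x - x0)) = 0" by (simp add: step_eq_0)
        then show "?A (x + t *\<^sub>R (x - x0)) \<noteq> ?A (x - t *\<^sub>R (x - x0))" using 1 by simp
      qed
    qed simp
  qed
qed

lemma norm_vec_le:
  fixes x :: "'a::real_normed_vector ^ 'n::finite" and B :: real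
  assumes "\<And>i. norm (x $ i) \<le> B"
  shows "norm x \<le> CARD('n) * B"
proof -
  have "norm x \<le> (\<Sum>i\<in>UNIV. norm (x $ i))" unfolding norm_vec_def by (intro L2_set_le_sum) auto
  also have "\<dots> \<le> (\<Sum>i\<in>(UNIV::'n set). B)" by (intro sum_mono assms)
  finally show ?thesis by simp
qed

lemma dir_deriv_scaled_diff:
  assumes "f differentiable (at x)" "g differentiable (at x)"
  shows "dir_deriv i (\<lambda>x. c * (f x - g x)) x = c * (dir_deriv i f x - dir_deriv i g x)"
  by (rule dir_deriv_eq) (auto intro!: derivative_eq_intros has_derivative_dir_deriv assms)

lemma partial_deriv_eq_dir_deriv: "partial_deriv i f = dir_deriv (axis i 1) f"
  by (simp add: partial_deriv_def dir_deriv_def fun_eq_iff)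

text \<open>\<open>f\<close> stands for the small error and \<open>g\<close> for the fixed
  potential. The last bound is a lower bound for the gradient, obtained by testing it in the single
  direction \<open>v\<close>; the dimension factors come from passing between basis directions and
  \<open>v\<close>.\<close>

lemma perturbed_bounds:
  fixes f g K :: "real ^ 'n::finite \<Rightarrow> real" and c e M :: real
  assumes S: "open S" "x \<in> S" and c: "c > 0" and sm: "smooth_on S f" "smooth_on S g"
    and K: "\<And>x. x \<in> S \<Longrightarrow> K x = c * (f x - g x)"
    and f: "\<And>i j. i \<in> Basis \<Longrightarrow> j \<in> Basis \<Longrightarrow>
      \<bar>f x\<bar> \<le> e \<and> \<bar>dir_deriv i f x\<bar> \<le> e \<and> \<bar>dir_deriv i (dir_deriv j f) x\<bar> \<le> e"
    and g: "\<And>i j. i \<in> Basis \<Longrightarrow> j \<in> Basis \<Longrightarrow>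
      \<bar>g x\<bar> \<le> M \<and> \<bar>dir_deriv i g x\<bar> \<le> M \<and> \<bar>dir_deriv i (dir_deriv j g) x\<bar> \<le> M"
  shows "\<bar>K x\<bar> \<le> c * (e + M)"
    and "K x \<le> c * (e - g x)"
    and "norm (grad K x) \<le> CARD('n) * (c * (e + M))"
    and "norm (hess K x) \<le> CARD('n) * (CARD('n) * (c * (e + M)))"
    and "c * (\<bar>dir_deriv v g x\<bar> - CARD('n) * e * norm v) \<le> CARD('n) * norm (grad K x) * norm v"
proof -
  have ax: "axis i (1::real) \<in> Basis" for i :: 'n by (simp add: axis_in_Basis_iff)
  have cle: "\<bar>c * (a - b)\<bar> \<le> c * (e + M)" if "\<bar>a\<bar> \<le> e \<and> \<bar>b\<bar> \<le> M" for a b :: real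
  proof -
    have "\<bar>a - b\<bar> \<le> e + M" using that by linarith
    then show ?thesis using c by (simp add: abs_mult)
  qed
  have sm': "f differentiable (at y)" "g differentiable (at y)" "i \<in> Basis \<Longrightarrow> dir_deriv i f differentiable (at y)"
    "i \<in> Basis \<Longrightarrow> dir_deriv i g differentiable (at y)" if "y \<in> S" for y i
    using sm that smooth_on_iff by blast+
  have d1: "dir_deriv v K y = c * (dir_deriv v f y - dir_deriv v g y)" if "y \<in> S" for v y
    using dir_deriv_cong(2)[OF S(1) that K] dir_deriv_scaled_diff[OF sm'(1,2)[OF that]] by simp
  have d2: "dir_deriv i (dir_deriv j K) x = c * (dir_deriv i (dir_deriv j f) x - dir_deriv i (dir_deriv j g) x)" if "j \<in> Basis" for i j
    using dir_deriv_cong(2)[OF S(1,2) d1[of _ j]] dir_deriv_scaled_diff[OF sm'(3,4)[OF S(2) that]] by simp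
  have fg: "\<bar>f x\<bar> \<le> e \<and> \<bar>g x\<bar> \<le> M" using f g ax by blast
  show "\<bar>K x\<bar> \<le> c * (e + M)" unfolding K[OF S(2)] by (rule cle[OF fg])
  show "K x \<le> c * (e - g x)" unfolding K[OF S(2)] using fg c by (intro mult_left_mono) auto
  have "\<bar>dir_deriv i K x\<bar> \<le> c * (e + M)" if "i \<in> Basis" for i
    unfolding d1[OF S(2)] using f g that by (intro cle) blast
  then show "norm (grad K x) \<le> CARD('n) * (c * (e + M))"
    by (intro norm_vec_le) (simp add: grad_def partial_deriv_eq_dir_deriv ax)
  have "\<bar>dir_deriv i (dir_deriv j K) x\<bar> \<le> c * (e + M)" if "i \<in> Basis" "j \<in> Basis" for i j
    unfolding d2[OF that(2)] using f g that by (intro cle) blast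
  then show "norm (hess K x) \<le> CARD('n) * (CARD('n) * (c * (e + M)))"
    by (intro norm_vec_le) (simp add: hess_def partial_deriv_eq_dir_deriv ax)
  have "(\<lambda>x. c * (f x - g x)) differentiable (at x)"
    by (intro differentiable_mult differentiable_diff differentiable_const sm'[OF S(2)])
  then have "K differentiable (at x)" using dir_deriv_cong(1)[OF S K] by simp
  moreover have "\<bar>dir_deriv i K x\<bar> \<le> norm (grad K x)" if i: "i \<in> Basis" for i
  proof -
    from i obtain k where k: "i = axis k 1" by (auto simp: Basis_vec_def)
    show ?thesis
      using component_le_norm_cart[of "grad K x" k] by (simp add: k grad_def partial_deriv_eq_dir_deriv)
  qed
  ultimately have 1: "\<bar>dir_deriv v K x\<bar> \<le> CARD('n) * norm (grad K x) * norm v"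
    using dir_deriv_bound[of K x "norm (grad K x)" v] by simp
  have 2: "\<bar>dir_deriv v f x\<bar> \<le> CARD('n) * e * norm v"
    using dir_deriv_bound[OF sm'(1)[OF S(2)], of e v] f by simp
  have "c * (\<bar>dir_deriv v g x\<bar> - CARD('n) * e * norm v) \<le> c * \<bar>dir_deriv v f x - dir_deriv v g x\<bar>"
    using 2 c by (intro mult_left_mono) auto
  also have "\<dots> = \<bar>dir_deriv v K x\<bar>" unfolding d1[OF S(2)] using c by (simp add: abs_mult)
  finally show "c * (\<bar>dir_deriv v g x\<bar> - CARD('n) * e * norm v) \<le> CARD('n) * norm (grad K x) * norm v"
    using 1 by linarith
qed

theorem theorem2p1:
  fixes c \<sigma> p q s :: real
  assumes "c > 0" and "p > 2" and "0 < \<sigma>" and "\<sigma> < 1"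
    and "s > - (\<sigma> * p / (p - 1))"
  shows "\<exists>c0 C0 :: real. c0 > 0 \<and> C0 > 0 \<and>
    (\<exists>(K :: nat \<Rightarrow> real ^ 'n::finite \<Rightarrow> real) (u :: nat \<Rightarrow> real ^ 'n \<Rightarrow> real).
      (\<forall>j. smooth (K j) \<and>
        (\<forall>x\<in>ball 0 2.
          - C0 \<le> K j x \<and> K j x \<le> - c0 \<and>
          c0 \<le> norm (grad (K j) x) \<and> norm (grad (K j) x) \<le> C0 \<and>
          norm (hess (K j) x) \<le> C0)) \<and>
      (\<forall>j. smooth (u j) \<and> (\<forall>x. u j x > 0) \<and>
        (\<forall>x. has_frac_p_laplacian c \<sigma> p (u j) x (K j x * u j x powr (q * (p - 1)))) \<and>
        ((\<lambda>x. norm x powr s * u j x) \<longlongrightarrow> 1) at_infinity) \<and>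
      filterlim (\<lambda>j. INF x\<in>cball 0 1. u j x) at_top sequentially)"
proof -
  obtain x0 :: "real ^ 'n" and A \<delta> \<kappa> where x0: "norm x0 = 4" and def: "deforms c \<sigma> p s A" and \<delta>: "\<delta> \<noteq> (0::real)"
    and Acont: "continuous_on UNIV A" and A0\<kappa>: "\<And>y. 0 \<le> A y \<and> A y \<le> \<kappa>"
    and Asupp: "\<And>x y. x \<in> ball 0 (5/2) \<Longrightarrow> norm (x - y) \<le> 1/2 \<Longrightarrow> A y = 0"
    and Amono: "\<And>y z. norm (y - x0) \<le> norm (z - x0) \<Longrightarrow> \<delta> * A y \<le> \<delta> * A z"
    and Anc: "\<And>x. x \<in> cball 0 2 \<Longrightarrow> \<exists>z. (x - x0) \<bullet> z \<noteq> 0 \<and> A (x + z) \<noteq> A (x - z)"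
    using ex_deformation[OF assms(2-5)] by blast
  define N where "N = real CARD('n) + \<sigma> * p"
  define W where "W y = A y powr (p - 1)" for y
  define S where "S = ball (0 :: real ^ 'n) (5/2)"
  define \<Phi> where "\<Phi> = potential N W"
  have N: "N > 0" "- N < - real DIM(real ^ 'n)" using assms by (auto simp: N_def add_pos_pos)
  have S: "open S" "S \<subseteq> ball 0 (5/2)" "(1/2::real) > 0" and N0: "N \<ge> 0" using N by (auto simp: S_def)
  have sub: "cball 0 2 \<subseteq> S" by (auto simp: S_def)
  have Wcont: "continuous_on UNIV W"
    unfolding W_def[abs_def] using Acont A0\<kappa> assms(2) by (intro continuous_on_powr' continuous_intros) auto
  then have Wm: "W \<in> borel_measurable borel" by (rule borel_measurable_continuous_onI)
  have W0: "W y \<ge> 0" for y by (simp add: W_def)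
  have Wi: "integrable lborel (\<lambda>y. \<bar>W y\<bar> * (1 + norm y) powr (- N))"
  proof (rule Bochner_Integration.integrable_bound)
    show "integrable lborel (\<lambda>y::real ^ 'n. \<kappa> powr (p - 1) * (1 + norm y) powr (- N))"
      by (intro integrable_mult_right integrable_one_plus_norm_powr N)
    have "W y \<le> \<kappa> powr (p - 1)" for y unfolding W_def using A0\<kappa> assms(2) by (intro powr_mono2) auto
    then show "AE y in lborel. norm (\<bar>W y\<bar> * (1 + norm y) powr (- N)) \<le> norm (\<kappa> powr (p - 1) * (1 + norm y) powr (- N))"
      using W0 by (intro AE_I2) (auto simp: intro!: mult_right_mono)
  qed (use Wm in measurable)
  have WS: "norm (x - y) > 1/2" if "x \<in> S" "W y \<noteq> 0" for x y
    using Asupp[of x y] that by (force simp: S_def W_def)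
  note PW = S N0 Wm Wi WS
  have sm\<Phi>: "smooth_on S \<Phi>" unfolding \<Phi>_def by (rule smooth_on_potential[OF PW])
  obtain C where C: "C \<ge> 0" "\<And>W x (i :: real ^ 'n) (j :: real ^ 'n). W \<in> borel_measurable borel \<Longrightarrow> integrable lborel (\<lambda>y. \<bar>W y\<bar> * (1 + norm y) powr (- N)) \<Longrightarrow>
      (\<And>x y. x \<in> S \<Longrightarrow> W y \<noteq> 0 \<Longrightarrow> norm (x - y) > 1/2) \<Longrightarrow> x \<in> S \<Longrightarrow> i \<in> Basis \<Longrightarrow> j \<in> Basis \<Longrightarrow>
      \<bar>potential N W x\<bar> \<le> C * (\<integral>y. \<bar>W y\<bar> * (1 + norm y) powr (- N) \<partial>lborel) \<and>
      \<bar>dir_deriv i (potential N W) x\<bar> \<le> C * (\<integral>y. \<bar>W y\<bar> * (1 + norm y) powr (- N) \<partial>lborel) \<and>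
      \<bar>dir_deriv i (dir_deriv j (potential N W)) x\<bar> \<le> C * (\<integral>y. \<bar>W y\<bar> * (1 + norm y) powr (- N) \<partial>lborel)"
    by (rule potential_bounds[OF S N0]) blast
  define M where "M = C * (\<integral>y. \<bar>W y\<bar> * (1 + norm y) powr (- N) \<partial>lborel)"
  have M: "\<bar>\<Phi> x\<bar> \<le> M \<and> \<bar>dir_deriv i \<Phi> x\<bar> \<le> M \<and> \<bar>dir_deriv i (dir_deriv j \<Phi>) x\<bar> \<le> M"
    if "x \<in> S" "i \<in> Basis" "j \<in> Basis" for x i j
    unfolding \<Phi>_def M_def by (rule C(2)[OF Wm Wi WS that])
  have "M \<ge> 0" unfolding M_def using C(1) by (intro mult_nonneg_nonneg Bochner_Integration.integral_nonneg) auto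
  have Wnc: "\<exists>z. (x - x0) \<bullet> z \<noteq> 0 \<and> W (x + z) \<noteq> W (x - z)" if x: "x \<in> cball 0 2" for x
  proof -
    obtain z where z: "(x - x0) \<bullet> z \<noteq> 0" "A (x + z) \<noteq> A (x - z)" using Anc[OF x] by blast
    have "W (x + z) \<noteq> W (x - z)"
      unfolding W_def using z(2) A0\<kappa> assms(2) powr_less_mono2[of "p - 1" "A (x + z)" "A (x - z)"]
        powr_less_mono2[of "p - 1" "A (x - z)" "A (x + z)"] by (metis diff_gt_0_iff_gt less_trans linorder_neq_iff one_less_numeral_iff semiring_norm(76))
    with z(1) show ?thesis by blast
  qed
  have "\<Phi> x > 0" if x: "x \<in> cball 0 2" for x
  proof -
    have xS: "x \<in> S" using x sub by blast
    obtain z0 where "W (x + z0) \<noteq> W (x - z0)" using Wnc[OF x] by blast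
    then obtain z where z: "W z \<noteq> 0" by metis
    show ?thesis
      unfolding \<Phi>_def potential_def
    proof (rule integral_pos_continuous[where U = "- {x}" and z = z])
      show "integrable lborel (\<lambda>y. W y * norm (x - y) powr (- N))" by (rule integrable_potential[OF PW xS])
      show zx: "z \<in> - {x}" using WS[OF xS z] by auto
      show "continuous_on (- {x}) (\<lambda>y. W y * norm (x - y) powr (- N))"
        by (intro continuous_intros continuous_on_subset[OF Wcont]) auto
      show "W z * norm (x - z) powr (- N) > 0"
        using z W0[of z] zx by (intro mult_pos_pos) (auto simp: less_le)
    qed (use W0 in auto)
  qed
  \<comment> \<open>The closed ball of radius 2 is compact and lies inside \<open>S\<close>, so
    positivity at each point becomes a uniform lower bound.\<close>
  moreover have "continuous_on (cball 0 2) \<Phi>"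
    using smooth_on_imp_continuous_on[OF sm\<Phi>] sub continuous_on_subset by blast
  ultimately obtain m where m: "m > 0" "\<And>x. x \<in> cball 0 2 \<Longrightarrow> m \<le> \<Phi> x"
    using continuous_attains_inf[of "cball (0 :: real ^ 'n) 2" \<Phi>] by (metis cball_eq_empty compact_cball not_numeral_less_zero)
  \<comment> \<open>Only the sign of \<open>\<delta>\<close> passes from \<open>A\<close> to its
    power \<open>W\<close>.\<close>
  define \<delta>' where "\<delta>' = (if \<delta> > 0 then 1 else - 1 :: real)"
  have Wmono: "\<delta>' * W y \<le> \<delta>' * W z" if "norm (y - x0) \<le> norm (z - x0)" for y z
    using Amono[OF that] \<delta> A0\<kappa> assms(2) by (auto simp: \<delta>'_def W_def mult_le_cancel_left intro!: powr_mono2)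
  define \<gamma> where "\<gamma> x = dir_deriv (x - x0) \<Phi> x" for x
  have "\<gamma> x \<noteq> 0" if x: "x \<in> cball 0 2" for x
  proof -
    obtain z where z: "(x - x0) \<bullet> z \<noteq> 0" "W (x + z) \<noteq> W (x - z)" using Wnc[OF x] by blast
    show ?thesis unfolding \<gamma>_def \<Phi>_def
      by (rule potential_radial_deriv_nonzero[where \<delta> = \<delta>', OF S N(1) Wcont Wi WS Wmono _ _ z])
        (use x sub in \<open>auto simp: \<delta>'_def\<close>)
  qed
  moreover have "continuous_on (cball 0 2) \<gamma>"
  proof -
    have "continuous_on S (\<lambda>x. \<Sum>i\<in>Basis. ((x - x0) \<bullet> i) * dir_deriv i \<Phi> x)"
      using sm\<Phi> smooth_on_iff[of S \<Phi>] by (intro continuous_intros smooth_on_imp_continuous_on) blast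
    moreover have "\<gamma> x = (\<Sum>i\<in>Basis. ((x - x0) \<bullet> i) * dir_deriv i \<Phi> x)" if "x \<in> S" for x
      unfolding \<gamma>_def using sm\<Phi> smooth_on_iff that by (intro dir_deriv_Basis_sum) blast
    ultimately show ?thesis using sub by (metis (mono_tags, lifting) continuous_on_cong continuous_on_subset)
  qed
  then have "continuous_on (cball 0 2) (\<lambda>x. \<bar>\<gamma> x\<bar>)" by (intro continuous_intros)
  ultimately obtain g where g: "g > 0" "\<And>x. x \<in> cball 0 2 \<Longrightarrow> g \<le> \<bar>\<gamma> x\<bar>"
    using continuous_attains_inf[of "cball (0 :: real ^ 'n) 2" "\<lambda>x. \<bar>\<gamma> x\<bar>"]
    by (metis cball_eq_empty compact_cball not_numeral_less_zero zero_less_abs_iff)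
  \<comment> \<open>The error may consume at most half of each lower bound. For the radial
    derivative it is at most \<open>CARD('n) * e * norm (x - x0)\<close> with
    \<open>norm (x - x0) \<le> 6\<close>, which explains 12.\<close>
  define e where "e = min (m / 2) (g / (12 * CARD('n)))"
  have e: "e > 0" "e \<le> m / 2" "e \<le> g / (12 * CARD('n))" using m(1) g(1) by (auto simp: e_def)
  have eg: "real CARD('n) * e * 6 \<le> g / 2" using e(3) by (simp add: field_simps)
  \<comment> \<open>The summand 1 avoids a division by 0 when \<open>C = 0\<close>.\<close>
  define \<eta> where "\<eta> = e / (C + 1)"
  have \<eta>: "\<eta> > 0" "C * \<eta> \<le> e" using C(1) e(1) by (auto simp: \<eta>_def field_simps)
  \<comment> \<open>The second entry is \<open>c * g / 2\<close> divided by
    \<open>6 * CARD('n)\<close>, the factor lost between the radial derivative and the norm of the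
    gradient.\<close>
  define c0 where "c0 = min (c * m / 2) (c * g / (12 * CARD('n)))"
  define T where "T = c * (e + M)"
  define C0 where "C0 = CARD('n) * (CARD('n) * T)"
  have T: "T > 0" using assms(1) e(1) \<open>M \<ge> 0\<close> by (simp add: T_def)
  have n1: "1 \<le> real CARD('n)" by (simp add: Suc_leI)
  have nT: "T \<le> CARD('n) * T" using mult_right_mono[OF n1, of T] T by simp
  have C0: "T \<le> C0" "CARD('n) * T \<le> C0" "CARD('n) * (CARD('n) * T) \<le> C0"
    using mult_right_mono[OF n1, of "CARD('n) * T"] nT T by (simp_all only: C0_def, linarith+)
  have "\<exists>K u. smooth K \<and> (\<forall>x\<in>ball 0 2. - C0 \<le> K x \<and> K x \<le> - c0 \<and> c0 \<le> norm (grad K x) \<and>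
      norm (grad K x) \<le> C0 \<and> norm (hess K x) \<le> C0) \<and> smooth u \<and> (\<forall>x. u x > 0) \<and>
      (\<forall>x. has_frac_p_laplacian c \<sigma> p u x (K x * u x powr (q * (p - 1)))) \<and>
      ((\<lambda>x. norm x powr s * u x) \<longlongrightarrow> 1) at_infinity \<and> (\<forall>x\<in>cball (0 :: real ^ 'n) 1. u x = v)"
    if v: "v \<ge> 2" for v
  proof -
    \<comment> \<open>With \<open>\<epsilon> = v powr q\<close> this is both the factor
      \<open>\<epsilon> powr (p - 1)\<close> of the main term and the value of
      \<open>u powr (q * (p - 1))\<close> on the plateau, so it cancels in \<open>K\<close>.\<close>
    define a where "a = v powr (q * (p - 1))"
    have a: "a > 0" "(v powr q) powr (p - 1) = a" using v by (auto simp: a_def powr_powr)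
    \<comment> \<open>The tolerance is scaled by \<open>a\<close> because the error density will be
      divided by \<open>a\<close>; for negative \<open>q\<close> this makes it small as
      \<open>v\<close> grows.\<close>
    have "v powr q > 0" "\<eta> * a > 0" using v \<eta> a by auto
    from def[unfolded deforms_def, rule_format, OF v this] obtain u L E where u: "smooth_on UNIV u" "\<And>x. u x > 0" "\<And>x. x \<in> S \<Longrightarrow> u x = v"
        "((\<lambda>x. norm x powr s * u x) \<longlongrightarrow> 1) at_infinity"
      and L: "smooth_on UNIV L" "\<And>x. has_frac_p_laplacian c \<sigma> p u x (L x)"
      and E: "E \<in> borel_measurable borel" "integrable lborel (\<lambda>y. \<bar>E y\<bar> * (1 + norm y) powr (- N))"
        "(\<integral>y. \<bar>E y\<bar> * (1 + norm y) powr (- N) \<partial>lborel) \<le> \<eta> * a"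
        "\<And>x y. x \<in> S \<Longrightarrow> E y \<noteq> 0 \<Longrightarrow> norm (x - y) > 1/2"
      and LS: "\<And>x. x \<in> S \<Longrightarrow> L x = c * (potential N E x - (v powr q) powr (p - 1) * \<Phi> x)"
      unfolding N_def[symmetric] W_def[abs_def, symmetric] \<Phi>_def[symmetric] S_def[symmetric] by blast
    define K where "K x = L x * u x powr (- (q * (p - 1)))" for x
    define P where "P = potential N (\<lambda>y. E y / a)"
    have P: "P x = potential N E x / a" for x by (simp add: P_def potential_def)
    have PE: "(\<lambda>y. E y / a) \<in> borel_measurable borel"
      "integrable lborel (\<lambda>y. \<bar>E y / a\<bar> * (1 + norm y) powr (- N))"
      "\<And>x y. x \<in> S \<Longrightarrow> E y / a \<noteq> 0 \<Longrightarrow> norm (x - y) > 1/2"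
      using E a by (auto simp: abs_divide)
    have "(\<integral>y. \<bar>E y / a\<bar> * (1 + norm y) powr (- N) \<partial>lborel) \<le> \<eta>"
      using E(3) a(1) by (simp add: abs_divide field_simps)
    then have "C * (\<integral>y. \<bar>E y / a\<bar> * (1 + norm y) powr (- N) \<partial>lborel) \<le> e"
      using C(1) \<eta>(2) by (meson mult_left_mono order_trans)
    then have Pe: "\<bar>P x\<bar> \<le> e \<and> \<bar>dir_deriv i P x\<bar> \<le> e \<and> \<bar>dir_deriv i (dir_deriv j P) x\<bar> \<le> e"
      if "x \<in> S" "i \<in> Basis" "j \<in> Basis" for x i j
      using C(2)[OF PE that] unfolding P_def by linarith
    have smP: "smooth_on S P" unfolding P_def by (rule smooth_on_potential[OF S N0 PE])
    have KS: "K x = c * (P x - \<Phi> x)" if "x \<in> S" for x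
    proof -
      have eq: "u x powr (- (q * (p - 1))) = 1 / a" unfolding u(3)[OF that] a_def powr_minus by (simp add: divide_inverse)
      show ?thesis unfolding K_def eq LS[OF that] a(2) P using a(1) by (simp add: field_simps)
    qed
    have "smooth_on UNIV (\<lambda>x. u x powr (- (q * (p - 1))))"
      using smooth_on_compose[OF open_UNIV smooth_on_powr_real u(1)] u(2) by simp
    then have "smooth K"
      unfolding K_def[abs_def] by (intro smooth_on_imp_smooth smooth_on_mult L) auto
    moreover have "- C0 \<le> K x \<and> K x \<le> - c0 \<and> c0 \<le> norm (grad K x) \<and> norm (grad K x) \<le> C0 \<and> norm (hess K x) \<le> C0"
      if "x \<in> ball 0 2" for x
    proof -
      have x: "x \<in> cball 0 2" "x \<in> S" using that sub by auto
      note b = perturbed_bounds[OF S(1) x(2) assms(1) smP sm\<Phi> KS Pe[OF x(2)] M[OF x(2)], folded T_def, simplified]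
      have "c * (e - \<Phi> x) \<le> c * (- m / 2)" using m(2)[OF x(1)] e(2) assms(1) by (intro mult_left_mono) auto
      then have 1: "K x \<le> - c0" using b(2) by (simp add: c0_def)
      have nx: "norm (x - x0) \<le> 6" using norm_triangle_ineq4[of x x0] x(1) x0 by simp
      have "CARD('n) * e * norm (x - x0) \<le> CARD('n) * e * 6" using e(1) nx by (intro mult_left_mono) auto
      then have "g / 2 \<le> \<bar>dir_deriv (x - x0) \<Phi> x\<bar> - CARD('n) * e * norm (x - x0)"
        using g(2)[OF x(1), unfolded \<gamma>_def] eg by linarith
      then have "c * (g / 2) \<le> c * (\<bar>dir_deriv (x - x0) \<Phi> x\<bar> - CARD('n) * e * norm (x - x0))"
        using assms(1) by (intro mult_left_mono) auto
      also have "\<dots> \<le> CARD('n) * norm (grad K x) * norm (x - x0)" by (rule b(5))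
      also have "\<dots> \<le> CARD('n) * norm (grad K x) * 6" using nx by (intro mult_left_mono) auto
      finally have "c * g / (12 * CARD('n)) \<le> norm (grad K x)" by (simp add: field_simps)
      then have "c0 \<le> norm (grad K x)" by (simp add: c0_def)
      then show ?thesis using 1 b(1,3,4) C0 by auto
    qed
    moreover have "K x * u x powr (q * (p - 1)) = L x" for x
      unfolding K_def powr_minus using u(2)[of x] by simp
    moreover have "u x = v" if "x \<in> cball 0 1" for x using that by (intro u(3)) (auto simp: S_def)
    ultimately show ?thesis
      using smooth_on_imp_smooth[OF u(1)] u(2,4) L(2) by - (rule exI[of _ K], rule exI[of _ u], simp)
  qed
  \<comment> \<open>The values \<open>real j + 2\<close> respect the requirement
    \<open>v \<ge> 2\<close> and tend to infinity.\<close>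
  then have "\<forall>j. \<exists>K u. smooth K \<and> (\<forall>x\<in>ball 0 2. - C0 \<le> K x \<and> K x \<le> - c0 \<and> c0 \<le> norm (grad K x) \<and>
      norm (grad K x) \<le> C0 \<and> norm (hess K x) \<le> C0) \<and> smooth u \<and> (\<forall>x. u x > 0) \<and>
      (\<forall>x. has_frac_p_laplacian c \<sigma> p u x (K x * u x powr (q * (p - 1)))) \<and>
      ((\<lambda>x. norm x powr s * u x) \<longlongrightarrow> 1) at_infinity \<and> (\<forall>x\<in>cball (0 :: real ^ 'n) 1. u x = real j + 2)"
    by simp
  from this[THEN choice] obtain K where "\<forall>j. \<exists>u. smooth (K j) \<and> (\<forall>x\<in>ball 0 2. - C0 \<le> K j x \<and> K j x \<le> - c0 \<and> c0 \<le> norm (grad (K j) x) \<and>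
      norm (grad (K j) x) \<le> C0 \<and> norm (hess (K j) x) \<le> C0) \<and> smooth u \<and> (\<forall>x. u x > 0) \<and>
      (\<forall>x. has_frac_p_laplacian c \<sigma> p u x (K j x * u x powr (q * (p - 1)))) \<and>
      ((\<lambda>x. norm x powr s * u x) \<longlongrightarrow> 1) at_infinity \<and> (\<forall>x\<in>cball (0 :: real ^ 'n) 1. u x = real j + 2)" ..
  from this[THEN choice] obtain u where Ku: "\<forall>j. smooth (K j) \<and> (\<forall>x\<in>ball 0 2. - C0 \<le> K j x \<and> K j x \<le> - c0 \<and> c0 \<le> norm (grad (K j) x) \<and>
      norm (grad (K j) x) \<le> C0 \<and> norm (hess (K j) x) \<le> C0) \<and> smooth (u j) \<and> (\<forall>x. u j x > 0) \<and>
      (\<forall>x. has_frac_p_laplacian c \<sigma> p (u j) x (K j x * u j x powr (q * (p - 1)))) \<and>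
      ((\<lambda>x. norm x powr s * u j x) \<longlongrightarrow> 1) at_infinity \<and> (\<forall>x\<in>cball (0 :: real ^ 'n) 1. u j x = real j + 2)" ..
  have "(\<lambda>j. INF x\<in>cball 0 1. u j x) = (\<lambda>j. 2 + real j)"
  proof
    fix j
    have "(INF x\<in>cball 0 1. u j x) = (INF x\<in>cball (0 :: real ^ 'n) 1. 2 + real j)"
      using Ku by (intro INF_cong) auto
    then show "(INF x\<in>cball 0 1. u j x) = 2 + real j" by simp
  qed
  moreover have "filterlim (\<lambda>j. 2 + real j) at_top sequentially"
    by (rule filterlim_tendsto_add_at_top[OF tendsto_const filterlim_real_sequentially])
  ultimately have lim: "filterlim (\<lambda>j. INF x\<in>cball 0 1. u j x) at_top sequentially" by simp
  have "c0 > 0" "C0 > 0" using assms(1) m(1) g(1) C0(1) T by (simp_all add: c0_def)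
  then show ?thesis
    using Ku lim by - (rule exI[of _ c0], rule exI[of _ C0], (rule conjI, assumption)+, rule exI[of _ K], rule exI[of _ u], blast)
qed

end
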